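(* Let $\mu$ be a finite positive Borel measure on $\mathbb{T}$ and let $\lambda\in\mathbb{T}$. Then $$c_\mu(\{\lambda\})=0\iff\int_0^1\frac{dx}{(1-x)P[\mu](x\lambda)+(1-x)^2}=\infty.$$
   Context: $\mathbb{T}$ is the unit circle; $L^2(\mathbb{T})$ is taken with respect to $dt/2\pi$. $P[\mu](z)=\int_{\mathbb{T}}\frac{1-|z|^2}{|\zeta-z|^2}\,d\mu(\zeta)$ for $|z|<1$. For $f\in L^2(\mathbb{T})$ put $$\mathcal{D}_\mu(f)=\int_{\mathbb{T}}\left(\int_{\mathbb{T}}\frac{|f(e^{it})-f(\xi)|^2}{|e^{it}-\xi|^2}\frac{dt}{2\pi}\right)d\mu(\xi),$$ where $f(\xi)$ is the non-tangential limit at $\xi$ of the Poisson integral of $f$ (the inner integral is $+\infty$ where this limit does not exist), and $\mathcal{D}^h(\mu)=\{f\in L^2(\mathbb{T}):\|f\|_\mu^2:=\|f\|_{L^2(\mathbb{T})}^2+\mathcal{D}_\mu(f)<\infty\}$. For $U\subset\mathbb{T}$ open, $c_\mu(U)=\inf\{\|u\|_\mu^2: u\in\mathcal{D}^h(\mu),\ u\ge0,\ u\ge1\text{ a.e. on }U\}$; for any $F\subset\mathbb{T}$, $c_\mu(F)=\inf\{c_\mu(U):U\text{ open},\ F\subset U\}$. *)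

theory Defs
  imports "HOL-Analysis.Analysis"
begin

abbreviation circle :: "complex set" where
  "circle \<equiv> sphere 0 1"

abbreviation circle_borel :: "complex measure" where
  "circle_borel \<equiv> restrict_space borel circle"

text \<open>Normalised arc length \<open>dt / (2 \<pi>)\<close> on the unit circle.\<close>

definition arc_measure :: "complex measure" where
  "arc_measure = distr (uniform_measure lborel {0..<2 * pi}) circle_borel cis"

definition poisson_kernel :: "complex \<Rightarrow> complex \<Rightarrow> real" where
  "poisson_kernel z \<zeta> = (1 - (cmod z)\<^sup>2) / (cmod (\<zeta> - z))\<^sup>2"

text \<open>No normalising constant here, whereas the Poisson integral of a function is that of
  the complex measure \<open>f dt / (2 \<pi>)\<close>.\<close>

definition poisson_measure :: "complex measure \<Rightarrow> complex \<Rightarrow> real" where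
  "poisson_measure \<mu> z = (\<integral>\<zeta>. poisson_kernel z \<zeta> \<partial>\<mu>)"

definition poisson_fun :: "(complex \<Rightarrow> complex) \<Rightarrow> complex \<Rightarrow> complex" where
  "poisson_fun f z = (\<integral>\<zeta>. poisson_kernel z \<zeta> *\<^sub>R f \<zeta> \<partial>arc_measure)"

definition stolz_region :: "complex \<Rightarrow> real \<Rightarrow> complex set" where
  "stolz_region \<xi> \<kappa> = {z. cmod z < 1 \<and> cmod (z - \<xi>) < \<kappa> * (1 - cmod z)}"

definition has_nt_limit :: "(complex \<Rightarrow> complex) \<Rightarrow> complex \<Rightarrow> complex \<Rightarrow> bool" where
  "has_nt_limit g \<xi> L \<longleftrightarrow> (\<forall>\<kappa>>1. (g \<longlongrightarrow> L) (at \<xi> within stolz_region \<xi> \<kappa>))"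

definition nt_limit :: "(complex \<Rightarrow> complex) \<Rightarrow> complex \<Rightarrow> complex" where
  "nt_limit g \<xi> = (THE L. has_nt_limit g \<xi> L)"

text \<open>Elements of \<open>L\<^sup>2\<close> are represented by Borel functions; only values on the circle matter,
  and everything below depends only on the almost-everywhere class. In particular, the value
  subtracted in the local Dirichlet integral is the boundary value of the Poisson integral
  and not the value of the chosen representative. The zero denominator at \<open>\<zeta> = \<xi>\<close> occurs
  on a null set.\<close>

definition L2_circle :: "(complex \<Rightarrow> complex) set" where
  "L2_circle = {f \<in> borel_measurable arc_measure.
     (\<integral>\<^sup>+\<zeta>. ennreal ((cmod (f \<zeta>))\<^sup>2) \<partial>arc_measure) < \<infinity>}"

definition local_dirichlet :: "complex \<Rightarrow> (complex \<Rightarrow> complex) \<Rightarrow> ennreal" where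
  "local_dirichlet \<xi> f =
     (if \<exists>L. has_nt_limit (poisson_fun f) \<xi> L
      then \<integral>\<^sup>+\<zeta>. ennreal ((cmod (f \<zeta> - nt_limit (poisson_fun f) \<xi>))\<^sup>2 / (cmod (\<zeta> - \<xi>))\<^sup>2)
             \<partial>arc_measure
      else \<infinity>)"

definition dirichlet_integral :: "complex measure \<Rightarrow> (complex \<Rightarrow> complex) \<Rightarrow> ennreal" where
  "dirichlet_integral \<mu> f = (\<integral>\<^sup>+\<xi>. local_dirichlet \<xi> f \<partial>\<mu>)"

definition dirichlet_norm_sq :: "complex measure \<Rightarrow> (complex \<Rightarrow> complex) \<Rightarrow> ennreal" where
  "dirichlet_norm_sq \<mu> f =
     (\<integral>\<^sup>+\<zeta>. ennreal ((cmod (f \<zeta>))\<^sup>2) \<partial>arc_measure) + dirichlet_integral \<mu> f"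

definition harmonic_dirichlet_space :: "complex measure \<Rightarrow> (complex \<Rightarrow> complex) set" where
  "harmonic_dirichlet_space \<mu> = {f \<in> L2_circle. dirichlet_norm_sq \<mu> f < \<infinity>}"

definition open_capacity :: "complex measure \<Rightarrow> complex set \<Rightarrow> ennreal" where
  "open_capacity \<mu> U =
     Inf {dirichlet_norm_sq \<mu> u | u. u \<in> harmonic_dirichlet_space \<mu> \<and>
       (AE \<zeta> in arc_measure. u \<zeta> \<in> \<real> \<and> 0 \<le> Re (u \<zeta>)) \<and>
       (AE \<zeta> in arc_measure. \<zeta> \<in> U \<longrightarrow> 1 \<le> Re (u \<zeta>))}"

definition capacity :: "complex measure \<Rightarrow> complex set \<Rightarrow> ennreal" where
  "capacity \<mu> F = Inf {open_capacity \<mu> U | U. openin (top_of_set circle) U \<and> F \<subseteq> U}"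

end

(* Write a(\<xi>) for the angle between \<xi> and lam.

   Divergence implies zero capacity: the weight s P[\<mu>]((1 - s) lam) + s^2 is at least Q(s), the
   \<mu>-integral of (s / (a + s))^2 plus s^2. For a density w on (0, 1] and u(\<zeta>) the integral of w over
   (a(\<zeta>), 1), Hardy's inequality on either side of a(\<xi>) bounds the local Dirichlet integral of u at \<xi>
   by a constant times the integral of w(s)^2 (s / (a(\<xi>) + s))^2, so the squared norm of u is at most a
   constant times the integral of w^2 Q. The choice w = 1 / Q on [d, 1], normalised to mass 1, gives
   squared norm O(1 / J), where J is the integral of 1 / Q over [d, 1].

   Convergence implies positive capacity: let V be the derivative of the Poisson integral of u along the
   radius through lam. A constant may be subtracted from u under the differentiated kernel, and a
   Hilbert-type inequality then bounds the integral of V^2 (1 - x) P_\<xi>(x lam) by a constant times the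
   local Dirichlet integral at \<xi>, uniformly in \<xi>. Hence the integral of V^2 times
   (1 - x) P[\<mu>](x lam) + (1 - x)^2 is bounded by the squared norm of u. The lower limit of the Poisson
   integral along the radius is at least 1, so AM-GM bounds that norm from below. *)
theory Submission
  imports Defs
begin

text \<open>Both directions rest on one comparison: \<open>s * P_\<xi>((1 - s) lam)\<close> and
  \<open>(s / (a(\<xi>) + s))^2\<close> agree up to constants, so the two estimates are dual to each
  other.

  For the upper bound, \<open>1 / Q\<close> is, up to scaling, the minimiser of the integral of
  \<open>w^2 Q\<close> at fixed mass, by Cauchy-Schwarz. Cutting it off below \<open>d\<close>
  serves three ends: the mass is finite, \<open>u\<close> is constantly 1 on the arc
  \<open>a < d\<close>, and \<open>u\<close> is Lipschitz, so that the boundary value in every local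
  Dirichlet integral is simply \<open>u \<xi>\<close>. The Hardy inequality on the side of
  \<open>lam\<close> must keep the gain \<open>(s / a)^2\<close>; the unweighted form would lose the
  decay in \<open>a(\<xi>)\<close> and with it the link to \<open>P[\<mu>]\<close>.

  For the lower bound the competitors are arbitrary and the neighbourhoods shrink, so the estimate
  must not depend on the neighbourhood. The radius provides this: the Poisson integral at
  \<open>r lam\<close> is the mean of \<open>u\<close> plus the integral of \<open>V\<close> over
  \<open>[0, r]\<close>, and both are bounded through the norm. The subtracted constant costs
  nothing because the differentiated kernel has mean zero, so it can be taken from the nontangential
  limit at \<xi>, whatever its value.\<close>

section \<open>Hardy inequalities\<close>

text \<open>Cauchy-Schwarz in \<open>s\<close> after the splitting
  \<open>K = sqrt (K * p) * sqrt (K / p)\<close>: the row bound removes the second factor, and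
  Tonelli leaves the column integral. The bound \<open>B\<close> may vary with \<open>s\<close>, so
  that weighted inequalities such as \<open>hardy_left\<close> come out of the same test.\<close>

lemma schur_test:
  fixes K :: "'b \<Rightarrow> 'a \<Rightarrow> real" and p :: "'a \<Rightarrow> real" and A :: "'b \<Rightarrow> real"
    and g B :: "'a \<Rightarrow> ennreal"
  assumes "sigma_finite_measure M" "sigma_finite_measure N"
  assumes K[measurable]: "case_prod K \<in> borel_measurable (N \<Otimes>\<^sub>M M)"
    and p[measurable]: "p \<in> borel_measurable M"
    and A[measurable]: "A \<in> borel_measurable N"
    and g[measurable]: "g \<in> borel_measurable M"
  assumes K0: "\<And>b s. 0 \<le> K b s" and p0: "\<And>b s. K b s \<noteq> 0 \<Longrightarrow> 0 < p s" and A0: "\<And>b. 0 \<le> A b"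
  assumes row: "\<And>b. (\<integral>\<^sup>+s. ennreal (K b s / p s) \<partial>M) \<le> ennreal (A b)"
    and col: "\<And>s. s \<in> space M \<Longrightarrow> (\<integral>\<^sup>+b. ennreal (K b s * A b) \<partial>N) * ennreal (p s) \<le> B s"
  shows "(\<integral>\<^sup>+b. (\<integral>\<^sup>+s. g s * ennreal (K b s) \<partial>M)\<^sup>2 \<partial>N) \<le> (\<integral>\<^sup>+s. (g s)\<^sup>2 * B s \<partial>M)"
proof -
  interpret M: sigma_finite_measure M by fact
  interpret N: sigma_finite_measure N by fact
  interpret P: pair_sigma_finite N M ..
  have row': "(\<integral>\<^sup>+s. g s * ennreal (K b s) \<partial>M)\<^sup>2 \<le>
      (\<integral>\<^sup>+s. (g s)\<^sup>2 * (ennreal (K b s * A b) * ennreal (p s)) \<partial>M)" if b: "b \<in> space N" for b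
  proof -
    have [measurable]: "K b \<in> borel_measurable M"
      using measurable_compose[OF measurable_Pair1'[OF b] K] by simp
    have split: "ennreal (K b s) = ennreal (sqrt (K b s * p s)) * ennreal (sqrt (K b s / p s))" for s
      by (cases "K b s = 0")
        (use K0[of b s] p0[of b s] in \<open>auto simp: ennreal_mult[symmetric] real_sqrt_mult[symmetric] power2_eq_square[symmetric]\<close>)
    have sq1: "(ennreal (sqrt (K b s * p s)))\<^sup>2 = ennreal (K b s) * ennreal (p s)" for s
      by (cases "K b s = 0")
        (use K0[of b s] p0[of b s] in \<open>auto simp: ennreal_power ennreal_mult\<close>)
    have sq2: "(ennreal (sqrt (K b s / p s)))\<^sup>2 = ennreal (K b s / p s)" for s
      by (cases "K b s = 0")
        (use K0[of b s] p0[of b s] in \<open>auto simp: ennreal_power\<close>)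
    have "(\<integral>\<^sup>+s. g s * ennreal (K b s) \<partial>M)\<^sup>2 =
        (\<integral>\<^sup>+s. (g s * ennreal (sqrt (K b s * p s))) * ennreal (sqrt (K b s / p s)) \<partial>M)\<^sup>2"
      by (subst split) (simp add: mult.assoc)
    also have "\<dots> \<le> (\<integral>\<^sup>+s. (g s * ennreal (sqrt (K b s * p s)))\<^sup>2 \<partial>M) *
        (\<integral>\<^sup>+s. (ennreal (sqrt (K b s / p s)))\<^sup>2 \<partial>M)"
      by (rule Cauchy_Schwarz_nn_integral) measurable
    also have "\<dots> = (\<integral>\<^sup>+s. (g s)\<^sup>2 * (ennreal (K b s) * ennreal (p s)) \<partial>M) * (\<integral>\<^sup>+s. ennreal (K b s / p s) \<partial>M)"
      by (simp add: power_mult_distrib sq1 sq2)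
    also have "\<dots> \<le> (\<integral>\<^sup>+s. (g s)\<^sup>2 * (ennreal (K b s) * ennreal (p s)) \<partial>M) * ennreal (A b)"
      by (intro mult_left_mono row) simp
    also have "\<dots> = (\<integral>\<^sup>+s. (g s)\<^sup>2 * (ennreal (K b s * A b) * ennreal (p s)) \<partial>M)"
      by (subst nn_integral_multc[symmetric]) (auto simp: ennreal_mult K0 A0 mult_ac)
    finally show ?thesis .
  qed
  have "(\<integral>\<^sup>+b. (\<integral>\<^sup>+s. g s * ennreal (K b s) \<partial>M)\<^sup>2 \<partial>N) \<le>
      (\<integral>\<^sup>+b. (\<integral>\<^sup>+s. (g s)\<^sup>2 * (ennreal (K b s * A b) * ennreal (p s)) \<partial>M) \<partial>N)"
    by (intro nn_integral_mono row')
  also have "\<dots> = (\<integral>\<^sup>+s. (\<integral>\<^sup>+b. (g s)\<^sup>2 * (ennreal (K b s * A b) * ennreal (p s)) \<partial>N) \<partial>M)"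
    by (rule P.Fubini'[symmetric]) measurable
  also have "\<dots> \<le> (\<integral>\<^sup>+s. (g s)\<^sup>2 * B s \<partial>M)"
  proof (intro nn_integral_mono)
    fix s assume s: "s \<in> space M"
    have [measurable]: "(\<lambda>b. K b s) \<in> borel_measurable N"
      using measurable_compose[OF measurable_Pair2'[OF s] K] by simp
    have "(\<integral>\<^sup>+b. (g s)\<^sup>2 * (ennreal (K b s * A b) * ennreal (p s)) \<partial>N) =
       (g s)\<^sup>2 * ((\<integral>\<^sup>+b. ennreal (K b s * A b) \<partial>N) * ennreal (p s))"
      by (simp add: nn_integral_cmult nn_integral_multc)
    also have "\<dots> \<le> (g s)\<^sup>2 * B s" by (intro mult_left_mono col s) simp
    finally show "(\<integral>\<^sup>+b. (g s)\<^sup>2 * (ennreal (K b s * A b) * ennreal (p s)) \<partial>N) \<le> (g s)\<^sup>2 * B s" .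
  qed
  finally show ?thesis .
qed

text \<open>The derivative is asked for only inside the interval because several antiderivatives
  below are square roots whose derivative blows up at an end point.\<close>

lemma nn_integral_FTC_interior:
  fixes F f :: "real \<Rightarrow> real"
  assumes "a \<le> b" "continuous_on {a..b} F"
    and deriv: "\<And>x. a < x \<Longrightarrow> x < b \<Longrightarrow> (F has_real_derivative f x) (at x)"
    and nonneg: "\<And>x. a < x \<Longrightarrow> x < b \<Longrightarrow> 0 \<le> f x"
    and [measurable]: "f \<in> borel_measurable borel"
  shows "(\<integral>\<^sup>+x. ennreal (f x) * indicator {a<..<b} x \<partial>lborel) = ennreal (F b - F a)"
proof -
  have "(f has_integral F b - F a) {a..b}"
    using assms by (intro fundamental_theorem_of_calculus_interior)
      (auto simp: has_real_derivative_iff_has_vector_derivative)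
  then have "(f has_integral F b - F a) {a<..<b}"
    by (simp add: has_integral_Icc_iff_Ioo)
  then have "((\<lambda>x. if x \<in> {a<..<b} then f x else 0) has_integral F b - F a) UNIV"
    by (simp only: has_integral_restrict_UNIV)
  then have "(\<integral>\<^sup>+x. ennreal (if x \<in> {a<..<b} then f x else 0) \<partial>lborel) = ennreal (F b - F a)"
    by (intro nn_integral_has_integral_lborel) (auto simp: nonneg)
  moreover have "ennreal (if x \<in> {a<..<b} then f x else 0) = ennreal (f x) * indicator {a<..<b} x" for x
    by (auto simp: indicator_def)
  ultimately show ?thesis by simp
qed

text \<open>Hardy's inequality for the averages of \<open>g\<close> over \<open>{a<..<b}\<close>.
  The Schur weight \<open>sqrt (s - a)\<close> gives row sums \<open>2 / sqrt (b - a)\<close> and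
  column sums at most \<open>4 / sqrt (s - a)\<close>, hence the classical constant 4; stopping at
  \<open>c\<close> only drops a nonnegative part of each column.\<close>

lemma hardy_right:
  fixes g :: "real \<Rightarrow> ennreal"
  assumes [measurable]: "g \<in> borel_measurable borel"
  shows "(\<integral>\<^sup>+b. (\<integral>\<^sup>+s. g s * ennreal (indicator {a<..<b} s / (b - a) * indicator {a<..<c} b) \<partial>lborel)\<^sup>2 \<partial>lborel)
     \<le> 4 * (\<integral>\<^sup>+s. (g s)\<^sup>2 * indicator {a<..<c} s \<partial>lborel)"
proof -
  \<comment> \<open>A conditional in place of indicators of intervals with moving end points makes
    the joint measurability of the kernel evident.\<close>
  define K where "K = (\<lambda>b s. if a < s \<and> s < b \<and> b < c then 1 / (b - a) else 0 :: real)"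
  have Keq: "indicator {a<..<b} s / (b - a) * indicator {a<..<c} b = K b s" for b s
    by (auto simp: K_def indicator_def)
  have "(\<integral>\<^sup>+b. (\<integral>\<^sup>+s. g s * ennreal (K b s) \<partial>lborel)\<^sup>2 \<partial>lborel) \<le>
     (\<integral>\<^sup>+s. (g s)\<^sup>2 * (4 * indicator {a<..<c} s) \<partial>lborel)"
  proof (rule schur_test[where p = "\<lambda>s. sqrt (s - a)" and A = "\<lambda>b. if a < b \<and> b < c then 2 / sqrt (b - a) else 0"])
    fix b
    show "(\<integral>\<^sup>+s. ennreal (K b s / sqrt (s - a)) \<partial>lborel) \<le> ennreal (if a < b \<and> b < c then 2 / sqrt (b - a) else 0)"
    proof (cases "a < b \<and> b < c")
      case True
      then have "(\<integral>\<^sup>+s. ennreal (K b s / sqrt (s - a)) \<partial>lborel) =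
          (\<integral>\<^sup>+s. ennreal (1 / ((b - a) * sqrt (s - a))) * indicator {a<..<b} s \<partial>lborel)"
        by (intro nn_integral_cong) (auto simp: K_def indicator_def)
      also have "\<dots> = ennreal (2 * sqrt (b - a) / (b - a) - 2 * sqrt (a - a) / (b - a))"
        using True by (intro nn_integral_FTC_interior)
          (auto intro!: continuous_intros derivative_eq_intros simp: divide_simps)
      also have "2 * sqrt (b - a) / (b - a) - 2 * sqrt (a - a) / (b - a) = 2 / sqrt (b - a)"
        using True by (simp add: field_simps)
      finally show ?thesis using True by simp
    next
      case False
      then have "K b s = 0" for s by (auto simp: K_def)
      then show ?thesis by simp
    qed
  next
    fix s :: real
    show "(\<integral>\<^sup>+b. ennreal (K b s * (if a < b \<and> b < c then 2 / sqrt (b - a) else 0)) \<partial>lborel) * ennreal (sqrt (s - a))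
       \<le> 4 * indicator {a<..<c} s"
    proof (cases "a < s \<and> s < c")
      case True
      have "(\<integral>\<^sup>+b. ennreal (K b s * (if a < b \<and> b < c then 2 / sqrt (b - a) else 0)) \<partial>lborel) =
          (\<integral>\<^sup>+b. ennreal (2 / ((b - a) * sqrt (b - a))) * indicator {s<..<c} b \<partial>lborel)"
        using True by (intro nn_integral_cong) (auto simp: K_def indicator_def)
      also have "\<dots> = ennreal (- 4 / sqrt (c - a) - (- 4 / sqrt (s - a)))"
        using True by (intro nn_integral_FTC_interior)
          (auto intro!: continuous_intros derivative_eq_intros simp: divide_simps)
      also have "\<dots> \<le> ennreal (4 / sqrt (s - a))"
        using True by (intro ennreal_leI) auto
      finally have "(\<integral>\<^sup>+b. ennreal (K b s * (if a < b \<and> b < c then 2 / sqrt (b - a) else 0)) \<partial>lborel) * ennreal (sqrt (s - a))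
          \<le> ennreal (4 / sqrt (s - a)) * ennreal (sqrt (s - a))"
        by (intro mult_right_mono) auto
      also have "\<dots> = 4" using True by (simp add: ennreal_mult[symmetric])
      finally show ?thesis using True by simp
    next
      case False
      then have "K b s = 0" for b by (auto simp: K_def)
      then show ?thesis by simp
    qed
  qed (auto simp: K_def lborel.sigma_finite_measure_axioms split: if_splits)
  also have "\<dots> = 4 * (\<integral>\<^sup>+s. (g s)\<^sup>2 * indicator {a<..<c} s \<partial>lborel)"
    by (subst nn_integral_cmult[symmetric]) (auto simp: mult_ac)
  finally show ?thesis unfolding Keq .
qed

text \<open>The weight \<open>sqrt (s ^ 3 * (a - s))\<close> comes from the weight \<open>sqrt (s - a)\<close> of \<open>hardy_right\<close>
  by the inversion \<open>s \<mapsto> 1 / s\<close>.\<close>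
lemma hardy_left:
  fixes g :: "real \<Rightarrow> ennreal"
  assumes [measurable]: "g \<in> borel_measurable borel" and "0 < a"
  shows "(\<integral>\<^sup>+b. (\<integral>\<^sup>+s. g s * ennreal (indicator {b<..<a} s / (a - b) * indicator {0<..<a} b) \<partial>lborel)\<^sup>2 \<partial>lborel)
     \<le> (\<integral>\<^sup>+s. (g s)\<^sup>2 * ennreal (4 * s\<^sup>2 / a\<^sup>2 * indicator {0<..<a} s) \<partial>lborel)"
proof -
  define K where "K = (\<lambda>b s. if b < s \<and> s < a \<and> 0 < b then 1 / (a - b) else 0 :: real)"
  have Keq: "indicator {b<..<a} s / (a - b) * indicator {0<..<a} b = K b s" for b s
    by (auto simp: K_def indicator_def)
  \<comment> \<open>Under \<open>s = 1 / \<sigma>\<close> the quotient \<open>(a - s) / s\<close>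
    becomes \<open>a * \<sigma> - 1\<close>, so this is the square root antiderivative of
    \<open>hardy_right\<close> in the inverted variable.\<close>
  have d1: "((\<lambda>s. - (2 / (a * (a - b))) * sqrt ((a - s) / s)) has_real_derivative
       1 / (a - b) / sqrt (s ^ 3 * (a - s))) (at s)" if "0 < s" "s < a" "b < a" for s b
  proof -
    have "sqrt (s ^ 3 * (a - s)) = s\<^sup>2 * sqrt ((a - s) / s)"
    proof -
      have "sqrt (s ^ 3 * (a - s)) = sqrt ((s\<^sup>2)\<^sup>2 * ((a - s) / s))"
        using that by (intro arg_cong[where f = sqrt]) (simp add: field_simps power2_eq_square power3_eq_cube)
      also have "\<dots> = s\<^sup>2 * sqrt ((a - s) / s)"
        by (simp only: real_sqrt_mult real_sqrt_power[symmetric] real_sqrt_abs abs_power2)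
      finally show ?thesis .
    qed
    then show ?thesis
      using that assms(2) by (auto intro!: derivative_eq_intros simp: divide_simps power2_eq_square)
  qed
  have d2: "((\<lambda>b. 4 / a\<^sup>2 * sqrt (b / (a - b))) has_real_derivative
       1 / (a - b) * (2 / (a * (a - b)) * sqrt ((a - b) / b))) (at b)" if "0 < b" "b < a" for b
  proof -
    have "((\<lambda>b. 4 / a\<^sup>2 * sqrt (b / (a - b))) has_real_derivative
        4 / a\<^sup>2 * (inverse (sqrt (b / (a - b))) / 2 * (a / (a - b)\<^sup>2))) (at b)"
      using that divide_pos_pos[of b "a - b"] order.asym[of 0 "b / (a - b)"]
      by (auto intro!: derivative_eq_intros simp: power2_eq_square)
    moreover have "inverse (sqrt (b / (a - b))) = sqrt ((a - b) / b)"
      by (simp add: real_sqrt_inverse[symmetric])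
    moreover have "4 / a\<^sup>2 * (r / 2 * (a / (a - b)\<^sup>2)) = 1 / (a - b) * (2 / (a * (a - b)) * r)" for r
      using that assms(2) by (simp add: divide_simps power2_eq_square)
    ultimately show ?thesis by metis
  qed
  have "(\<integral>\<^sup>+b. (\<integral>\<^sup>+s. g s * ennreal (K b s) \<partial>lborel)\<^sup>2 \<partial>lborel) \<le>
     (\<integral>\<^sup>+s. (g s)\<^sup>2 * ennreal (4 * s\<^sup>2 / a\<^sup>2 * indicator {0<..<a} s) \<partial>lborel)"
  proof (rule schur_test[where p = "\<lambda>s. sqrt (s ^ 3 * (a - s))"
        and A = "\<lambda>b. if 0 < b \<and> b < a then 2 / (a * (a - b)) * sqrt ((a - b) / b) else 0"])
    fix b
    show "(\<integral>\<^sup>+s. ennreal (K b s / sqrt (s ^ 3 * (a - s))) \<partial>lborel) \<le>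
       ennreal (if 0 < b \<and> b < a then 2 / (a * (a - b)) * sqrt ((a - b) / b) else 0)"
    proof (cases "0 < b \<and> b < a")
      case True
      then have "(\<integral>\<^sup>+s. ennreal (K b s / sqrt (s ^ 3 * (a - s))) \<partial>lborel) =
          (\<integral>\<^sup>+s. ennreal (1 / (a - b) / sqrt (s ^ 3 * (a - s))) * indicator {b<..<a} s \<partial>lborel)"
        by (intro nn_integral_cong) (auto simp: K_def indicator_def)
      also have "\<dots> = ennreal (- (2 / (a * (a - b))) * sqrt ((a - a) / a) - - (2 / (a * (a - b))) * sqrt ((a - b) / b))"
        using True by (intro nn_integral_FTC_interior d1) (auto intro!: continuous_intros)
      finally show ?thesis using True by simp
    next
      case False
      then have "K b s = 0" for s by (auto simp: K_def)
      then show ?thesis by simp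
    qed
  next
    fix s :: real
    show "(\<integral>\<^sup>+b. ennreal (K b s * (if 0 < b \<and> b < a then 2 / (a * (a - b)) * sqrt ((a - b) / b) else 0)) \<partial>lborel)
         * ennreal (sqrt (s ^ 3 * (a - s)))
       \<le> ennreal (4 * s\<^sup>2 / a\<^sup>2 * indicator {0<..<a} s)"
    proof (cases "0 < s \<and> s < a")
      case True
      \<comment> \<open>Since \<open>b\<close> is positive, a mass at \<open>s\<close> is seen only
        from \<open>b\<close> in \<open>{0<..<s}\<close>. This short range is the source of the gain
        \<open>s\<^sup>2 / a\<^sup>2\<close> over the unweighted inequality.\<close>
      have "(\<integral>\<^sup>+b. ennreal (K b s * (if 0 < b \<and> b < a then 2 / (a * (a - b)) * sqrt ((a - b) / b) else 0)) \<partial>lborel) =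
          (\<integral>\<^sup>+b. ennreal (1 / (a - b) * (2 / (a * (a - b)) * sqrt ((a - b) / b))) * indicator {0<..<s} b \<partial>lborel)"
        using True by (intro nn_integral_cong) (auto simp: K_def indicator_def)
      also have "\<dots> = ennreal (4 / a\<^sup>2 * sqrt (s / (a - s)) - 4 / a\<^sup>2 * sqrt (0 / (a - 0)))"
        using True by (intro nn_integral_FTC_interior d2) (auto intro!: continuous_intros)
      finally have "(\<integral>\<^sup>+b. ennreal (K b s * (if 0 < b \<and> b < a then 2 / (a * (a - b)) * sqrt ((a - b) / b) else 0)) \<partial>lborel)
          * ennreal (sqrt (s ^ 3 * (a - s)))
          = ennreal (4 / a\<^sup>2 * sqrt (s / (a - s)) * sqrt (s ^ 3 * (a - s)))"
        using True assms(2) by (simp add: ennreal_mult[symmetric])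
      also have "4 / a\<^sup>2 * sqrt (s / (a - s)) * sqrt (s ^ 3 * (a - s)) = 4 / a\<^sup>2 * sqrt ((s\<^sup>2)\<^sup>2)"
        using True by (simp add: real_sqrt_mult[symmetric] mult.assoc) (simp add: eval_nat_numeral)
      also have "sqrt ((s\<^sup>2)\<^sup>2) = s\<^sup>2" by (simp only: real_sqrt_abs abs_power2)
      finally show ?thesis using True by simp
    next
      case False
      then have "K b s = 0" for b by (auto simp: K_def)
      then show ?thesis by simp
    qed
  qed (auto simp: K_def lborel.sigma_finite_measure_axioms assms(2) less_imp_le split: if_splits)
  then show ?thesis unfolding Keq .
qed

section \<open>Integration over the circle by arc distance, and the comparison of arc with
  chord\<close>

section \<open>Arc length and angles\<close>

lemma space_arc_measure[simp]: "space arc_measure = circle"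
  by (simp add: arc_measure_def space_restrict_space)

lemma sets_arc_measure[measurable_cong, simp]: "sets arc_measure = sets circle_borel"
  by (simp add: arc_measure_def)

text \<open>Moving the piece over \<open>{c + p..<p}\<close> back by one period turns one window
  into the other; the piece over \<open>{0..<c + p}\<close> is common to both.\<close>

lemma nn_integral_periodic:
  fixes h :: "real \<Rightarrow> ennreal"
  assumes [measurable]: "h \<in> borel_measurable borel" and per: "\<And>t. h (t + p) = h t"
    and c: "-p \<le> c" "c \<le> 0"
  shows "(\<integral>\<^sup>+t. h t * indicator {c..<c + p} t \<partial>lborel) = (\<integral>\<^sup>+t. h t * indicator {0..<p} t \<partial>lborel)"
proof -
  have "(\<integral>\<^sup>+t. h t * indicator {c + p..<p} t \<partial>lborel) = (\<integral>\<^sup>+t. h t * indicator {c..<0} t \<partial>lborel)"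
    by (subst nn_integral_real_affine[where c = 1 and t = p])
      (auto intro!: nn_integral_cong simp: indicator_def add.commute[of p] per)
  then have "(\<integral>\<^sup>+t. h t * indicator {c..<0} t \<partial>lborel) + (\<integral>\<^sup>+t. h t * indicator {0..<c + p} t \<partial>lborel)
     = (\<integral>\<^sup>+t. h t * indicator {0..<c + p} t \<partial>lborel) + (\<integral>\<^sup>+t. h t * indicator {c + p..<p} t \<partial>lborel)"
    by (simp add: add.commute)
  then have "(\<integral>\<^sup>+t. h t * indicator {c..<0} t + h t * indicator {0..<c + p} t \<partial>lborel)
     = (\<integral>\<^sup>+t. h t * indicator {0..<c + p} t + h t * indicator {c + p..<p} t \<partial>lborel)"
    by (simp add: nn_integral_add)
  also have "(\<lambda>t. h t * indicator {0..<c + p} t + h t * indicator {c + p..<p} t) = (\<lambda>t. h t * indicator {0..<p} t)"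
    using c by (auto simp: indicator_def fun_eq_iff)
  also have "(\<lambda>t. h t * indicator {c..<0} t + h t * indicator {0..<c + p} t) = (\<lambda>t. h t * indicator {c..<c + p} t)"
    using c by (auto simp: indicator_def fun_eq_iff)
  finally show ?thesis .
qed

text \<open>Rotation invariance of arc length, with the parameter window centred at
  \<open>lam\<close> so that the angle from \<open>lam\<close> becomes
  \<open>\<bar>t\<bar>\<close>.\<close>

lemma nn_integral_arc_measure:
  assumes lam: "lam \<in> circle" and F[measurable]: "F \<in> borel_measurable circle_borel"
  shows "(\<integral>\<^sup>+z. F z \<partial>arc_measure) =
    ennreal (1 / (2 * pi)) * (\<integral>\<^sup>+t. F (lam * cis t) * indicator {-pi..<pi} t \<partial>lborel)"
proof -
  have [measurable]: "cis \<in> measurable borel circle_borel"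
    by (intro measurable_restrict_space2 borel_measurable_continuous_onI) (auto intro!: continuous_intros)
  have div: "x / ennreal (2 * pi) = ennreal (1 / (2 * pi)) * x" for x
  proof -
    have "inverse (ennreal (2 * pi)) = ennreal (1 / (2 * pi))"
      by (subst inverse_ennreal) (auto simp: field_simps)
    then show ?thesis by (simp only: divide_ennreal_def mult.commute)
  qed
  have lamcis: "lam = cis (Arg lam)"
    using cis_Arg[of lam] lam by (cases "lam = 0") (auto simp: sgn_div_norm)
  have "(\<integral>\<^sup>+z. F z \<partial>arc_measure) = (\<integral>\<^sup>+t. F (cis t) \<partial>uniform_measure lborel {0..<2 * pi})"
    unfolding arc_measure_def by (intro nn_integral_distr) (auto cong: measurable_cong_sets)
  also have "\<dots> = (\<integral>\<^sup>+t. F (cis t) * indicator {0..<2 * pi} t \<partial>lborel) / ennreal (2 * pi)"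
    by (subst nn_integral_uniform_measure) auto
  \<comment> \<open>\<open>Arg lam\<close> lies in \<open>(-pi, pi]\<close>, so the new window
    starts in \<open>(-2 * pi, 0]\<close>, the range that \<open>nn_integral_periodic\<close>
    admits.\<close>
  also have "(\<integral>\<^sup>+t. F (cis t) * indicator {0..<2 * pi} t \<partial>lborel) =
     (\<integral>\<^sup>+t. F (cis t) * indicator {Arg lam - pi..<Arg lam - pi + 2 * pi} t \<partial>lborel)"
    using mpi_less_Arg[of lam] Arg_le_pi[of lam]
    by (intro nn_integral_periodic[symmetric]) (auto simp: cis_mult[symmetric])
  also have "\<dots> = (\<integral>\<^sup>+t. F (lam * cis t) * indicator {-pi..<pi} t \<partial>lborel)"
    by (subst nn_integral_real_affine[where c = 1 and t = "Arg lam"])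
      (auto intro!: nn_integral_cong simp: indicator_def cis_mult[symmetric] lamcis[symmetric])
  also have "\<dots> / ennreal (2 * pi) = ennreal (1 / (2 * pi)) * \<dots>"
    by (rule div)
  finally show ?thesis .
qed

text \<open>The geodesic distance from \<open>lam\<close> to \<open>z\<close> on the circle. Taken
  unsigned and through the arccosine it is continuous everywhere, whereas a signed argument jumps at
  the antipode of \<open>lam\<close>.\<close>

definition ang :: "complex \<Rightarrow> complex \<Rightarrow> real" where
  "ang lam z = arccos (Re (z * cnj lam))"

lemma Re_mult_cnj_bounds:
  assumes "lam \<in> circle" "z \<in> circle"
  shows "- 1 \<le> Re (z * cnj lam)" "Re (z * cnj lam) \<le> 1"
  using abs_Re_le_cmod[of "z * cnj lam"] assms by (auto simp: norm_mult abs_le_iff)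

lemma ang_bounds:
  assumes "lam \<in> circle" "z \<in> circle"
  shows "0 \<le> ang lam z" "ang lam z \<le> pi" "cos (ang lam z) = Re (z * cnj lam)"
  using Re_mult_cnj_bounds[OF assms] by (auto simp: ang_def arccos_lbound arccos_ubound)

lemma continuous_on_ang: "lam \<in> circle \<Longrightarrow> continuous_on circle (ang lam)"
  unfolding ang_def using Re_mult_cnj_bounds[of lam]
  by (auto intro!: continuous_intros)

lemma ang_measurable: "lam \<in> circle \<Longrightarrow> ang lam \<in> borel_measurable circle_borel"
  by (intro borel_measurable_continuous_on_restrict continuous_on_ang)

lemma ang_cis: "lam \<in> circle \<Longrightarrow> \<bar>t\<bar> \<le> pi \<Longrightarrow> ang lam (lam * cis t) = \<bar>t\<bar>"
proof -
  assume *: "lam \<in> circle" "\<bar>t\<bar> \<le> pi"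
  have "lam * cis t * cnj lam = cis t * (lam * cnj lam)" by simp
  also have "lam * cnj lam = 1" using * by (simp add: complex_norm_square[symmetric])
  finally have "lam * cis t * cnj lam = cis t" by simp
  then have "Re (lam * cis t * cnj lam) = cos t" by (metis cis.sel(1))
  then show ?thesis using * unfolding ang_def by (metis arccos_cos_eq_abs)
qed

lemma circle_eq_cis:
  assumes "lam \<in> circle" "z \<in> circle"
  obtains t where "\<bar>t\<bar> \<le> pi" "z = lam * cis t"
proof
  define w where "w = z * cnj lam"
  have w: "cmod w = 1" using assms by (simp add: w_def norm_mult)
  show "\<bar>Arg w\<bar> \<le> pi" using mpi_less_Arg[of w] Arg_le_pi[of w] by auto
  have "cis (Arg w) = w" using w by (subst cis_Arg) (auto simp: sgn_div_norm)
  then show "z = lam * cis (Arg w)"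
    using assms by (simp add: w_def complex_norm_square[symmetric] mult.assoc mult.left_commute)
qed

text \<open>Every angle strictly between 0 and \<open>pi\<close> is attained at exactly two points,
  \<open>lam * cis b\<close> and \<open>lam * cis (- b)\<close>, which doubles the density
  \<open>1 / (2 * pi)\<close>; the two exceptional points form a null set.\<close>

lemma nn_integral_arc_measure_ang:
  fixes F :: "real \<Rightarrow> ennreal"
  assumes lam: "lam \<in> circle" and [measurable]: "F \<in> borel_measurable borel"
  shows "(\<integral>\<^sup>+z. F (ang lam z) \<partial>arc_measure) = ennreal (1 / pi) * (\<integral>\<^sup>+b. F b * indicator {0<..<pi} b \<partial>lborel)"
proof -
  note [measurable] = ang_measurable[OF lam]
  let ?I = "\<integral>\<^sup>+b. F b * indicator {0<..<pi} b \<partial>lborel"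
  have "AE t in lborel. t \<noteq> 0" "AE t in lborel. t \<noteq> - pi"
    by (rule AE_lborel_singleton)+
  then have "(\<integral>\<^sup>+t. F (ang lam (lam * cis t)) * indicator {-pi..<pi} t \<partial>lborel) =
     (\<integral>\<^sup>+t. F t * indicator {0<..<pi} t + F (- t) * indicator {-pi<..<0} t \<partial>lborel)"
    by (intro nn_integral_cong_AE, eventually_elim) (auto simp: indicator_def ang_cis[OF lam])
  also have "\<dots> = ?I + (\<integral>\<^sup>+t. F (- t) * indicator {-pi<..<0} t \<partial>lborel)"
    by (rule nn_integral_add) auto
  also have "(\<integral>\<^sup>+t. F (- t) * indicator {-pi<..<0} t \<partial>lborel) = ?I"
    by (subst nn_integral_real_affine[where c = "-1" and t = 0])
      (auto intro!: nn_integral_cong simp: indicator_def)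
  finally have *: "(\<integral>\<^sup>+t. F (ang lam (lam * cis t)) * indicator {-pi..<pi} t \<partial>lborel) = 2 * ?I"
    by (simp only: mult_2)
  have "(\<integral>\<^sup>+z. F (ang lam z) \<partial>arc_measure) = ennreal (1 / (2 * pi)) * (2 * ?I)"
    unfolding *[symmetric] by (rule nn_integral_arc_measure[OF lam]) measurable
  also have "\<dots> = ennreal (1 / (2 * pi)) * ennreal 2 * ?I"
    by (simp only: mult.assoc ennreal_numeral)
  also have "ennreal (1 / (2 * pi)) * ennreal 2 = ennreal (1 / pi)"
    by (subst ennreal_mult[symmetric]) auto
  finally show ?thesis .
qed

lemma emeasure_arc_measure: "emeasure arc_measure (space arc_measure) = 1"
proof -
  have "(\<integral>\<^sup>+z. 1 \<partial>arc_measure) = ennreal (1 / pi) * (\<integral>\<^sup>+b. 1 * indicator {0<..<pi} b \<partial>lborel)"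
    by (rule nn_integral_arc_measure_ang[of 1]) auto
  also have "\<dots> = 1" by (simp add: ennreal_mult[symmetric])
  finally show ?thesis by simp
qed

lemma finite_measure_arc_measure: "finite_measure arc_measure"
  using emeasure_arc_measure by (intro finite_measureI) auto

text \<open>Serves to discard the one point at which a kernel or a quotient below divides by
  zero.\<close>

lemma AE_arc_measure_ang_pos:
  assumes lam: "lam \<in> circle"
  shows "AE z in arc_measure. 0 < ang lam z"
proof -
  note [measurable] = ang_measurable[OF lam]
  have "(\<integral>\<^sup>+z. indicator {..0} (ang lam z) \<partial>arc_measure) =
      ennreal (1 / pi) * (\<integral>\<^sup>+b. indicator {..0} b * indicator {0<..<pi} b \<partial>lborel)"
    by (rule nn_integral_arc_measure_ang[OF lam]) auto
  also have "(\<lambda>b::real. indicator {..0} b * indicator {0<..<pi} b :: ennreal) = (\<lambda>b. 0)"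
    by (auto simp: indicator_def)
  finally have "(\<integral>\<^sup>+z. indicator {..0} (ang lam z) \<partial>arc_measure) = 0" by simp
  then have "AE z in arc_measure. indicator {..0} (ang lam z) = (0::ennreal)"
    by (subst (asm) nn_integral_0_iff_AE) auto
  then show ?thesis by (auto elim!: eventually_mono simp: indicator_def split: if_splits)
qed

lemma sin_ge_half:
  fixes x :: real assumes "0 \<le> x" "x \<le> pi / 2" shows "x / 2 \<le> sin x"
proof -
  \<comment> \<open>The number \<open>17 / 10\<close> exceeds \<open>pi / 2\<close>, and its square
    2.89 stays below 3, which makes the cubic Taylor term at most \<open>x / 2\<close>.\<close>
  have "x \<le> 17 / 10" using assms pi_approx by auto
  then have "x * x \<le> 3" using assms mult_mono[of x "17 / 10" x "17 / 10"] by auto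
  then have "x / 2 \<le> x - x ^ 3 / 6"
    using assms mult_left_mono[of "x * x" 3 x] by (auto simp: power3_eq_cube)
  moreover have "\<bar>sin x - (\<Sum>m<3. sin_coeff m * x ^ m)\<bar> \<le> inverse (fact 3) * \<bar>x\<bar> ^ 3"
    by (rule Maclaurin_sin_bound)
  then have "\<bar>sin x - x\<bar> \<le> x ^ 3 / 6"
    using assms by (simp add: sin_coeff_def eval_nat_numeral field_simps)
  ultimately show ?thesis by linarith
qed

lemma cmod_diff_cis_sq: "(cmod (cis s - cis t))\<^sup>2 = 2 - 2 * cos (s - t)"
proof -
  have "(cos s - cos t)\<^sup>2 + (sin s - sin t)\<^sup>2 =
      ((sin s)\<^sup>2 + (cos s)\<^sup>2) + ((sin t)\<^sup>2 + (cos t)\<^sup>2) - 2 * (cos s * cos t + sin s * sin t)"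
    by (simp add: power2_eq_square algebra_simps)
  then show ?thesis by (simp add: cmod_power2 cos_diff)
qed

lemma cmod_diff_cis: "cmod (cis s - cis t) = 2 * \<bar>sin ((s - t) / 2)\<bar>"
proof -
  have "2 * ((s - t) / 2) = s - t" by simp
  then have "(cmod (cis s - cis t))\<^sup>2 = (2 * \<bar>sin ((s - t) / 2)\<bar>)\<^sup>2"
    unfolding cmod_diff_cis_sq using cos_double_sin[of "(s - t) / 2"] by (simp only: power2_eq_square) (simp add: algebra_simps)
  then show ?thesis by (rule power2_eq_imp_eq) auto
qed

text \<open>Folding the circle onto the half circle of nonnegative angles does not lengthen chords,
  because \<open>cos (s - t) \<le> cos (\<bar>s\<bar> - \<bar>t\<bar>)\<close>. On the half circle
  \<open>sin_ge_half\<close> bounds an arc by twice its chord.\<close>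

lemma ang_diff_le:
  assumes lam: "lam \<in> circle" "z \<in> circle" "w \<in> circle"
  shows "\<bar>ang lam z - ang lam w\<bar> \<le> 2 * cmod (z - w)"
proof -
  obtain s where s: "\<bar>s\<bar> \<le> pi" "z = lam * cis s" using circle_eq_cis[OF lam(1,2)] .
  obtain t where t: "\<bar>t\<bar> \<le> pi" "w = lam * cis t" using circle_eq_cis[OF lam(1,3)] .
  define x where "x = \<bar>\<bar>s\<bar> - \<bar>t\<bar>\<bar> / 2"
  have "x / 2 \<le> sin x" unfolding x_def using s t by (intro sin_ge_half) auto
  also have "sin x = \<bar>sin ((\<bar>s\<bar> - \<bar>t\<bar>) / 2)\<bar>"
  proof -
    have "x = (\<bar>s\<bar> - \<bar>t\<bar>) / 2 \<or> x = - ((\<bar>s\<bar> - \<bar>t\<bar>) / 2)" unfolding x_def by argo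
    then have "\<bar>sin ((\<bar>s\<bar> - \<bar>t\<bar>) / 2)\<bar> = \<bar>sin x\<bar>" by (metis abs_minus_cancel sin_minus)
    moreover have "0 \<le> sin x" using s t by (intro sin_ge_zero) (auto simp: x_def)
    ultimately show ?thesis by simp
  qed
  finally have "\<bar>\<bar>s\<bar> - \<bar>t\<bar>\<bar> \<le> 2 * cmod (cis (\<bar>s\<bar>) - cis (\<bar>t\<bar>))"
    unfolding cmod_diff_cis x_def by linarith
  also have "cmod (cis (\<bar>s\<bar>) - cis (\<bar>t\<bar>)) \<le> cmod (cis s - cis t)"
  proof (rule power2_le_imp_le)
    have "cos (s - t) \<le> cos (\<bar>s\<bar> - \<bar>t\<bar>)"
    proof -
      have "sin s * sin t \<le> \<bar>sin s\<bar> * \<bar>sin t\<bar>" by (metis abs_ge_self abs_mult)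
      also have "\<dots> = sin \<bar>s\<bar> * sin \<bar>t\<bar>"
        using s t sin_ge_zero[of "\<bar>s\<bar>"] sin_ge_zero[of "\<bar>t\<bar>"] by (auto simp: abs_if)
      finally show ?thesis by (simp add: cos_diff)
    qed
    then show "(cmod (cis (\<bar>s\<bar>) - cis (\<bar>t\<bar>)))\<^sup>2 \<le> (cmod (cis s - cis t))\<^sup>2"
      by (simp add: cmod_diff_cis_sq)
  qed simp
  also have "cmod (cis s - cis t) = cmod (z - w)"
    using lam by (simp add: s t norm_mult right_diff_distrib[symmetric])
  finally show ?thesis using ang_cis[OF lam(1)] s t by simp
qed

lemma ang_self[simp]: "lam \<in> circle \<Longrightarrow> ang lam lam = 0"
  using ang_cis[of lam 0] by simp

lemma cmod_diff_le_ang: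
  assumes lam: "lam \<in> circle" "z \<in> circle"
  shows "cmod (z - lam) \<le> ang lam z"
proof -
  obtain s where s: "\<bar>s\<bar> \<le> pi" "z = lam * cis s" using circle_eq_cis[OF lam(1,2)] .
  have "cmod (z - lam) = cmod (lam * (cis s - cis 0))"
    by (simp add: s right_diff_distrib)
  also have "\<dots> = cmod (cis s - cis 0)" using lam by (simp add: norm_mult)
  also have "\<dots> = 2 * \<bar>sin (s / 2)\<bar>" by (subst cmod_diff_cis) simp
  also have "\<dots> \<le> \<bar>s\<bar>" using abs_sin_x_le_abs_x[of "s / 2"] by simp
  finally show ?thesis using ang_cis[OF lam(1)] s by simp
qed

section \<open>Energy estimates for functions of the arc distance given by a density\<close>

section \<open>Functions of the angle\<close>

text \<open>Boundedness makes the tail Lipschitz, so that composed with the angle it is continuous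
  on the circle and its nontangential limits are its values. The support makes the tail vanish from
  1 on, on which \<open>tail_square_le\<close> relies.\<close>

locale radial_density =
  fixes \<omega> :: "real \<Rightarrow> real" and C :: real
  assumes density_measurable[measurable]: "\<omega> \<in> borel_measurable borel"
    and density_nonneg: "\<And>s. 0 \<le> \<omega> s"
    and density_bounded: "\<And>s. \<omega> s \<le> C"
    and density_support: "\<And>s. \<omega> s \<noteq> 0 \<Longrightarrow> 0 < s \<and> s \<le> 1"
begin

definition tail :: "real \<Rightarrow> real" where
  "tail b = (\<integral>s. \<omega> s * indicator {b<..} s \<partial>lborel)"

lemma integrable_density: "integrable lborel \<omega>"
proof (rule Bochner_Integration.integrable_bound)
  show "integrable lborel (\<lambda>s. C * indicator {0..1::real} s)"
    by (intro integrable_mult_right) (auto simp: integrable_indicator_iff)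
  show "AE s in lborel. norm (\<omega> s) \<le> norm (C * indicator {0..1} s)"
  proof (intro AE_I2)
    fix s
    show "norm (\<omega> s) \<le> norm (C * indicator {0..1} s)"
      using density_nonneg[of s] density_bounded[of s] density_support[of s]
      by (cases "\<omega> s = 0") (auto simp: indicator_def)
  qed
qed simp

lemma integrable_density_indicator: "A \<in> sets borel \<Longrightarrow> integrable lborel (\<lambda>s. \<omega> s * indicator A s)"
  using integrable_mult_indicator[of A lborel \<omega>] integrable_density by (simp add: mult.commute)

lemma tail_diff:
  assumes "a \<le> b"
  shows "tail a - tail b = (\<integral>s. \<omega> s * indicator {a<..<b} s \<partial>lborel)"
proof -
  have "tail a - tail b = (\<integral>s. \<omega> s * indicator {a<..} s - \<omega> s * indicator {b<..} s \<partial>lborel)"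
    unfolding tail_def by (intro Bochner_Integration.integral_diff[symmetric] integrable_density_indicator) auto
  also have "\<dots> = (\<integral>s. \<omega> s * indicator {a<..<b} s \<partial>lborel)"
  proof (rule integral_cong_AE)
    show "AE s in lborel. \<omega> s * indicator {a<..} s - \<omega> s * indicator {b<..} s = \<omega> s * indicator {a<..<b} s"
      using AE_lborel_singleton[of b] by eventually_elim (use assms in \<open>auto simp: indicator_def\<close>)
  qed auto
  finally show ?thesis .
qed

lemma ennreal_tail_diff:
  assumes "a \<le> b"
  shows "ennreal (tail a - tail b) = (\<integral>\<^sup>+s. ennreal (\<omega> s) * indicator {a<..<b} s \<partial>lborel)"
proof -
  have "ennreal (tail a - tail b) = (\<integral>\<^sup>+s. ennreal (\<omega> s * indicator {a<..<b} s) \<partial>lborel)"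
    unfolding tail_diff[OF assms]
    by (intro nn_integral_eq_integral[symmetric] integrable_density_indicator) (auto simp: density_nonneg)
  also have "\<dots> = (\<integral>\<^sup>+s. ennreal (\<omega> s) * indicator {a<..<b} s \<partial>lborel)"
    by (intro nn_integral_cong) (auto simp: indicator_def)
  finally show ?thesis .
qed

lemma tail_antimono: "a \<le> b \<Longrightarrow> tail b \<le> tail a"
proof -
  assume "a \<le> b"
  have "0 \<le> (\<integral>s. \<omega> s * indicator {a<..<b} s \<partial>lborel)"
    by (intro integral_nonneg_AE) (simp add: density_nonneg)
  then show ?thesis using tail_diff[OF \<open>a \<le> b\<close>] by simp
qed

lemma tail_outside: "1 \<le> b \<Longrightarrow> tail b = 0"
proof -
  assume "1 \<le> b"
  then have *: "\<omega> s * indicator {b<..} s = 0" for s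
    using density_support[of s] by (cases "\<omega> s = 0") (auto simp: indicator_def)
  show ?thesis unfolding tail_def * by simp
qed

lemma tail_nonneg: "0 \<le> tail b"
  unfolding tail_def by (intro integral_nonneg_AE) (simp add: density_nonneg)

lemma tail_lipschitz: "\<bar>tail a - tail b\<bar> \<le> C * \<bar>a - b\<bar>"
proof -
  have *: "tail a - tail b \<le> C * (b - a)" if "a \<le> b" for a b
  proof -
    have "tail a - tail b \<le> (\<integral>s. C * indicator {a<..<b} s \<partial>lborel)"
      unfolding tail_diff[OF that]
    proof (rule integral_mono)
      show "integrable lborel (\<lambda>s. C * indicator {a<..<b} s)"
        using that by (intro integrable_mult_right integrable_real_indicator) auto
      show "\<omega> s * indicator {a<..<b} s \<le> C * indicator {a<..<b} s" for s
        by (simp add: density_bounded indicator_def)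
    qed (simp add: integrable_density_indicator)
    then show ?thesis using that by (simp add: mult.commute)
  qed
  show ?thesis
    using *[of a b] *[of b a] tail_antimono[of a b] tail_antimono[of b a]
    by (cases "a \<le> b") auto
qed

lemma continuous_on_tail: "continuous_on A tail"
proof -
  have "C-lipschitz_on A tail"
    using tail_lipschitz density_nonneg[of 0] density_bounded[of 0]
    by (intro lipschitz_onI) (auto simp: dist_real_def)
  then show ?thesis by (rule lipschitz_on_continuous_on)
qed

lemma tail_measurable[measurable]: "tail \<in> borel_measurable borel"
  by (intro borel_measurable_continuous_onI continuous_on_tail)

text \<open>The difference quotient of the tail between \<open>a\<close> and \<open>b\<close> is, up
  to sign, the average of the density over the interval between them. \<open>hardy_right\<close>
  treats \<open>b > a\<close> and \<open>hardy_left\<close> treats \<open>b < a\<close>; the weights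
  \<open>4\<close> for \<open>s > a\<close> and \<open>4 * s\<^sup>2 / a\<^sup>2\<close> for
  \<open>s < a\<close> are both dominated by a multiple of
  \<open>(s / (a + s))\<^sup>2\<close>.\<close>

lemma tail_energy:
  assumes a: "0 \<le> a"
  shows "(\<integral>\<^sup>+b. ennreal ((tail b - tail a)\<^sup>2 / (b - a)\<^sup>2) * indicator {0<..<pi} b \<partial>lborel)
    \<le> 16 * (\<integral>\<^sup>+s. ennreal ((\<omega> s)\<^sup>2 * (s / (a + s))\<^sup>2) \<partial>lborel)"
proof -
  define X where "X = (\<lambda>b. \<integral>\<^sup>+s. ennreal (\<omega> s) * ennreal (indicator {a<..<b} s / (b - a) * indicator {a<..<pi} b) \<partial>lborel)"
  define Y where "Y = (\<lambda>b. \<integral>\<^sup>+s. ennreal (\<omega> s) * ennreal (indicator {b<..<a} s / (a - b) * indicator {0<..<a} b) \<partial>lborel)"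
  \<comment> \<open>The intervals depend on \<open>b\<close>; rewriting their indicators as
    conditionals exposes joint measurability.\<close>
  have "X = (\<lambda>b. \<integral>\<^sup>+s. ennreal (\<omega> s) * ennreal (if a < s \<and> s < b \<and> b < pi then 1 / (b - a) else 0) \<partial>lborel)"
    unfolding X_def by (intro ext nn_integral_cong) (auto simp: indicator_def)
  then have [measurable]: "X \<in> borel_measurable borel" by simp
  have "Y = (\<lambda>b. \<integral>\<^sup>+s. ennreal (\<omega> s) * ennreal (if b < s \<and> s < a \<and> 0 < b then 1 / (a - b) else 0) \<partial>lborel)"
    unfolding Y_def by (intro ext nn_integral_cong) (auto simp: indicator_def)
  then have [measurable]: "Y \<in> borel_measurable borel" by simp
  have quot: "(\<integral>\<^sup>+s. ennreal (\<omega> s) * ennreal (indicator {c<..<d} s / (d - c)) \<partial>lborel) =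
      ennreal ((tail c - tail d) / (d - c))" if "c < d" for c d
  proof -
    have "(\<integral>\<^sup>+s. ennreal (\<omega> s) * ennreal (indicator {c<..<d} s / (d - c)) \<partial>lborel) =
        (\<integral>\<^sup>+s. ennreal (\<omega> s) * indicator {c<..<d} s * ennreal (1 / (d - c)) \<partial>lborel)"
      by (intro nn_integral_cong) (auto simp: indicator_def)
    also have "\<dots> = ennreal (tail c - tail d) * ennreal (1 / (d - c))"
      using that by (simp add: nn_integral_multc ennreal_tail_diff)
    also have "\<dots> = ennreal ((tail c - tail d) / (d - c))"
      using that tail_antimono[of c d] by (simp add: ennreal_mult[symmetric])
    finally show ?thesis .
  qed
  have pointwise: "ennreal ((tail b - tail a)\<^sup>2 / (b - a)\<^sup>2) * indicator {0<..<pi} b \<le> (X b)\<^sup>2 + (Y b)\<^sup>2" for b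
  proof (cases "0 < b \<and> b < pi")
    case True
    consider "a < b" | "b < a" | "a = b" by linarith
    then show ?thesis
    proof cases
      case 1
      then have "X b = ennreal ((tail a - tail b) / (b - a))"
        using True quot[of a b] by (simp add: X_def)
      then have "(X b)\<^sup>2 = ennreal ((tail b - tail a)\<^sup>2 / (b - a)\<^sup>2)"
        using 1 tail_antimono[of a b] by (simp add: ennreal_power power_divide power2_commute)
      then show ?thesis using True by simp
    next
      case 2
      then have "Y b = ennreal ((tail b - tail a) / (a - b))"
        using True quot[of b a] by (simp add: Y_def)
      then have "(Y b)\<^sup>2 = ennreal ((tail b - tail a)\<^sup>2 / (b - a)\<^sup>2)"
        using 2 tail_antimono[of b a] by (simp add: ennreal_power power_divide power2_commute[of b a])
      then show ?thesis using True by simp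
    qed auto
  qed auto
  have Y: "(\<integral>\<^sup>+b. (Y b)\<^sup>2 \<partial>lborel) \<le> (\<integral>\<^sup>+s. (ennreal (\<omega> s))\<^sup>2 * ennreal (4 * s\<^sup>2 / a\<^sup>2 * indicator {0<..<a} s) \<partial>lborel)"
  \<comment> \<open>\<open>hardy_left\<close> divides by \<open>a\<close>. For \<open>a = 0\<close>
    there is no \<open>b\<close> on the left, and \<open>Y\<close> vanishes.\<close>
  proof (cases "a = 0")
    case True
    then show ?thesis by (simp add: Y_def)
  next
    case False
    then show ?thesis using a unfolding Y_def by (intro hardy_left) auto
  qed
  have "(\<integral>\<^sup>+b. ennreal ((tail b - tail a)\<^sup>2 / (b - a)\<^sup>2) * indicator {0<..<pi} b \<partial>lborel)
      \<le> (\<integral>\<^sup>+b. (X b)\<^sup>2 + (Y b)\<^sup>2 \<partial>lborel)"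
    by (intro nn_integral_mono pointwise)
  also have "\<dots> = (\<integral>\<^sup>+b. (X b)\<^sup>2 \<partial>lborel) + (\<integral>\<^sup>+b. (Y b)\<^sup>2 \<partial>lborel)"
    by (rule nn_integral_add) auto
  also have "\<dots> \<le> 4 * (\<integral>\<^sup>+s. (ennreal (\<omega> s))\<^sup>2 * indicator {a<..<pi} s \<partial>lborel) +
      (\<integral>\<^sup>+s. (ennreal (\<omega> s))\<^sup>2 * ennreal (4 * s\<^sup>2 / a\<^sup>2 * indicator {0<..<a} s) \<partial>lborel)"
    unfolding X_def by (intro add_mono Y hardy_right) auto
  also have "\<dots> = (\<integral>\<^sup>+s. 4 * ((ennreal (\<omega> s))\<^sup>2 * indicator {a<..<pi} s) +
      (ennreal (\<omega> s))\<^sup>2 * ennreal (4 * s\<^sup>2 / a\<^sup>2 * indicator {0<..<a} s) \<partial>lborel)"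
    by (subst nn_integral_add) (auto simp: nn_integral_cmult)
  also have "\<dots> \<le> (\<integral>\<^sup>+s. ennreal (16 * ((\<omega> s)\<^sup>2 * (s / (a + s))\<^sup>2)) \<partial>lborel)"
  proof (intro nn_integral_mono)
    fix s
    have "4 * ((\<omega> s)\<^sup>2 * indicator {a<..<pi} s) + (\<omega> s)\<^sup>2 * (4 * s\<^sup>2 / a\<^sup>2 * indicator {0<..<a} s)
       \<le> 16 * ((\<omega> s)\<^sup>2 * (s / (a + s))\<^sup>2)"
    proof -
      \<comment> \<open>Beyond \<open>a\<close> the ratio \<open>s / (a + s)\<close> is at least one
        half, and below \<open>a\<close> it is at least half of \<open>s / a\<close>. Squaring costs
        a factor 4 on top of Hardy's 4, whence the 16.\<close>
      have outer: "4 \<le> 16 * (s / (a + s))\<^sup>2" if "a < s"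
      proof -
        have "1 / 2 \<le> s / (a + s)" using that a by (simp add: field_simps)
        then have "(1 / 2)\<^sup>2 \<le> (s / (a + s))\<^sup>2" by (intro power_mono) auto
        then show ?thesis by (simp add: power2_eq_square)
      qed
      have inner: "4 * s\<^sup>2 / a\<^sup>2 \<le> 16 * (s / (a + s))\<^sup>2" if "0 < s" "s < a"
      proof -
        have "s / a \<le> 2 * (s / (a + s))" using that by (simp add: field_simps)
        then have "(s / a)\<^sup>2 \<le> (2 * (s / (a + s)))\<^sup>2" using that by (intro power_mono) auto
        then show ?thesis by (simp add: power_divide power_mult_distrib)
      qed
      consider "a < s" | "0 < s" "s < a" | "s = a" | "s \<le> 0" by linarith
      then show ?thesis
      proof cases
        case 1
        with outer[OF 1] a have "(\<omega> s)\<^sup>2 * 4 \<le> (\<omega> s)\<^sup>2 * (16 * (s / (a + s))\<^sup>2)"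
          by (intro mult_left_mono) auto
        then show ?thesis using 1 a by (auto simp: indicator_def)
      next
        case 2
        with inner[OF 2] have "(\<omega> s)\<^sup>2 * (4 * s\<^sup>2 / a\<^sup>2) \<le> (\<omega> s)\<^sup>2 * (16 * (s / (a + s))\<^sup>2)"
          by (intro mult_left_mono) auto
        then show ?thesis using 2 by (auto simp: indicator_def)
      next
        case 4
        then have "\<omega> s = 0" using density_support[of s] by auto
        then show ?thesis by simp
      qed (auto simp: indicator_def)
    qed
    moreover have "4 * ((ennreal (\<omega> s))\<^sup>2 * indicator {a<..<pi} s) +
        (ennreal (\<omega> s))\<^sup>2 * ennreal (4 * s\<^sup>2 / a\<^sup>2 * indicator {0<..<a} s) =
        ennreal (4 * ((\<omega> s)\<^sup>2 * indicator {a<..<pi} s) + (\<omega> s)\<^sup>2 * (4 * s\<^sup>2 / a\<^sup>2 * indicator {0<..<a} s))"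
      by (auto simp: indicator_def ennreal_power density_nonneg ennreal_mult simp del: times_divide_eq_right)
    ultimately show "4 * ((ennreal (\<omega> s))\<^sup>2 * indicator {a<..<pi} s) +
        (ennreal (\<omega> s))\<^sup>2 * ennreal (4 * s\<^sup>2 / a\<^sup>2 * indicator {0<..<a} s)
        \<le> ennreal (16 * ((\<omega> s)\<^sup>2 * (s / (a + s))\<^sup>2))"
      by (simp only: ennreal_leI)
  qed
  also have "\<dots> = 16 * (\<integral>\<^sup>+s. ennreal ((\<omega> s)\<^sup>2 * (s / (a + s))\<^sup>2) \<partial>lborel)"
    by (subst nn_integral_cmult[symmetric]) (auto simp: ennreal_mult)
  finally show ?thesis .
qed

text \<open>The tail vanishes at 1, and \<open>\<bar>b - 1\<bar> < 1\<close> for \<open>b\<close> in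
  \<open>(0, 1)\<close>, so the square of the tail is at most its squared difference quotient at 1.
  The L2 norm thus reduces to \<open>tail_energy\<close> with \<open>a = 1\<close>, and
  \<open>s / (1 + s) \<le> s\<close>.\<close>

lemma tail_square_le:
  "(\<integral>\<^sup>+b. ennreal ((tail b)\<^sup>2) * indicator {0<..<pi} b \<partial>lborel) \<le> 16 * (\<integral>\<^sup>+s. ennreal ((\<omega> s)\<^sup>2 * s\<^sup>2) \<partial>lborel)"
proof -
  have "(\<integral>\<^sup>+b. ennreal ((tail b)\<^sup>2) * indicator {0<..<pi} b \<partial>lborel) \<le>
      (\<integral>\<^sup>+b. ennreal ((tail b - tail 1)\<^sup>2 / (b - 1)\<^sup>2) * indicator {0<..<pi} b \<partial>lborel)"
  proof (intro nn_integral_mono)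
    fix b
    show "ennreal ((tail b)\<^sup>2) * indicator {0<..<pi} b \<le> ennreal ((tail b - tail 1)\<^sup>2 / (b - 1)\<^sup>2) * indicator {0<..<pi} b"
    proof (cases "0 < b \<and> b < 1")
      case True
      then have "(b - 1)\<^sup>2 \<le> 1" "0 < (b - 1)\<^sup>2" by (auto simp: abs_square_le_1)
      then have "(tail b)\<^sup>2 \<le> (tail b - tail 1)\<^sup>2 / (b - 1)\<^sup>2"
        by (simp add: tail_outside pos_le_divide_eq mult_left_le)
      then show ?thesis by (intro mult_right_mono ennreal_leI) auto
    next
      case False
      then show ?thesis using tail_outside[of b] by (cases "1 \<le> b") auto
    qed
  qed
  also have "\<dots> \<le> 16 * (\<integral>\<^sup>+s. ennreal ((\<omega> s)\<^sup>2 * (s / (1 + s))\<^sup>2) \<partial>lborel)"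
    by (rule tail_energy) simp
  also have "\<dots> \<le> 16 * (\<integral>\<^sup>+s. ennreal ((\<omega> s)\<^sup>2 * s\<^sup>2) \<partial>lborel)"
  proof (rule mult_left_mono, rule nn_integral_mono, rule ennreal_leI)
    fix s
    show "(\<omega> s)\<^sup>2 * (s / (1 + s))\<^sup>2 \<le> (\<omega> s)\<^sup>2 * s\<^sup>2"
    proof (cases "\<omega> s = 0")
      case False
      then have "0 < s" using density_support by auto
      then show ?thesis by (intro mult_left_mono power_mono) (auto simp: divide_simps)
    qed auto
  qed auto
  finally show ?thesis .
qed

text \<open>Replacing the chord by the difference of angles costs 4 by \<open>ang_diff_le\<close>,
  and \<open>tail_energy\<close> costs 16; the density \<open>1 / pi\<close> of the angle is rounded
  up to 1.\<close>

lemma tail_local_energy: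
  assumes lam: "lam \<in> circle" and \<xi>: "\<xi> \<in> circle"
  shows "(\<integral>\<^sup>+\<zeta>. ennreal ((tail (ang lam \<zeta>) - tail (ang lam \<xi>))\<^sup>2 / (cmod (\<zeta> - \<xi>))\<^sup>2) \<partial>arc_measure)
    \<le> 64 * (\<integral>\<^sup>+s. ennreal ((\<omega> s)\<^sup>2 * (s / (ang lam \<xi> + s))\<^sup>2) \<partial>lborel)"
proof -
  define a where "a = ang lam \<xi>"
  have a: "0 \<le> a" using ang_bounds[OF lam \<xi>] by (simp add: a_def)
  have "(\<integral>\<^sup>+\<zeta>. ennreal ((tail (ang lam \<zeta>) - tail a)\<^sup>2 / (cmod (\<zeta> - \<xi>))\<^sup>2) \<partial>arc_measure)
     \<le> (\<integral>\<^sup>+\<zeta>. ennreal (4 * ((tail (ang lam \<zeta>) - tail a)\<^sup>2 / (ang lam \<zeta> - a)\<^sup>2)) \<partial>arc_measure)"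
  proof (intro nn_integral_mono ennreal_leI)
    fix \<zeta> assume "\<zeta> \<in> space arc_measure"
    then have z: "\<zeta> \<in> circle" by simp
    let ?b = "ang lam \<zeta>"
    show "(tail ?b - tail a)\<^sup>2 / (cmod (\<zeta> - \<xi>))\<^sup>2 \<le> 4 * ((tail ?b - tail a)\<^sup>2 / (?b - a)\<^sup>2)"
    proof (cases "?b = a")
      case False
      have "\<bar>?b - a\<bar> \<le> 2 * cmod (\<zeta> - \<xi>)" unfolding a_def by (rule ang_diff_le[OF lam z \<xi>])
      then have "\<bar>?b - a\<bar>\<^sup>2 \<le> (2 * cmod (\<zeta> - \<xi>))\<^sup>2" by (intro power_mono) auto
      then have le: "(?b - a)\<^sup>2 / 4 \<le> (cmod (\<zeta> - \<xi>))\<^sup>2" by (simp add: power_mult_distrib)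
      have "(tail ?b - tail a)\<^sup>2 / (cmod (\<zeta> - \<xi>))\<^sup>2 \<le> (tail ?b - tail a)\<^sup>2 / ((?b - a)\<^sup>2 / 4)"
        using False le by (intro divide_left_mono mult_pos_pos) (auto intro: less_le_trans[OF _ le])
      then show ?thesis by (simp add: mult.commute)
    qed simp
  qed
  also have "\<dots> = ennreal (1 / pi) *
      (\<integral>\<^sup>+b. ennreal (4 * ((tail b - tail a)\<^sup>2 / (b - a)\<^sup>2)) * indicator {0<..<pi} b \<partial>lborel)"
    by (rule nn_integral_arc_measure_ang[OF lam]) measurable
  also have "\<dots> \<le> 1 *
      (\<integral>\<^sup>+b. ennreal (4 * ((tail b - tail a)\<^sup>2 / (b - a)\<^sup>2)) * indicator {0<..<pi} b \<partial>lborel)"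
    using pi_ge_two by (intro mult_right_mono) (auto simp: ennreal_le_1)
  also have "\<dots> = 4 * (\<integral>\<^sup>+b. ennreal ((tail b - tail a)\<^sup>2 / (b - a)\<^sup>2) * indicator {0<..<pi} b \<partial>lborel)"
    by (simp only: mult_1_left, subst nn_integral_cmult[symmetric])
      (measurable, simp only: ennreal_mult'[OF zero_le_numeral] ennreal_numeral mult.assoc)
  also have "\<dots> \<le> 4 * (16 * (\<integral>\<^sup>+s. ennreal ((\<omega> s)\<^sup>2 * (s / (a + s))\<^sup>2) \<partial>lborel))"
    by (intro mult_left_mono tail_energy a) simp
  also have "\<dots> = 64 * (\<integral>\<^sup>+s. ennreal ((\<omega> s)\<^sup>2 * (s / (a + s))\<^sup>2) \<partial>lborel)"
    by (simp add: mult.assoc[symmetric])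
  finally show ?thesis by (simp add: a_def)
qed

end

section \<open>The Poisson kernel, its radial derivative and boundary values of Poisson
  integrals\<close>

section \<open>Poisson integrals\<close>

lemma measurable_circle_borel:
  "sets M = sets circle_borel \<Longrightarrow> f \<in> borel_measurable borel \<Longrightarrow> f \<in> borel_measurable M"
  using measurable_restrict_space1[of f borel borel circle] measurable_cong_sets by blast

lemma measurable_pair_circle_borel:
  assumes "sets M = sets circle_borel"
    and f: "case_prod f \<in> borel_measurable (borel \<Otimes>\<^sub>M borel)"
  shows "case_prod f \<in> borel_measurable (lborel \<Otimes>\<^sub>M M)"
proof -
  have [measurable]: "(\<lambda>z. z) \<in> borel_measurable M"
    by (rule measurable_circle_borel[OF assms(1)]) simp
  have "(\<lambda>p. (fst p, snd p)) \<in> measurable (lborel \<Otimes>\<^sub>M M) (borel \<Otimes>\<^sub>M borel)"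
    by (intro measurable_Pair measurable_compose[OF measurable_snd]) auto
  from measurable_compose[OF this f] show ?thesis by (simp add: case_prod_beta')
qed

lemma poisson_kernel_nonneg: "cmod z < 1 \<Longrightarrow> 0 \<le> poisson_kernel z \<zeta>"
  by (simp add: poisson_kernel_def abs_square_le_1)

lemma poisson_kernel_measurable[measurable]: "poisson_kernel z \<in> borel_measurable borel"
  unfolding poisson_kernel_def[abs_def] by measurable

lemma poisson_kernel_bounded:
  assumes "cmod z < 1" "\<zeta> \<in> circle"
  shows "poisson_kernel z \<zeta> \<le> 1 / (1 - cmod z)\<^sup>2"
proof -
  have "1 - cmod z \<le> cmod (\<zeta> - z)" using assms norm_triangle_ineq2[of \<zeta> z] by simp
  then have "(1 - cmod z)\<^sup>2 \<le> (cmod (\<zeta> - z))\<^sup>2" using assms by (intro power_mono) auto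
  then show ?thesis unfolding poisson_kernel_def
    using assms by (intro frac_le) auto
qed

lemma cmod_diff_radial:
  assumes "lam \<in> circle" "\<zeta> \<in> circle"
  shows "(cmod (\<zeta> - of_real x * lam))\<^sup>2 = 1 + x\<^sup>2 - 2 * x * Re (\<zeta> * cnj lam)"
proof -
  have l: "(Re lam)\<^sup>2 + (Im lam)\<^sup>2 = 1" and z: "(Re \<zeta>)\<^sup>2 + (Im \<zeta>)\<^sup>2 = 1"
    using assms by (simp_all add: cmod_power2[symmetric])
  have "(cmod (\<zeta> - of_real x * lam))\<^sup>2 = ((Re \<zeta>)\<^sup>2 + (Im \<zeta>)\<^sup>2) + x\<^sup>2 * ((Re lam)\<^sup>2 + (Im lam)\<^sup>2)
      - 2 * x * Re (\<zeta> * cnj lam)"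
    unfolding cmod_power2 by (simp add: power2_eq_square algebra_simps)
  then show ?thesis by (simp add: l z)
qed

text \<open>The derivative of \<open>x \<mapsto> poisson_kernel (of_real x * lam) \<zeta>\<close> on the unit circle.\<close>

definition radial_kernel :: "complex \<Rightarrow> real \<Rightarrow> complex \<Rightarrow> real" where
  "radial_kernel lam x \<zeta> =
    (2 * Re (\<zeta> * cnj lam) * (1 + x\<^sup>2) - 4 * x) / (1 + x\<^sup>2 - 2 * x * Re (\<zeta> * cnj lam))\<^sup>2"

lemma radial_kernel_measurable[measurable]:
  "case_prod (radial_kernel lam) \<in> borel_measurable (borel \<Otimes>\<^sub>M borel)"
  unfolding radial_kernel_def[abs_def] case_prod_beta' by measurable

lemma radial_denominator:
  fixes x c :: real
  assumes "0 \<le> x" "x < 1" "c \<le> 1"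
  shows "(1 - x)\<^sup>2 \<le> 1 + x\<^sup>2 - 2 * x * c" "0 < 1 + x\<^sup>2 - 2 * x * c"
proof -
  have "0 \<le> 2 * x * (1 - c)" using assms by simp
  then show *: "(1 - x)\<^sup>2 \<le> 1 + x\<^sup>2 - 2 * x * c" by (simp add: power2_eq_square algebra_simps)
  have "0 < (1 - x)\<^sup>2" using assms by simp
  with * show "0 < 1 + x\<^sup>2 - 2 * x * c" by linarith
qed

lemma radial_kernel_bound:
  assumes "lam \<in> circle" "\<zeta> \<in> circle" "0 \<le> x" "x < 1"
  shows "\<bar>radial_kernel lam x \<zeta>\<bar> \<le> 2 / (cmod (\<zeta> - of_real x * lam))\<^sup>2"
proof -
  define c where "c = Re (\<zeta> * cnj lam)"
  have c: "-1 \<le> c" "c \<le> 1" using Re_mult_cnj_bounds[OF assms(1,2)] by (auto simp: c_def)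
  define D where "D = 1 + x\<^sup>2 - 2 * x * c"
  have D: "0 < D" using radial_denominator[OF assms(3,4) c(2)] by (simp add: D_def)
  \<comment> \<open>These two products are \<open>2 * D\<close> minus and plus the numerator of the
    kernel.\<close>
  have "0 \<le> 2 * (1 - c) * (1 + x)\<^sup>2" "0 \<le> 2 * (1 + c) * (1 - x)\<^sup>2"
    using c by auto
  then have "\<bar>2 * c * (1 + x\<^sup>2) - 4 * x\<bar> \<le> 2 * D"
    by (simp add: D_def abs_le_iff power2_eq_square algebra_simps)
  then have "\<bar>2 * c * (1 + x\<^sup>2) - 4 * x\<bar> / D\<^sup>2 \<le> 2 * D / D\<^sup>2"
    by (intro divide_right_mono) auto
  also have "2 * D / D\<^sup>2 = 2 / D" by (simp add: power2_eq_square)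
  finally show ?thesis
    unfolding cmod_diff_radial[OF assms(1,2)] radial_kernel_def by (simp add: c_def D_def)
qed

lemma radial_kernel_bound':
  assumes "lam \<in> circle" "\<zeta> \<in> circle" "0 \<le> x" "x < 1"
  shows "\<bar>radial_kernel lam x \<zeta>\<bar> \<le> 2 / (1 - x)\<^sup>2"
proof -
  have "2 / (cmod (\<zeta> - of_real x * lam))\<^sup>2 \<le> 2 / (1 - x)\<^sup>2"
    unfolding cmod_diff_radial[OF assms(1,2)]
    using radial_denominator[OF assms(3,4) Re_mult_cnj_bounds(2)[OF assms(1,2)]] assms
    by (intro divide_left_mono mult_pos_pos) auto
  with radial_kernel_bound[OF assms] show ?thesis by linarith
qed

lemma integral_radial_kernel_radius:
  assumes "lam \<in> circle" "\<zeta> \<in> circle" "0 \<le> r" "r < 1"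
  shows "(\<integral>x. indicator {0..r} x * radial_kernel lam x \<zeta> \<partial>lborel) = poisson_kernel (of_real r * lam) \<zeta> - 1"
proof -
  define c where "c = Re (\<zeta> * cnj lam)"
  have c: "c \<le> 1" using Re_mult_cnj_bounds[OF assms(1,2)] by (auto simp: c_def)
  have pos: "0 < 1 + x\<^sup>2 - 2 * x * c" if "0 \<le> x" "x \<le> r" for x
    using radial_denominator[of x c] that assms c by auto
  have nz: "1 + x\<^sup>2 \<noteq> 2 * x * c" if "0 \<le> x" "x \<le> r" for x
    using pos[OF that] by auto
  have P: "poisson_kernel (of_real r * lam) \<zeta> = (1 - r\<^sup>2) / (1 + r\<^sup>2 - 2 * r * c)"
    unfolding poisson_kernel_def cmod_diff_radial[OF assms(1,2)] c_def
    using assms by (simp add: norm_mult)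
  have "(\<integral>x. radial_kernel lam x \<zeta> * indicator {0..r} x \<partial>lborel) =
      (1 - r\<^sup>2) / (1 + r\<^sup>2 - 2 * r * c) - (1 - 0\<^sup>2) / (1 + 0\<^sup>2 - 2 * 0 * c)"
  proof (rule integral_FTC_Icc_real)
    show "isCont (\<lambda>x. radial_kernel lam x \<zeta>) x" if "0 \<le> x" "x \<le> r" for x
      unfolding radial_kernel_def c_def[symmetric] using nz[OF that]
      by (intro continuous_intros) auto
    show "DERIV (\<lambda>x. (1 - x\<^sup>2) / (1 + x\<^sup>2 - 2 * x * c)) x :> radial_kernel lam x \<zeta>"
      if "0 \<le> x" "x \<le> r" for x
      unfolding radial_kernel_def c_def[symmetric] using nz[OF that]
      by (auto intro!: derivative_eq_intros simp: power2_eq_square algebra_simps)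
  qed (use assms in auto)
  moreover have "(\<integral>x. indicator {0..r} x * radial_kernel lam x \<zeta> \<partial>lborel) =
      (\<integral>x. radial_kernel lam x \<zeta> * indicator {0..r} x \<partial>lborel)"
    by (intro Bochner_Integration.integral_cong) auto
  ultimately show ?thesis unfolding P by simp
qed

text \<open>An explicit antiderivative in the angle vanishes at 0 and at \<open>pi\<close>. Since
  \<open>integral_poisson_kernel\<close> is itself derived from this lemma, the vanishing mean
  cannot be obtained by differentiating the total mass of the Poisson kernel.\<close>

lemma integral_radial_kernel_arc:
  assumes lam: "lam \<in> circle" and x: "0 \<le> x" "x < 1"
  shows "integrable arc_measure (radial_kernel lam x)" "(\<integral>\<zeta>. radial_kernel lam x \<zeta> \<partial>arc_measure) = 0"
proof -
  interpret finite_measure arc_measure by (rule finite_measure_arc_measure)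
  \<comment> \<open>Adding the uniform bound \<open>K\<close> makes the kernel nonnegative, so that
    it can be integrated through \<open>ang\<close> by the nonnegative integral; the total mass 1
    lets \<open>K\<close> be subtracted again.\<close>
  define K where "K = 2 / (1 - x)\<^sup>2"
  have [measurable]: "radial_kernel lam x \<in> borel_measurable borel"
    unfolding radial_kernel_def[abs_def] by measurable
  have [measurable]: "radial_kernel lam x \<in> borel_measurable arc_measure"
    by (rule measurable_circle_borel) auto
  show int: "integrable arc_measure (radial_kernel lam x)"
    by (rule integrable_const_bound[of _ K]) (use radial_kernel_bound'[OF lam _ x] in \<open>auto simp: K_def\<close>)
  have rnonneg: "0 \<le> radial_kernel lam x \<zeta> + K" if "\<zeta> \<in> circle" for \<zeta>
    using radial_kernel_bound'[OF lam that x] unfolding K_def by linarith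
  define h where "h b = (2 * cos b * (1 + x\<^sup>2) - 4 * x) / (1 + x\<^sup>2 - 2 * x * cos b)\<^sup>2" for b
  have [measurable]: "h \<in> borel_measurable borel" unfolding h_def[abs_def] by measurable
  have pos: "0 < 1 + x\<^sup>2 - 2 * x * cos b" for b using radial_denominator[OF x, of "cos b"] by auto
  have nz: "1 + x\<^sup>2 \<noteq> 2 * x * cos b" for b using pos[of b] by auto
  have hang: "radial_kernel lam x \<zeta> = h (ang lam \<zeta>)" if "\<zeta> \<in> circle" for \<zeta>
    using ang_bounds(3)[OF lam that] by (simp add: radial_kernel_def h_def)
  have hbound: "0 \<le> h b + K" if "0 < b" "b < pi" for b
  proof -
    have "lam * cis b \<in> circle" using lam by (simp add: norm_mult)
    from radial_kernel_bound'[OF lam this x] hang[OF this] ang_cis[OF lam, of b] that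
    show ?thesis by (simp add: K_def abs_le_iff)
  qed
  \<comment> \<open>For \<open>x \<noteq> 0\<close> the quotient is the conjugate Poisson kernel
    divided by \<open>x\<close>; the derivative formula is the Cauchy-Riemann equation in polar
    coordinates.\<close>
  have hder: "((\<lambda>b. 2 * sin b / (1 + x\<^sup>2 - 2 * x * cos b) + K * b) has_real_derivative h b + K) (at b)" for b
  proof -
    have *: "(2 * cos b * (1 + x\<^sup>2 - 2 * x * cos b) - 2 * sin b * (2 * x * sin b)) = 2 * cos b * (1 + x\<^sup>2) - 4 * x"
      using sin_cos_squared_add[of b] by algebra
    have "((\<lambda>b. 2 * sin b / (1 + x\<^sup>2 - 2 * x * cos b) + K * b) has_real_derivative
        (2 * cos b * (1 + x\<^sup>2 - 2 * x * cos b) - 2 * sin b * (2 * x * sin b)) / (1 + x\<^sup>2 - 2 * x * cos b)\<^sup>2 + K) (at b)"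
      using nz[of b] by (auto intro!: derivative_eq_intros simp: power2_eq_square)
    then show ?thesis unfolding h_def * .
  qed
  have "(\<integral>\<^sup>+\<zeta>. ennreal (radial_kernel lam x \<zeta> + K) \<partial>arc_measure) = (\<integral>\<^sup>+\<zeta>. ennreal (h (ang lam \<zeta>) + K) \<partial>arc_measure)"
    by (intro nn_integral_cong) (simp add: hang)
  also have "\<dots> = ennreal (1 / pi) * (\<integral>\<^sup>+b. ennreal (h b + K) * indicator {0<..<pi} b \<partial>lborel)"
    by (rule nn_integral_arc_measure_ang[OF lam]) measurable
  also have "(\<integral>\<^sup>+b. ennreal (h b + K) * indicator {0<..<pi} b \<partial>lborel) =
      ennreal ((2 * sin pi / (1 + x\<^sup>2 - 2 * x * cos pi) + K * pi) - (2 * sin 0 / (1 + x\<^sup>2 - 2 * x * cos 0) + K * 0))"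
    by (rule nn_integral_FTC_interior)
      (use hbound hder in \<open>auto intro!: continuous_at_imp_continuous_on DERIV_isCont\<close>)
  also have "ennreal (1 / pi) * \<dots> = ennreal K"
    by (simp add: ennreal_mult[symmetric] K_def)
  finally have "(\<integral>\<zeta>. radial_kernel lam x \<zeta> + K \<partial>arc_measure) = K"
    using rnonneg by (intro integral_eq_nn_integral[THEN trans]) (auto simp: K_def)
  moreover have "measure arc_measure (space arc_measure) = 1"
    using emeasure_arc_measure by (simp add: measure_def)
  ultimately show "(\<integral>\<zeta>. radial_kernel lam x \<zeta> \<partial>arc_measure) = 0"
    using int by simp
qed

text \<open>The fundamental theorem of calculus along the radius, in integrated form:
  \<open>integral_radial_kernel_radius\<close> holds for each \<zeta>, and the order of integration
  is exchanged. The kernel is bounded by \<open>2 / (1 - r)\<^sup>2\<close> on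
  \<open>{0..r}\<close>, so integrability of \<open>v\<close> suffices and no derivative is taken
  under the integral sign.\<close>

lemma poisson_radial_fubini:
  fixes v :: "complex \<Rightarrow> real"
  assumes lam: "lam \<in> circle" and r: "0 \<le> r" "r < 1" and v: "integrable arc_measure v"
  shows "integrable lborel (\<lambda>x. indicator {0..r} x * (\<integral>\<zeta>. radial_kernel lam x \<zeta> * v \<zeta> \<partial>arc_measure))" (is ?int)
    and "(\<integral>\<zeta>. poisson_kernel (of_real r * lam) \<zeta> * v \<zeta> \<partial>arc_measure) =
      (\<integral>\<zeta>. v \<zeta> \<partial>arc_measure) + (\<integral>x. indicator {0..r} x * (\<integral>\<zeta>. radial_kernel lam x \<zeta> * v \<zeta> \<partial>arc_measure) \<partial>lborel)"
      (is ?eq)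
proof -
  interpret A: finite_measure arc_measure by (rule finite_measure_arc_measure)
  interpret P: pair_sigma_finite lborel arc_measure ..
  note [measurable] = measurable_pair_circle_borel[OF sets_arc_measure radial_kernel_measurable]
    borel_measurable_integrable[OF v]
  have [measurable]: "poisson_kernel z \<in> borel_measurable arc_measure" for z
    by (rule measurable_circle_borel) auto
  define f where "f = (\<lambda>x \<zeta>. indicator {0..r} x * (radial_kernel lam x \<zeta> * v \<zeta>))"
  have [measurable]: "case_prod f \<in> borel_measurable (lborel \<Otimes>\<^sub>M arc_measure)"
    unfolding f_def by measurable
  have fb: "norm (f x \<zeta>) \<le> 2 / (1 - r)\<^sup>2 * \<bar>v \<zeta>\<bar> * indicator {0..r} x" if "\<zeta> \<in> circle" for x \<zeta>
  proof (cases "x \<in> {0..r}")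
    case True
    then have "\<bar>radial_kernel lam x \<zeta>\<bar> \<le> 2 / (1 - x)\<^sup>2" using lam that r by (intro radial_kernel_bound') auto
    also have "\<dots> \<le> 2 / (1 - r)\<^sup>2" using True r by (intro divide_left_mono power_mono) auto
    finally have "\<bar>radial_kernel lam x \<zeta>\<bar> * \<bar>v \<zeta>\<bar> \<le> 2 / (1 - r)\<^sup>2 * \<bar>v \<zeta>\<bar>"
      by (intro mult_right_mono) auto
    then show ?thesis using True by (simp add: f_def abs_mult)
  qed (simp add: f_def)
  have int: "integrable (lborel \<Otimes>\<^sub>M arc_measure) (case_prod f)"
  proof (rule integrableI_bounded)
    have "(\<integral>\<^sup>+p. ennreal (norm (case_prod f p)) \<partial>(lborel \<Otimes>\<^sub>M arc_measure)) =
        (\<integral>\<^sup>+x. (\<integral>\<^sup>+\<zeta>. ennreal (norm (f x \<zeta>)) \<partial>arc_measure) \<partial>lborel)"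
      by (subst A.nn_integral_fst[symmetric]) auto
    also have "\<dots> \<le> (\<integral>\<^sup>+x. (\<integral>\<^sup>+\<zeta>. ennreal (2 / (1 - r)\<^sup>2) * ennreal \<bar>v \<zeta>\<bar> * indicator {0..r} x \<partial>arc_measure) \<partial>lborel)"
    proof (intro nn_integral_mono)
      fix x \<zeta> assume "\<zeta> \<in> space arc_measure"
      then have "ennreal (norm (f x \<zeta>)) \<le> ennreal (2 / (1 - r)\<^sup>2 * \<bar>v \<zeta>\<bar> * indicator {0..r} x)"
        by (intro ennreal_leI fb) auto
      also have "\<dots> = ennreal (2 / (1 - r)\<^sup>2) * ennreal \<bar>v \<zeta>\<bar> * indicator {0..r} x"
        by (subst ennreal_mult[symmetric]) (auto simp: indicator_def)
      finally show "ennreal (norm (f x \<zeta>)) \<le> ennreal (2 / (1 - r)\<^sup>2) * ennreal \<bar>v \<zeta>\<bar> * indicator {0..r} x" .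
    qed
    also have "\<dots> = ennreal (2 / (1 - r)\<^sup>2) * (\<integral>\<^sup>+\<zeta>. ennreal \<bar>v \<zeta>\<bar> \<partial>arc_measure) * ennreal r"
      using r by (simp add: nn_integral_cmult nn_integral_multc)
    also have "\<dots> < \<infinity>"
      using v by (auto simp: integrable_iff_bounded ennreal_mult_less_top)
    finally show "(\<integral>\<^sup>+p. ennreal (norm (case_prod f p)) \<partial>(lborel \<Otimes>\<^sub>M arc_measure)) < \<infinity>" .
  qed simp
  have inner: "(\<integral>\<zeta>. f x \<zeta> \<partial>arc_measure) = indicator {0..r} x * (\<integral>\<zeta>. radial_kernel lam x \<zeta> * v \<zeta> \<partial>arc_measure)" for x
    by (simp add: f_def)
  show ?int using P.integrable_fst[OF int] unfolding inner .
  have ivP: "integrable arc_measure (\<lambda>\<zeta>. poisson_kernel (of_real r * lam) \<zeta> * v \<zeta>)"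
  proof (rule Bochner_Integration.integrable_bound)
    show "integrable arc_measure (\<lambda>\<zeta>. 1 / (1 - r)\<^sup>2 * v \<zeta>)" using v by simp
    show "AE \<zeta> in arc_measure. norm (poisson_kernel (of_real r * lam) \<zeta> * v \<zeta>) \<le> norm (1 / (1 - r)\<^sup>2 * v \<zeta>)"
    proof (intro AE_I2)
      fix \<zeta> assume "\<zeta> \<in> space arc_measure"
      then have "\<bar>poisson_kernel (of_real r * lam) \<zeta>\<bar> \<le> \<bar>1 / (1 - r)\<^sup>2\<bar>"
        using poisson_kernel_bounded[of "of_real r * lam" \<zeta>] poisson_kernel_nonneg[of "of_real r * lam" \<zeta>] r lam
        by (simp add: norm_mult)
      then show "norm (poisson_kernel (of_real r * lam) \<zeta> * v \<zeta>) \<le> norm (1 / (1 - r)\<^sup>2 * v \<zeta>)"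
        unfolding real_norm_def abs_mult by (intro mult_right_mono) auto
    qed
  qed auto
  have "(\<integral>x. indicator {0..r} x * (\<integral>\<zeta>. radial_kernel lam x \<zeta> * v \<zeta> \<partial>arc_measure) \<partial>lborel) =
      (\<integral>\<zeta>. (\<integral>x. f x \<zeta> \<partial>lborel) \<partial>arc_measure)"
    using P.Fubini_integral[OF int] unfolding inner by simp
  also have "\<dots> = (\<integral>\<zeta>. poisson_kernel (of_real r * lam) \<zeta> * v \<zeta> - v \<zeta> \<partial>arc_measure)"
  proof (rule Bochner_Integration.integral_cong[OF refl])
    fix \<zeta> assume "\<zeta> \<in> space arc_measure"
    then have "\<zeta> \<in> circle" by simp
    have "(\<integral>x. f x \<zeta> \<partial>lborel) = (\<integral>x. indicator {0..r} x * radial_kernel lam x \<zeta> * v \<zeta> \<partial>lborel)"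
      by (simp add: f_def mult.assoc)
    also have "\<dots> = (\<integral>x. indicator {0..r} x * radial_kernel lam x \<zeta> \<partial>lborel) * v \<zeta>"
      by (rule integral_mult_left_zero)
    finally show "(\<integral>x. f x \<zeta> \<partial>lborel) = poisson_kernel (of_real r * lam) \<zeta> * v \<zeta> - v \<zeta>"
      using integral_radial_kernel_radius[OF lam \<open>\<zeta> \<in> circle\<close> r] by (simp add: left_diff_distrib)
  qed
  also have "\<dots> = (\<integral>\<zeta>. poisson_kernel (of_real r * lam) \<zeta> * v \<zeta> \<partial>arc_measure) - (\<integral>\<zeta>. v \<zeta> \<partial>arc_measure)"
    by (rule Bochner_Integration.integral_diff[OF ivP v])
  finally show ?eq by simp
qed

text \<open>Along the radius through \<open>z\<close> the integral of the kernel starts at the total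
  mass 1 and has derivative zero by \<open>integral_radial_kernel_arc\<close>; this is
  \<open>poisson_radial_fubini\<close> for the constant function 1.\<close>

lemma integral_poisson_kernel:
  assumes "cmod z < 1"
  shows "integrable arc_measure (poisson_kernel z)" "(\<integral>\<zeta>. poisson_kernel z \<zeta> \<partial>arc_measure) = 1"
proof -
  interpret A: finite_measure arc_measure by (rule finite_measure_arc_measure)
  have [measurable]: "poisson_kernel z \<in> borel_measurable arc_measure"
    by (rule measurable_circle_borel) auto
  show "integrable arc_measure (poisson_kernel z)"
    by (rule A.integrable_const_bound[of _ "1 / (1 - cmod z)\<^sup>2"])
      (use poisson_kernel_bounded[OF assms] poisson_kernel_nonneg[OF assms] in auto)
  obtain lam where lam: "lam \<in> circle" "z = of_real (cmod z) * lam"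
  proof (cases "z = 0")
    case True then show ?thesis using that[of 1] by simp
  next
    case False
    then have "cmod (sgn z) = 1" "z = of_real (cmod z) * sgn z" by (simp_all add: norm_sgn) (simp add: sgn_eq)
    then show ?thesis using that[of "sgn z"] by simp
  qed
  have "measure arc_measure (space arc_measure) = 1"
    using emeasure_arc_measure by (simp add: measure_def)
  moreover have zero: "indicator {0..cmod z} x * (\<integral>\<zeta>. radial_kernel lam x \<zeta> \<partial>arc_measure) = 0" for x
    using assms integral_radial_kernel_arc(2)[OF lam(1), of x] by (auto simp: indicator_def)
  have "(\<integral>x. indicator {0..cmod z} x * (\<integral>\<zeta>. radial_kernel lam x \<zeta> \<partial>arc_measure) \<partial>lborel) = 0"
    unfolding zero by simp
  ultimately show "(\<integral>\<zeta>. poisson_kernel z \<zeta> \<partial>arc_measure) = 1"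
    using poisson_radial_fubini(2)[OF lam(1), of "cmod z" "\<lambda>_. 1"] assms lam(2) by simp
qed

text \<open>The approximate identity argument: near \<xi> continuity and unit mass give
  \<open>e / 2\<close>, and away from \<xi> the kernel is at most a constant times
  \<open>1 - (cmod z)\<^sup>2\<close>. The approach to \<xi> within the disc is unrestricted, which
  covers all Stolz regions at once.\<close>

lemma poisson_fun_tendsto:
  assumes cont: "continuous_on circle u" and \<xi>: "\<xi> \<in> circle"
  shows "(poisson_fun u \<longlongrightarrow> u \<xi>) (at \<xi> within ball 0 1)"
proof (rule tendstoI)
  fix e :: real assume e: "0 < e"
  interpret A: finite_measure arc_measure by (rule finite_measure_arc_measure)
  have [measurable]: "u \<in> borel_measurable arc_measure"
    using borel_measurable_continuous_on_restrict[OF cont] by simp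
  have [measurable]: "poisson_kernel z \<in> borel_measurable arc_measure" for z
    by (rule measurable_circle_borel) auto
  obtain B where B: "\<And>\<zeta>. \<zeta> \<in> circle \<Longrightarrow> norm (u \<zeta>) \<le> B"
    using compact_imp_bounded[OF compact_continuous_image[OF cont compact_sphere]] unfolding bounded_iff by blast
  have B0: "0 \<le> B" using B[OF \<xi>] norm_ge_zero order_trans by blast
  obtain d where d: "0 < d" "\<And>\<zeta>. \<zeta> \<in> circle \<Longrightarrow> cmod (\<zeta> - \<xi>) < d \<Longrightarrow> cmod (u \<zeta> - u \<xi>) < e / 2"
    using cont \<xi> e unfolding continuous_on_iff dist_norm by (metis half_gt_zero)
  \<comment> \<open>\<open>2 * B\<close> bounds the oscillation of \<open>u\<close>, and
    \<open>4 / d\<^sup>2\<close> comes from the distance \<open>d / 2\<close> between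
    \<open>z\<close> and the far part of the circle.\<close>
  define K where "K = 2 * B * (4 / d\<^sup>2)"
  have K: "0 \<le> K" using B0 by (simp add: K_def)
  have est: "cmod (poisson_fun u z - u \<xi>) \<le> e / 2 + K * (1 - (cmod z)\<^sup>2)"
    if z: "cmod z < 1" "cmod (z - \<xi>) < d / 2" for z
  proof -
    note P = integral_poisson_kernel[OF z(1)]
    have z2: "0 \<le> 1 - (cmod z)\<^sup>2" using z by (simp add: abs_square_le_1)
    have iu: "integrable arc_measure (\<lambda>\<zeta>. poisson_kernel z \<zeta> *\<^sub>R u \<zeta>)"
    proof (rule A.integrable_const_bound[of _ "1 / (1 - cmod z)\<^sup>2 * B"], rule AE_I2)
      fix \<zeta> assume "\<zeta> \<in> space arc_measure"
      then have "poisson_kernel z \<zeta> * norm (u \<zeta>) \<le> 1 / (1 - cmod z)\<^sup>2 * B"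
        by (intro mult_mono poisson_kernel_bounded B z) auto
      then show "norm (poisson_kernel z \<zeta> *\<^sub>R u \<zeta>) \<le> 1 / (1 - cmod z)\<^sup>2 * B"
        using poisson_kernel_nonneg[OF z(1)] by simp
    qed simp
    have ic: "integrable arc_measure (\<lambda>\<zeta>. poisson_kernel z \<zeta> *\<^sub>R u \<xi>)" using P(1) by simp
    have "poisson_fun u z - u \<xi> = (\<integral>\<zeta>. poisson_kernel z \<zeta> *\<^sub>R u \<zeta> \<partial>arc_measure) - (\<integral>\<zeta>. poisson_kernel z \<zeta> *\<^sub>R u \<xi> \<partial>arc_measure)"
      unfolding poisson_fun_def using P by simp
    also have "\<dots> = (\<integral>\<zeta>. poisson_kernel z \<zeta> *\<^sub>R (u \<zeta> - u \<xi>) \<partial>arc_measure)"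
      unfolding scaleR_diff_right by (rule Bochner_Integration.integral_diff[symmetric, OF iu ic])
    also have "cmod \<dots> \<le> (\<integral>\<zeta>. norm (poisson_kernel z \<zeta> *\<^sub>R (u \<zeta> - u \<xi>)) \<partial>arc_measure)"
      by (rule integral_norm_bound)
    also have "\<dots> \<le> (\<integral>\<zeta>. e / 2 * poisson_kernel z \<zeta> + K * (1 - (cmod z)\<^sup>2) \<partial>arc_measure)"
    proof (rule integral_mono)
      show "integrable arc_measure (\<lambda>\<zeta>. norm (poisson_kernel z \<zeta> *\<^sub>R (u \<zeta> - u \<xi>)))"
        unfolding scaleR_diff_right by (intro integrable_norm Bochner_Integration.integrable_diff iu ic)
      show "integrable arc_measure (\<lambda>\<zeta>. e / 2 * poisson_kernel z \<zeta> + K * (1 - (cmod z)\<^sup>2))"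
        using P(1) by simp
      fix \<zeta> assume "\<zeta> \<in> space arc_measure"
      then have c: "\<zeta> \<in> circle" by simp
      note p0 = poisson_kernel_nonneg[OF z(1), of \<zeta>]
      show "norm (poisson_kernel z \<zeta> *\<^sub>R (u \<zeta> - u \<xi>)) \<le> e / 2 * poisson_kernel z \<zeta> + K * (1 - (cmod z)\<^sup>2)"
      proof (cases "cmod (\<zeta> - \<xi>) < d")
        case True
        then have "poisson_kernel z \<zeta> * cmod (u \<zeta> - u \<xi>) \<le> poisson_kernel z \<zeta> * (e / 2)"
          using d(2)[OF c] p0 by (intro mult_left_mono) auto
        moreover have "0 \<le> K * (1 - (cmod z)\<^sup>2)" using K z2 by simp
        ultimately show ?thesis using p0 by (simp add: mult.commute)
      next
        case False
        have "d / 2 \<le> cmod (\<zeta> - z)"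
          using False z(2) norm_triangle_ineq[of "\<zeta> - z" "z - \<xi>"] by simp
        then have "(d / 2)\<^sup>2 \<le> (cmod (\<zeta> - z))\<^sup>2" using d by (intro power_mono) auto
        then have "poisson_kernel z \<zeta> \<le> (1 - (cmod z)\<^sup>2) / (d / 2)\<^sup>2"
          unfolding poisson_kernel_def using z2 d by (intro divide_left_mono mult_pos_pos) auto
        also have "\<dots> = (1 - (cmod z)\<^sup>2) * (4 / d\<^sup>2)" by (simp add: power_divide)
        finally have "poisson_kernel z \<zeta> * cmod (u \<zeta> - u \<xi>) \<le> (1 - (cmod z)\<^sup>2) * (4 / d\<^sup>2) * (2 * B)"
          using p0 norm_triangle_ineq4[of "u \<zeta>" "u \<xi>"] B[OF c] B[OF \<xi>] z2 by (intro mult_mono) auto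
        moreover have "0 \<le> e / 2 * poisson_kernel z \<zeta>" using e p0 by simp
        ultimately show ?thesis using p0 by (simp add: K_def mult_ac)
      qed
    qed
    also have "\<dots> = e / 2 + K * (1 - (cmod z)\<^sup>2)"
      using P emeasure_arc_measure by (simp add: measure_def)
    finally show ?thesis .
  qed
  have "((\<lambda>z. K * (1 - (cmod z)\<^sup>2)) \<longlongrightarrow> K * (1 - (cmod \<xi>)\<^sup>2)) (at \<xi> within ball 0 1)"
    by (intro tendsto_intros)
  then have "\<forall>\<^sub>F z in at \<xi> within ball 0 1. K * (1 - (cmod z)\<^sup>2) < e / 2"
    using \<xi> e by (intro order_tendstoD(2)) auto
  moreover have "\<forall>\<^sub>F z in at \<xi> within ball 0 1. cmod (z - \<xi>) < d / 2"
    using d by (auto simp: eventually_at dist_norm intro!: exI[of _ "d / 2"])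
  moreover have "\<forall>\<^sub>F z in at \<xi> within ball 0 1. cmod z < 1"
    by (auto simp: eventually_at_filter)
  ultimately show "\<forall>\<^sub>F z in at \<xi> within ball 0 1. dist (poisson_fun u z) (u \<xi>) < e"
    by eventually_elim (use est in \<open>force simp: dist_norm\<close>)
qed

text \<open>The points \<open>r * \<xi>\<close> satisfy
  \<open>cmod (r * \<xi> - \<xi>) = 1 - r\<close> and so lie in the region of aperture 2. Without
  accumulation at \<xi> every number would be a limit, and \<open>nt_limit\<close> would be
  undetermined.\<close>

lemma stolz_region_islimpt:
  assumes "\<xi> \<in> circle" shows "\<xi> islimpt stolz_region \<xi> 2"
  unfolding islimpt_approachable
proof (intro allI impI)
  fix e :: real assume e: "0 < e"
  define r where "r = 1 - min e 1 / 2"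
  have r: "0 < r" "r < 1" "1 - r < e" using e by (auto simp: r_def min_def)
  have "of_real r * \<xi> - \<xi> = of_real (r - 1) * \<xi>" by (simp add: algebra_simps)
  then have d: "cmod (of_real r * \<xi> - \<xi>) = 1 - r" using assms r by (simp only: norm_mult norm_of_real) simp
  then have "of_real r * \<xi> \<in> stolz_region \<xi> 2"
    using assms r by (simp add: stolz_region_def norm_mult)
  moreover have "of_real r * \<xi> \<noteq> \<xi>" using d r by auto
  ultimately show "\<exists>x'\<in>stolz_region \<xi> 2. x' \<noteq> \<xi> \<and> dist x' \<xi> < e"
    using d r by (intro bexI[of _ "of_real r * \<xi>"]) (auto simp: dist_norm)
qed

lemma nt_limit_continuous:
  assumes "continuous_on circle u" and \<xi>: "\<xi> \<in> circle"
  shows "has_nt_limit (poisson_fun u) \<xi> (u \<xi>)" "nt_limit (poisson_fun u) \<xi> = u \<xi>"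
proof -
  show lim: "has_nt_limit (poisson_fun u) \<xi> (u \<xi>)"
    unfolding has_nt_limit_def
    by (intro allI impI tendsto_within_subset[OF poisson_fun_tendsto[OF assms]]) (auto simp: stolz_region_def)
  have "L = u \<xi>" if "has_nt_limit (poisson_fun u) \<xi> L" for L
  proof (rule tendsto_unique)
    show "at \<xi> within stolz_region \<xi> 2 \<noteq> bot"
      using stolz_region_islimpt[OF \<xi>] by (simp add: trivial_limit_within)
    show "(poisson_fun u \<longlongrightarrow> L) (at \<xi> within stolz_region \<xi> 2)"
      "(poisson_fun u \<longlongrightarrow> u \<xi>) (at \<xi> within stolz_region \<xi> 2)"
      using that lim unfolding has_nt_limit_def by simp_all
  qed
  then show "nt_limit (poisson_fun u) \<xi> = u \<xi>"
    unfolding nt_limit_def by (intro the_equality lim)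
qed

lemma local_dirichlet_continuous:
  assumes "continuous_on circle u" "\<xi> \<in> circle"
  shows "local_dirichlet \<xi> u = (\<integral>\<^sup>+\<zeta>. ennreal ((cmod (u \<zeta> - u \<xi>))\<^sup>2 / (cmod (\<zeta> - \<xi>))\<^sup>2) \<partial>arc_measure)"
  using nt_limit_continuous[OF assms] unfolding local_dirichlet_def by auto

section \<open>Upper bound for the capacity by an explicit test function\<close>

section \<open>Divergence of the radial integral\<close>

text \<open>The weight that the energy estimates produce: the integral comes from the local
  Dirichlet integrals and \<open>s\<^sup>2\<close> from the L2 norm. The second term also keeps the
  weight positive away from 0.\<close>

definition radial_mass :: "complex measure \<Rightarrow> complex \<Rightarrow> real \<Rightarrow> real" where
  "radial_mass \<mu> lam s = (\<integral>\<xi>. (s / (ang lam \<xi> + s))\<^sup>2 \<partial>\<mu>) + s\<^sup>2"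

context
  fixes \<mu> :: "complex measure" and lam :: complex
  assumes finite_mu: "finite_measure \<mu>" and sets_mu: "sets \<mu> = sets circle_borel" and lam: "lam \<in> circle"
begin

interpretation finite_measure \<mu> by (rule finite_mu)

lemma space_mu: "space \<mu> = circle"
  using sets_eq_imp_space_eq[OF sets_mu] by (simp add: space_restrict_space)

lemma ang_measurable_mu[measurable]: "ang lam \<in> borel_measurable \<mu>"
  using ang_measurable[OF lam] measurable_cong_sets[OF sets_mu refl] by blast

lemma ratio_bounds:
  assumes "0 < s" "\<xi> \<in> circle"
  shows "0 \<le> (s / (ang lam \<xi> + s))\<^sup>2" "(s / (ang lam \<xi> + s))\<^sup>2 \<le> 1"
  using ang_bounds(1)[OF lam assms(2)] assms(1) by (auto intro!: power_le_one)

lemma integrable_ratio: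
  assumes "0 < s"
  shows "integrable \<mu> (\<lambda>\<xi>. (s / (ang lam \<xi> + s))\<^sup>2)"
  using ratio_bounds[OF assms] by (intro integrable_const_bound[of _ 1] AE_I2) (auto simp: space_mu)

lemma integrable_poisson_kernel_mu:
  assumes "cmod z < 1" shows "integrable \<mu> (poisson_kernel z)"
proof (rule integrable_const_bound[of _ "1 / (1 - cmod z)\<^sup>2"])
  show "AE \<xi> in \<mu>. norm (poisson_kernel z \<xi>) \<le> 1 / (1 - cmod z)\<^sup>2"
    using poisson_kernel_bounded[OF assms] poisson_kernel_nonneg[OF assms]
    by (intro AE_I2) (auto simp: space_mu)
  show "poisson_kernel z \<in> borel_measurable \<mu>" by (rule measurable_circle_borel[OF sets_mu]) simp
qed

lemma ennreal_radial_mass: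
  assumes "0 < s"
  shows "ennreal (radial_mass \<mu> lam s) = (\<integral>\<^sup>+\<xi>. ennreal ((s / (ang lam \<xi> + s))\<^sup>2) \<partial>\<mu>) + ennreal (s\<^sup>2)"
  unfolding radial_mass_def
  by (subst nn_integral_eq_integral[OF integrable_ratio[OF assms]]) auto

lemma radial_mass_ge: "s\<^sup>2 \<le> radial_mass \<mu> lam s"
  unfolding radial_mass_def by (simp add: integral_nonneg_AE)

lemma radial_mass_measurable[measurable]: "radial_mass \<mu> lam \<in> borel_measurable borel"
  unfolding radial_mass_def[abs_def] by measurable

text \<open>With \<open>s = 1 - x\<close>, passing through \<open>lam\<close> gives
  \<open>cmod (\<xi> - of_real x * lam) \<le> ang lam \<xi> + s\<close>, while
  \<open>s \<le> 1 - x\<^sup>2\<close>; hence \<open>(s / (ang lam \<xi> + s))\<^sup>2\<close> is at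
  most \<open>s\<close> times the Poisson kernel at \<xi>.\<close>

lemma radial_mass_le_poisson:
  assumes x: "0 \<le> x" "x < 1"
  shows "radial_mass \<mu> lam (1 - x) \<le> (1 - x) * poisson_measure \<mu> (of_real x * lam) + (1 - x)\<^sup>2"
proof -
  have z: "cmod (of_real x * lam) < 1" using x lam by (simp add: norm_mult)
  define s where "s = 1 - x"
  have s: "0 < s" "s \<le> 1" using x by (auto simp: s_def)
  have "(\<integral>\<xi>. (s / (ang lam \<xi> + s))\<^sup>2 \<partial>\<mu>) \<le> (\<integral>\<xi>. s * poisson_kernel (of_real x * lam) \<xi> \<partial>\<mu>)"
  proof (rule integral_mono)
    show "integrable \<mu> (\<lambda>\<xi>. (s / (ang lam \<xi> + s))\<^sup>2)" by (rule integrable_ratio[OF s(1)])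
    show "integrable \<mu> (\<lambda>\<xi>. s * poisson_kernel (of_real x * lam) \<xi>)"
      by (intro integrable_mult_right integrable_poisson_kernel_mu z)
    fix \<xi> assume "\<xi> \<in> space \<mu>"
    then have \<xi>: "\<xi> \<in> circle" by (simp add: space_mu)
    have "cmod (\<xi> - of_real x * lam) \<le> cmod (\<xi> - lam) + cmod (lam - of_real x * lam)"
      using norm_triangle_ineq[of "\<xi> - lam" "lam - of_real x * lam"] by simp
    also have "lam - of_real x * lam = of_real s * lam" by (simp add: s_def algebra_simps)
    also have "cmod (of_real s * lam) = s" using lam s by (simp add: norm_mult)
    also have "cmod (\<xi> - lam) \<le> ang lam \<xi>" by (rule cmod_diff_le_ang[OF lam \<xi>])
    finally have le: "cmod (\<xi> - of_real x * lam) \<le> ang lam \<xi> + s" by simp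
    have pos: "0 < cmod (\<xi> - of_real x * lam)"
      using norm_triangle_ineq2[of \<xi> "of_real x * lam"] z \<xi> by (simp only: mem_sphere_0)
    have "(s / (ang lam \<xi> + s))\<^sup>2 = s\<^sup>2 / (ang lam \<xi> + s)\<^sup>2" by (rule power_divide)
    also have "\<dots> \<le> s * (1 - x\<^sup>2) / (cmod (\<xi> - of_real x * lam))\<^sup>2"
    proof (rule frac_le)
      have "s \<le> 1 - x\<^sup>2" using x mult_left_le[of x x] by (simp add: s_def power2_eq_square)
      then show "s\<^sup>2 \<le> s * (1 - x\<^sup>2)" using s by (simp add: power2_eq_square)
      then show "0 \<le> s * (1 - x\<^sup>2)" using zero_le_power2[of s] by linarith
      show "(cmod (\<xi> - of_real x * lam))\<^sup>2 \<le> (ang lam \<xi> + s)\<^sup>2" using le pos by (intro power_mono) auto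
    qed (use pos in auto)
    finally show "(s / (ang lam \<xi> + s))\<^sup>2 \<le> s * poisson_kernel (of_real x * lam) \<xi>"
      using lam by (simp add: poisson_kernel_def norm_mult)
  qed
  then show ?thesis by (simp add: radial_mass_def poisson_measure_def s_def)
qed

lemma radial_mass_integral_infinite:
  assumes inf: "(\<integral>\<^sup>+x\<in>{0..<1}. ennreal (1 / ((1 - x) * poisson_measure \<mu> (of_real x * lam) + (1 - x)\<^sup>2)) \<partial>lborel) = \<infinity>"
  shows "(\<integral>\<^sup>+s. ennreal (1 / radial_mass \<mu> lam s) * indicator {0<..1} s \<partial>lborel) = \<infinity>"
proof -
  have "(\<integral>\<^sup>+x\<in>{0..<1}. ennreal (1 / ((1 - x) * poisson_measure \<mu> (of_real x * lam) + (1 - x)\<^sup>2)) \<partial>lborel)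
      \<le> (\<integral>\<^sup>+x. ennreal (1 / radial_mass \<mu> lam (1 - x)) * indicator {0<..1} (1 - x) \<partial>lborel)"
  proof (intro nn_integral_mono)
    fix x :: real
    show "ennreal (1 / ((1 - x) * poisson_measure \<mu> (of_real x * lam) + (1 - x)\<^sup>2)) * indicator {0..<1} x
        \<le> ennreal (1 / radial_mass \<mu> lam (1 - x)) * indicator {0<..1} (1 - x)"
    proof (cases "0 \<le> x \<and> x < 1")
      case True
      then have "0 < radial_mass \<mu> lam (1 - x)"
        using radial_mass_ge[of "1 - x"] zero_less_power[of "1 - x" 2] by linarith
      then have "1 / ((1 - x) * poisson_measure \<mu> (of_real x * lam) + (1 - x)\<^sup>2) \<le> 1 / radial_mass \<mu> lam (1 - x)"
        using True radial_mass_le_poisson[of x] by (intro divide_left_mono mult_pos_pos) auto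
      then show ?thesis using True by (auto intro: ennreal_leI)
    qed (auto simp: indicator_def)
  qed
  also have "\<dots> = (\<integral>\<^sup>+s. ennreal (1 / radial_mass \<mu> lam s) * indicator {0<..1} s \<partial>lborel)"
    by (subst (2) nn_integral_real_affine[where c = "-1" and t = 1]) auto
  finally show ?thesis using inf by (simp add: top_unique)
qed

text \<open>Monotone convergence makes the truncated integrals unbounded. Each is finite because
  \<open>radial_mass\<close> is at least \<open>d\<^sup>2\<close> on \<open>{d..1}\<close>, and a
  finite value is what allows the density to be normalised.\<close>

lemma large_truncated_integral:
  assumes inf: "(\<integral>\<^sup>+s. ennreal (1 / radial_mass \<mu> lam s) * indicator {0<..1} s \<partial>lborel) = \<infinity>"
  obtains d J where "0 < d" "R < J" "(\<integral>\<^sup>+s. ennreal (indicator {d..1} s / radial_mass \<mu> lam s) \<partial>lborel) = ennreal J"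
proof -
  define f where "f = (\<lambda>n s. ennreal (indicator {inverse (real (Suc n))..1} s / radial_mass \<mu> lam s))"
  have mono: "incseq f"
    unfolding f_def incseq_def le_fun_def
  proof (intro allI impI ennreal_leI divide_right_mono)
    fix m n :: nat and s assume "m \<le> n"
    then have le: "inverse (real (Suc n)) \<le> inverse (real (Suc m))" by (simp add: le_imp_inverse_le)
    show "indicator {inverse (real (Suc m))..1} s \<le> (indicator {inverse (real (Suc n))..1} s :: real)"
      by (auto simp: indicator_def simp del: of_nat_Suc intro: order_trans[OF le])
    show "0 \<le> radial_mass \<mu> lam s" using radial_mass_ge[of s] zero_le_power2[of s] by linarith
  qed
  have "(SUP n. f n s) = ennreal (1 / radial_mass \<mu> lam s) * indicator {0<..1} s" for s
  proof (rule antisym)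
    have "f n s \<le> ennreal (1 / radial_mass \<mu> lam s) * indicator {0<..1} s" for n
    proof (cases "inverse (real (Suc n)) \<le> s")
      case True
      then have "0 < s" using positive_imp_inverse_positive[of "real (Suc n)"] by linarith
      then show ?thesis by (auto simp: f_def indicator_def)
    qed (auto simp: f_def)
    then show "(SUP n. f n s) \<le> ennreal (1 / radial_mass \<mu> lam s) * indicator {0<..1} s"
      by (intro SUP_least)
    show "ennreal (1 / radial_mass \<mu> lam s) * indicator {0<..1} s \<le> (SUP n. f n s)"
    proof (cases "0 < s \<and> s \<le> 1")
      case True
      then obtain n where "inverse (real (Suc n)) < s" using reals_Archimedean by blast
      then have "ennreal (1 / radial_mass \<mu> lam s) * indicator {0<..1} s = f n s"
        using True by (auto simp: f_def)
      then show ?thesis by (auto intro: SUP_upper)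
    qed (auto simp: indicator_def)
  qed
  then have "(SUP n. \<integral>\<^sup>+s. f n s \<partial>lborel) = \<infinity>"
    using nn_integral_monotone_convergence_SUP[OF mono, of lborel] inf by (simp add: f_def)
  then have "ennreal R < (SUP n. \<integral>\<^sup>+s. f n s \<partial>lborel)"
    by (simp only: infinity_ennreal_def ennreal_less_top)
  then obtain n where n: "ennreal R < (\<integral>\<^sup>+s. f n s \<partial>lborel)" unfolding less_SUP_iff by blast
  define d where "d = inverse (real (Suc n))"
  have d: "0 < d" by (simp add: d_def)
  have "(\<integral>\<^sup>+s. f n s \<partial>lborel) \<le> (\<integral>\<^sup>+s. ennreal (1 / d\<^sup>2) * indicator {d..1} s \<partial>lborel)"
  proof (rule nn_integral_mono)
    fix s
    show "f n s \<le> ennreal (1 / d\<^sup>2) * indicator {d..1} s"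
    proof (cases "d \<le> s \<and> s \<le> 1")
      case True
      then have "d\<^sup>2 \<le> s\<^sup>2" using d by (intro power_mono) auto
      then have "d\<^sup>2 \<le> radial_mass \<mu> lam s" using radial_mass_ge[of s] by linarith
      then have "1 / radial_mass \<mu> lam s \<le> 1 / d\<^sup>2" using d by (intro frac_le) auto
      then show ?thesis using True unfolding f_def d_def[symmetric] by (simp add: ennreal_leI)
    next
      case False
      then show ?thesis unfolding f_def d_def[symmetric] by auto
    qed
  qed
  also have "\<dots> = ennreal (1 / d\<^sup>2) * emeasure lborel {d..1}" by (rule nn_integral_cmult_indicator) simp
  also have "\<dots> < \<infinity>" by (simp add: ennreal_mult_less_top emeasure_lborel_Icc_eq)
  finally have "(\<integral>\<^sup>+s. f n s \<partial>lborel) = ennreal (enn2real (\<integral>\<^sup>+s. f n s \<partial>lborel))" by simp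
  moreover from this n have "R < enn2real (\<integral>\<^sup>+s. f n s \<partial>lborel)"
    by (metis enn2real_nonneg ennreal_less_iff ennreal_neg linorder_not_le not_less_zero order_le_less_trans order_less_imp_le)
  ultimately show ?thesis using that[OF d, of "enn2real (\<integral>\<^sup>+s. f n s \<partial>lborel)"] unfolding f_def d_def by simp
qed

text \<open>By Cauchy-Schwarz, a density of mass 1 on \<open>{d..1}\<close> has weighted energy at
  least \<open>1 / J\<close>, with equality for the multiple of \<open>1 / radial_mass\<close>
  chosen here. The factor 64 is that of \<open>tail_local_energy\<close>.\<close>

lemma capacity_le_of_truncated_integral:
  assumes d: "0 < d" and J: "0 < J"
    and int: "(\<integral>\<^sup>+s. ennreal (indicator {d..1} s / radial_mass \<mu> lam s) \<partial>lborel) = ennreal J"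
  shows "capacity \<mu> {lam} \<le> ennreal (64 / J)"
proof -
  define \<omega> where "\<omega> s = indicator {d..1} s / radial_mass \<mu> lam s / J" for s
  have Q0: "0 \<le> radial_mass \<mu> lam s" for s using radial_mass_ge[of s] zero_le_power2[of s] by linarith
  have Qd: "d\<^sup>2 \<le> radial_mass \<mu> lam s" if "d \<le> s" for s
  proof -
    have "d\<^sup>2 \<le> s\<^sup>2" using d that by (intro power_mono) auto
    then show ?thesis using radial_mass_ge[of s] by linarith
  qed
  have [measurable]: "\<omega> \<in> borel_measurable borel" unfolding \<omega>_def[abs_def] by measurable
  interpret radial_density \<omega> "1 / d\<^sup>2 / J"
  proof
    fix s
    show "0 \<le> \<omega> s" using Q0[of s] J by (simp add: \<omega>_def)
    show "\<omega> s \<le> 1 / d\<^sup>2 / J"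
    proof (cases "d \<le> s")
      case True
      have "indicator {d..1} s / radial_mass \<mu> lam s \<le> 1 / d\<^sup>2"
        using Qd[OF True] d by (intro frac_le) (auto simp: indicator_def)
      then show ?thesis unfolding \<omega>_def using J by (intro divide_right_mono) auto
    qed (use J in \<open>auto simp: \<omega>_def\<close>)
    show "\<omega> s \<noteq> 0 \<Longrightarrow> 0 < s \<and> s \<le> 1" using d by (auto simp: \<omega>_def indicator_def split: if_splits)
  qed simp
  have int1: "(\<integral>\<^sup>+s. ennreal (\<omega> s) \<partial>lborel) = 1"
  proof -
    have "(\<integral>\<^sup>+s. ennreal (\<omega> s) \<partial>lborel) = (\<integral>\<^sup>+s. ennreal (1 / J) * ennreal (indicator {d..1} s / radial_mass \<mu> lam s) \<partial>lborel)"
      using J Q0 by (intro nn_integral_cong) (simp add: \<omega>_def ennreal_mult[symmetric])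
    also have "\<dots> = ennreal (1 / J) * ennreal J" by (subst nn_integral_cmult) (auto simp: int)
    also have "\<dots> = 1" using J by (simp add: ennreal_mult[symmetric])
    finally show ?thesis .
  qed
  have energy: "(\<integral>\<^sup>+s. ennreal ((\<omega> s)\<^sup>2) * ennreal (radial_mass \<mu> lam s) \<partial>lborel) = ennreal (1 / J)"
  proof -
    have "(\<omega> s)\<^sup>2 * radial_mass \<mu> lam s = 1 / J * \<omega> s" for s
    proof (cases "d \<le> s \<and> s \<le> 1")
      case True
      then have "0 < radial_mass \<mu> lam s" using Qd[of s] d by (meson less_le_trans zero_less_power)
      then show ?thesis using True J by (simp add: \<omega>_def power2_eq_square)
    qed (auto simp: \<omega>_def indicator_def)
    then have "ennreal ((\<omega> s)\<^sup>2) * ennreal (radial_mass \<mu> lam s) = ennreal (1 / J) * ennreal (\<omega> s)" for s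
      using J Q0 density_nonneg by (simp add: ennreal_mult[symmetric])
    then show ?thesis by (simp add: nn_integral_cmult int1)
  qed
  \<comment> \<open>The density lives on \<open>{d..1}\<close>, so below \<open>d\<close> the tail
    is the full mass. This makes \<open>u\<close> equal to 1 on a whole arc around
    \<open>lam\<close>.\<close>
  have tail1: "tail b = 1" if "b < d" for b
  proof -
    have "tail b = (\<integral>s. \<omega> s \<partial>lborel)"
      unfolding tail_def using that by (intro Bochner_Integration.integral_cong) (auto simp: \<omega>_def indicator_def)
    also have "\<dots> = 1"
      by (subst integral_eq_nn_integral) (auto simp: int1 density_nonneg)
    finally show ?thesis .
  qed
  define u where "u \<zeta> = complex_of_real (tail (ang lam \<zeta>))" for \<zeta>
  have cont: "continuous_on circle u"
    unfolding u_def by (intro continuous_intros continuous_on_compose2[OF continuous_on_tail[of UNIV]] continuous_on_ang lam) auto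
  have [measurable]: "u \<in> borel_measurable arc_measure"
    using borel_measurable_continuous_on_restrict[OF cont] by simp
  \<comment> \<open>\<open>S\<close> and \<open>T\<close> are the two parts of the integral of
    \<open>(\<omega> s)\<^sup>2 * radial_mass \<mu> lam s\<close>. The L2 constant 16 is raised to
    64 so that they recombine.\<close>
  define S where "S = (\<integral>\<^sup>+s. ennreal ((\<omega> s)\<^sup>2) * ennreal (s\<^sup>2) \<partial>lborel)"
  define T where "T = (\<integral>\<^sup>+s. ennreal ((\<omega> s)\<^sup>2) * (\<integral>\<^sup>+\<xi>. ennreal ((s / (ang lam \<xi> + s))\<^sup>2) \<partial>\<mu>) \<partial>lborel)"
  have l2: "(\<integral>\<^sup>+\<zeta>. ennreal ((cmod (u \<zeta>))\<^sup>2) \<partial>arc_measure) \<le> 64 * S"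
  proof -
    have "(\<integral>\<^sup>+\<zeta>. ennreal ((cmod (u \<zeta>))\<^sup>2) \<partial>arc_measure) = (\<integral>\<^sup>+\<zeta>. ennreal ((tail (ang lam \<zeta>))\<^sup>2) \<partial>arc_measure)"
      by (simp add: u_def)
    also have "\<dots> = ennreal (1 / pi) * (\<integral>\<^sup>+b. ennreal ((tail b)\<^sup>2) * indicator {0<..<pi} b \<partial>lborel)"
      by (rule nn_integral_arc_measure_ang[OF lam]) measurable
    also have "\<dots> \<le> 1 * (16 * (\<integral>\<^sup>+s. ennreal ((\<omega> s)\<^sup>2 * s\<^sup>2) \<partial>lborel))"
      using pi_ge_two by (intro mult_mono tail_square_le) (auto simp: ennreal_le_1)
    also have "\<dots> = 16 * S" by (simp add: S_def ennreal_mult)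
    also have "\<dots> \<le> 64 * S" by (intro mult_right_mono) auto
    finally show ?thesis .
  qed
  have dir: "dirichlet_integral \<mu> u \<le> 64 * T"
  proof -
    have "dirichlet_integral \<mu> u \<le> (\<integral>\<^sup>+\<xi>. 64 * (\<integral>\<^sup>+s. ennreal ((\<omega> s)\<^sup>2 * (s / (ang lam \<xi> + s))\<^sup>2) \<partial>lborel) \<partial>\<mu>)"
      unfolding dirichlet_integral_def
    proof (intro nn_integral_mono)
      fix \<xi> assume "\<xi> \<in> space \<mu>"
      then have \<xi>: "\<xi> \<in> circle" by (simp add: space_mu)
      have "local_dirichlet \<xi> u = (\<integral>\<^sup>+\<zeta>. ennreal ((tail (ang lam \<zeta>) - tail (ang lam \<xi>))\<^sup>2 / (cmod (\<zeta> - \<xi>))\<^sup>2) \<partial>arc_measure)"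
        unfolding local_dirichlet_continuous[OF cont \<xi>] u_def of_real_diff[symmetric] norm_of_real power2_abs ..
      also have "\<dots> \<le> 64 * (\<integral>\<^sup>+s. ennreal ((\<omega> s)\<^sup>2 * (s / (ang lam \<xi> + s))\<^sup>2) \<partial>lborel)"
        by (rule tail_local_energy[OF lam \<xi>])
      finally show "local_dirichlet \<xi> u \<le> 64 * (\<integral>\<^sup>+s. ennreal ((\<omega> s)\<^sup>2 * (s / (ang lam \<xi> + s))\<^sup>2) \<partial>lborel)" .
    qed
    also have "\<dots> = 64 * (\<integral>\<^sup>+\<xi>. (\<integral>\<^sup>+s. ennreal ((\<omega> s)\<^sup>2) * ennreal ((s / (ang lam \<xi> + s))\<^sup>2) \<partial>lborel) \<partial>\<mu>)"
      by (subst nn_integral_cmult) (auto simp: ennreal_mult)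
    also have "(\<integral>\<^sup>+\<xi>. (\<integral>\<^sup>+s. ennreal ((\<omega> s)\<^sup>2) * ennreal ((s / (ang lam \<xi> + s))\<^sup>2) \<partial>lborel) \<partial>\<mu>) =
        (\<integral>\<^sup>+s. (\<integral>\<^sup>+\<xi>. ennreal ((\<omega> s)\<^sup>2) * ennreal ((s / (ang lam \<xi> + s))\<^sup>2) \<partial>\<mu>) \<partial>lborel)"
    proof -
      interpret P: pair_sigma_finite \<mu> lborel ..
      show ?thesis by (rule P.Fubini'[symmetric]) measurable
    qed
    also have "\<dots> = T" unfolding T_def by (simp add: nn_integral_cmult)
    finally show ?thesis .
  qed
  have "dirichlet_norm_sq \<mu> u \<le> 64 * S + 64 * T"
    unfolding dirichlet_norm_sq_def by (intro add_mono l2 dir)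
  also have "\<dots> = 64 * (T + S)" by (simp add: distrib_left add.commute)
  also have "T + S = (\<integral>\<^sup>+s. ennreal ((\<omega> s)\<^sup>2) * (\<integral>\<^sup>+\<xi>. ennreal ((s / (ang lam \<xi> + s))\<^sup>2) \<partial>\<mu>)
      + ennreal ((\<omega> s)\<^sup>2) * ennreal (s\<^sup>2) \<partial>lborel)"
    unfolding S_def T_def by (subst nn_integral_add) auto
  \<comment> \<open>\<open>ennreal_radial_mass\<close> holds for positive \<open>s\<close>;
    elsewhere the density vanishes.\<close>
  also have "\<dots> = (\<integral>\<^sup>+s. ennreal ((\<omega> s)\<^sup>2) * ennreal (radial_mass \<mu> lam s) \<partial>lborel)"
  proof (intro nn_integral_cong)
    fix s
    show "ennreal ((\<omega> s)\<^sup>2) * (\<integral>\<^sup>+\<xi>. ennreal ((s / (ang lam \<xi> + s))\<^sup>2) \<partial>\<mu>) + ennreal ((\<omega> s)\<^sup>2) * ennreal (s\<^sup>2)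
        = ennreal ((\<omega> s)\<^sup>2) * ennreal (radial_mass \<mu> lam s)"
      using density_support[of s] by (cases "\<omega> s = 0") (simp_all add: ennreal_radial_mass distrib_left)
  qed
  also have "64 * \<dots> = ennreal (64 / J)"
    unfolding energy using J by (subst ennreal_numeral[symmetric], subst ennreal_mult[symmetric]) auto
  finally have norm: "dirichlet_norm_sq \<mu> u \<le> ennreal (64 / J)" .
  then have fin: "dirichlet_norm_sq \<mu> u < \<infinity>" by (rule le_less_trans) simp
  then have "u \<in> harmonic_dirichlet_space \<mu>"
    unfolding harmonic_dirichlet_space_def L2_circle_def
    by (auto simp: dirichlet_norm_sq_def intro: le_less_trans[rotated])
  define U where "U = circle \<inter> ang lam -` {..<d}"
  have "openin (top_of_set circle) U"
    unfolding U_def by (rule continuous_openin_preimage_gen[OF continuous_on_ang[OF lam]]) simp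
  moreover have "{lam} \<subseteq> U" using lam d by (simp add: U_def)
  ultimately have "capacity \<mu> {lam} \<le> open_capacity \<mu> U"
    unfolding capacity_def by (intro Inf_lower) blast
  also have "\<dots> \<le> dirichlet_norm_sq \<mu> u"
    unfolding open_capacity_def
  proof (intro Inf_lower CollectI exI[of _ u] conjI refl)
    show "u \<in> harmonic_dirichlet_space \<mu>" by fact
    show "AE \<zeta> in arc_measure. u \<zeta> \<in> \<real> \<and> 0 \<le> Re (u \<zeta>)"
      by (intro AE_I2) (simp add: u_def tail_nonneg)
    show "AE \<zeta> in arc_measure. \<zeta> \<in> U \<longrightarrow> 1 \<le> Re (u \<zeta>)"
      by (intro AE_I2) (simp add: u_def U_def tail1)
  qed
  finally show ?thesis using norm by (rule order_trans)
qed

lemma capacity_eq_0: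
  assumes "(\<integral>\<^sup>+x\<in>{0..<1}. ennreal (1 / ((1 - x) * poisson_measure \<mu> (of_real x * lam) + (1 - x)\<^sup>2)) \<partial>lborel) = \<infinity>"
  shows "capacity \<mu> {lam} = 0"
proof -
  have "capacity \<mu> {lam} \<le> 0"
  proof (rule ennreal_le_epsilon)
    fix e :: real assume e: "0 < e"
    obtain d J where dJ: "0 < d" "64 / e < J"
      "(\<integral>\<^sup>+s. ennreal (indicator {d..1} s / radial_mass \<mu> lam s) \<partial>lborel) = ennreal J"
      using large_truncated_integral[OF radial_mass_integral_infinite[OF assms]] .
    have J: "0 < J" using dJ(2) e by (smt (verit) divide_pos_pos)
    have "capacity \<mu> {lam} \<le> ennreal (64 / J)"
      by (rule capacity_le_of_truncated_integral[OF dJ(1) J dJ(3)])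
    also have "\<dots> \<le> ennreal e" using dJ(2) e J by (intro ennreal_leI) (simp add: field_simps)
    finally show "capacity \<mu> {lam} \<le> 0 + ennreal e" by simp
  qed
  then show ?thesis by simp
qed

end

section \<open>A lower bound for the norm, uniform over neighbourhoods of the point\<close>

section \<open>Convergence of the radial integral\<close>

text \<open>The integrals of \<open>1 / (y * sqrt t)\<close> below \<open>y\<close> and of
  \<open>1 / (t * sqrt t)\<close> above \<open>y\<close> are each at most \<open>2 / sqrt y\<close>.
  The bound does not depend on \<open>c\<close>.\<close>

lemma nn_integral_inverse_max_le:
  fixes y c :: real
  assumes y: "0 < y"
  shows "(\<integral>\<^sup>+t. ennreal (1 / (max y t * sqrt t)) * indicator {0<..<c} t \<partial>lborel) \<le> ennreal (4 / sqrt y)"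
proof -
  \<comment> \<open>The maximum keeps the upper limit of the second piece at least \<open>y\<close>
    when \<open>c\<close> is smaller than \<open>y\<close>.\<close>
  define e where "e = max y c"
  have e: "y \<le> e" by (simp add: e_def)
  have sq: "y = sqrt y * sqrt y" using y by simp
  have "AE t in lborel. t \<noteq> y" by (rule AE_lborel_singleton)
  then have "(\<integral>\<^sup>+t. ennreal (1 / (max y t * sqrt t)) * indicator {0<..<c} t \<partial>lborel) \<le>
      (\<integral>\<^sup>+t. ennreal (1 / (y * sqrt t)) * indicator {0<..<y} t + ennreal (1 / (t * sqrt t)) * indicator {y<..<e} t \<partial>lborel)"
    by (intro nn_integral_mono_AE, eventually_elim) (auto simp: indicator_def e_def max_def)
  also have "\<dots> = (\<integral>\<^sup>+t. ennreal (1 / (y * sqrt t)) * indicator {0<..<y} t \<partial>lborel) +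
      (\<integral>\<^sup>+t. ennreal (1 / (t * sqrt t)) * indicator {y<..<e} t \<partial>lborel)"
    by (rule nn_integral_add) auto
  also have "(\<integral>\<^sup>+t. ennreal (1 / (y * sqrt t)) * indicator {0<..<y} t \<partial>lborel) = ennreal (2 * sqrt y / y - 2 * sqrt 0 / y)"
    using y by (intro nn_integral_FTC_interior)
      (auto intro!: continuous_intros derivative_eq_intros simp: divide_simps)
  also have "2 * sqrt y / y - 2 * sqrt 0 / y = 2 / sqrt y"
    using y by (simp add: field_simps)
  also have "(\<integral>\<^sup>+t. ennreal (1 / (t * sqrt t)) * indicator {y<..<e} t \<partial>lborel) = ennreal (- 2 / sqrt e - - 2 / sqrt y)"
    using y e by (intro nn_integral_FTC_interior)
      (auto intro!: continuous_intros derivative_eq_intros simp: divide_simps)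
  also have "ennreal (2 / sqrt y) + ennreal (- 2 / sqrt e - - 2 / sqrt y) \<le> ennreal (2 / sqrt y) + ennreal (2 / sqrt y)"
    using y e by (intro add_left_mono ennreal_leI) auto
  also have "\<dots> = ennreal (4 / sqrt y)" using y by (subst ennreal_plus[symmetric]) auto
  finally show ?thesis .
qed

text \<open>The kernel \<open>1 / max y t\<close> is homogeneous of degree -1, so square root
  weights fit Schur's test. By \<open>nn_integral_inverse_max_le\<close> the rows, with the density
  \<open>1 / pi \<le> 1 / 2\<close> of the angle, give \<open>2 / sqrt y\<close>, and the columns
  multiply this by 4. The condition on \<open>ang\<close> removes one point, at which the Schur
  weight would vanish.\<close>

lemma hilbert_inequality_arc:
  fixes g :: "complex \<Rightarrow> ennreal"
  assumes lam: "lam \<in> circle" and [measurable]: "g \<in> borel_measurable arc_measure"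
  shows "(\<integral>\<^sup>+y. (\<integral>\<^sup>+\<zeta>. g \<zeta> * ennreal (if 0 < y \<and> y < 2 \<and> 0 < ang lam \<zeta> then 1 / max y (ang lam \<zeta>) else 0) \<partial>arc_measure)\<^sup>2 \<partial>lborel)
    \<le> 8 * (\<integral>\<^sup>+\<zeta>. (g \<zeta>)\<^sup>2 \<partial>arc_measure)"
proof -
  interpret A: finite_measure arc_measure by (rule finite_measure_arc_measure)
  have [measurable]: "ang lam \<in> borel_measurable arc_measure"
    using ang_measurable[OF lam] by simp
  define K where "K = (\<lambda>y \<zeta>. if 0 < y \<and> y < 2 \<and> 0 < ang lam \<zeta> then 1 / max y (ang lam \<zeta>) else 0)"
  have "(\<integral>\<^sup>+y. (\<integral>\<^sup>+\<zeta>. g \<zeta> * ennreal (K y \<zeta>) \<partial>arc_measure)\<^sup>2 \<partial>lborel) \<le> (\<integral>\<^sup>+\<zeta>. (g \<zeta>)\<^sup>2 * 8 \<partial>arc_measure)"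
  proof (rule schur_test[where p = "\<lambda>\<zeta>. sqrt (ang lam \<zeta>)" and A = "\<lambda>y. if 0 < y then 2 / sqrt y else 0"])
    fix y
    show "(\<integral>\<^sup>+\<zeta>. ennreal (K y \<zeta> / sqrt (ang lam \<zeta>)) \<partial>arc_measure) \<le> ennreal (if 0 < y then 2 / sqrt y else 0)"
    proof (cases "0 < y")
      case True
      have "(\<integral>\<^sup>+\<zeta>. ennreal (K y \<zeta> / sqrt (ang lam \<zeta>)) \<partial>arc_measure) \<le>
          (\<integral>\<^sup>+\<zeta>. ennreal (1 / (max y (ang lam \<zeta>) * sqrt (ang lam \<zeta>))) \<partial>arc_measure)"
        by (intro nn_integral_mono) (auto simp: K_def)
      also have "\<dots> = ennreal (1 / pi) * (\<integral>\<^sup>+b. ennreal (1 / (max y b * sqrt b)) * indicator {0<..<pi} b \<partial>lborel)"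
        by (rule nn_integral_arc_measure_ang[OF lam]) measurable
      also have "\<dots> \<le> ennreal (1 / 2) * ennreal (4 / sqrt y)"
        using pi_ge_two by (intro mult_mono nn_integral_inverse_max_le True ennreal_leI) (auto simp: field_simps)
      also have "\<dots> = ennreal (2 / sqrt y)" using True by (subst ennreal_mult[symmetric]) auto
      finally show ?thesis using True by simp
    qed (simp add: K_def)
  next
    fix \<zeta> assume "\<zeta> \<in> space arc_measure"
    show "(\<integral>\<^sup>+y. ennreal (K y \<zeta> * (if 0 < y then 2 / sqrt y else 0)) \<partial>lborel) * ennreal (sqrt (ang lam \<zeta>)) \<le> 8"
    proof (cases "0 < ang lam \<zeta>")
      case True
      have "(\<integral>\<^sup>+y. ennreal (K y \<zeta> * (if 0 < y then 2 / sqrt y else 0)) \<partial>lborel) =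
          (\<integral>\<^sup>+y. 2 * (ennreal (1 / (max (ang lam \<zeta>) y * sqrt y)) * indicator {0<..<2} y) \<partial>lborel)"
        using True by (intro nn_integral_cong)
          (auto simp: K_def indicator_def max.commute ennreal_mult[symmetric] simp flip: ennreal_numeral)
      also have "\<dots> = 2 * (\<integral>\<^sup>+y. ennreal (1 / (max (ang lam \<zeta>) y * sqrt y)) * indicator {0<..<2} y \<partial>lborel)"
        by (rule nn_integral_cmult) measurable
      also have "\<dots> \<le> 2 * ennreal (4 / sqrt (ang lam \<zeta>))"
        by (intro mult_left_mono nn_integral_inverse_max_le True) simp
      finally have "(\<integral>\<^sup>+y. ennreal (K y \<zeta> * (if 0 < y then 2 / sqrt y else 0)) \<partial>lborel) * ennreal (sqrt (ang lam \<zeta>))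
          \<le> 2 * ennreal (4 / sqrt (ang lam \<zeta>)) * ennreal (sqrt (ang lam \<zeta>))"
        by (intro mult_right_mono) auto
      also have "\<dots> = ennreal (2 * (4 / sqrt (ang lam \<zeta>)) * sqrt (ang lam \<zeta>))"
        using True by (simp add: ennreal_mult[symmetric] flip: ennreal_numeral)
      also have "2 * (4 / sqrt (ang lam \<zeta>)) * sqrt (ang lam \<zeta>) = 8" using True by simp
      finally show ?thesis by simp
    qed (simp add: K_def)
  qed (auto simp: K_def lborel.sigma_finite_measure_axioms A.sigma_finite_measure_axioms split: if_splits)
  also have "\<dots> = 8 * (\<integral>\<^sup>+\<zeta>. (g \<zeta>)\<^sup>2 \<partial>arc_measure)"
    by (subst nn_integral_multc) (auto simp: mult.commute)
  finally show ?thesis by (simp only: K_def)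
qed

text \<open>The distance \<open>D\<close> from \<zeta> to the radial point is at least
  \<open>1 - x\<close>, and the angle is at most
  \<open>2 * cmod (\<zeta> - lam) \<le> 2 * (D + (1 - x)) \<le> 4 * D\<close>.\<close>

lemma max_ang_le:
  assumes lam: "lam \<in> circle" "\<zeta> \<in> circle" and x: "0 \<le> x" "x < 1"
  shows "max (1 - x) (ang lam \<zeta>) \<le> 4 * cmod (\<zeta> - of_real x * lam)" "1 - x \<le> cmod (\<zeta> - of_real x * lam)"
proof -
  have "cmod (of_real x * lam) = x" using lam x by (simp add: norm_mult)
  then show y: "1 - x \<le> cmod (\<zeta> - of_real x * lam)"
    using norm_triangle_ineq2[of \<zeta> "of_real x * lam"] lam by simp
  have "ang lam \<zeta> \<le> 2 * cmod (\<zeta> - lam)"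
    using ang_diff_le[OF lam(1) lam(2) lam(1)] lam by simp
  also have "cmod (\<zeta> - lam) \<le> cmod (\<zeta> - of_real x * lam) + cmod (of_real x * lam - lam)"
    using norm_triangle_ineq[of "\<zeta> - of_real x * lam" "of_real x * lam - lam"] by simp
  also have "of_real x * lam - lam = of_real (x - 1) * lam" by (simp add: algebra_simps)
  also have "cmod (of_real (x - 1) * lam) = 1 - x" using lam x by (simp only: norm_mult norm_of_real) simp
  finally show "max (1 - x) (ang lam \<zeta>) \<le> 4 * cmod (\<zeta> - of_real x * lam)" using y x by simp
qed

text \<open>The common core of the L2 and the local estimate. Assumption \<open>le\<close> says that
  the weight absorbs one power of the distance \<open>D\<close> from \<zeta> to
  \<open>of_real x * lam\<close>, turning \<open>v\<close> into \<open>g\<close>. By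
  \<open>radial_kernel_bound\<close> the integrand is then at most \<open>8 * g / D\<close>, by
  \<open>max_ang_le\<close> at most \<open>32 * g\<close> times the Hilbert-type kernel, and
  \<open>32\<^sup>2 * 8 = 8192\<close>.\<close>

lemma radial_derivative_weighted_bound:
  fixes v g :: "complex \<Rightarrow> real" and w :: "real \<Rightarrow> real"
  assumes lam: "lam \<in> circle" and v: "integrable arc_measure v"
    and g[measurable]: "g \<in> borel_measurable arc_measure" and g0: "\<And>\<zeta>. 0 \<le> g \<zeta>"
    and w0: "\<And>x. 0 \<le> w x"
    and le: "\<And>x. 0 \<le> x \<Longrightarrow> x < 1 \<Longrightarrow> AE \<zeta> in arc_measure.
      w x * \<bar>v \<zeta>\<bar> / (cmod (\<zeta> - of_real x * lam))\<^sup>2 \<le> 4 * g \<zeta> / cmod (\<zeta> - of_real x * lam)"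
  shows "(\<integral>\<^sup>+x\<in>{0..<1}. ennreal ((\<integral>\<zeta>. radial_kernel lam x \<zeta> * v \<zeta> \<partial>arc_measure)\<^sup>2 * (w x)\<^sup>2) \<partial>lborel)
    \<le> 8192 * (\<integral>\<^sup>+\<zeta>. ennreal ((g \<zeta>)\<^sup>2) \<partial>arc_measure)"
proof -
  interpret A: finite_measure arc_measure by (rule finite_measure_arc_measure)
  have [measurable]: "v \<in> borel_measurable arc_measure" using v by simp
  have [measurable]: "ang lam \<in> borel_measurable arc_measure"
    using ang_measurable[OF lam] by simp
  define K where "K = (\<lambda>y \<zeta>. if 0 < y \<and> y < 2 \<and> 0 < ang lam \<zeta> then 1 / max y (ang lam \<zeta>) else 0)"
  have [measurable]: "case_prod K \<in> borel_measurable (lborel \<Otimes>\<^sub>M arc_measure)"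
    unfolding K_def by measurable
  define X where "X y = (\<integral>\<^sup>+\<zeta>. ennreal (g \<zeta>) * ennreal (K y \<zeta>) \<partial>arc_measure)" for y
  have [measurable]: "X \<in> borel_measurable borel"
    using A.borel_measurable_nn_integral[of "\<lambda>y \<zeta>. ennreal (g \<zeta>) * ennreal (K y \<zeta>)" lborel]
    unfolding X_def[abs_def] by simp
  have pointwise: "ennreal ((\<integral>\<zeta>. radial_kernel lam x \<zeta> * v \<zeta> \<partial>arc_measure)\<^sup>2 * (w x)\<^sup>2) \<le> 1024 * (X (1 - x))\<^sup>2"
    if x: "0 \<le> x" "x < 1" for x
  proof -
    define V where "V = (\<integral>\<zeta>. radial_kernel lam x \<zeta> * v \<zeta> \<partial>arc_measure)"
    have [measurable]: "radial_kernel lam x \<in> borel_measurable arc_measure"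
      by (rule measurable_circle_borel) (simp_all add: radial_kernel_def[abs_def])
    have "ennreal (w x * \<bar>V\<bar>) = ennreal \<bar>\<integral>\<zeta>. w x * (radial_kernel lam x \<zeta> * v \<zeta>) \<partial>arc_measure\<bar>"
      using w0 by (simp add: V_def abs_mult)
    also have "\<dots> \<le> (\<integral>\<^sup>+\<zeta>. ennreal \<bar>w x * (radial_kernel lam x \<zeta> * v \<zeta>)\<bar> \<partial>arc_measure)"
    proof -
      have "integrable arc_measure (\<lambda>\<zeta>. radial_kernel lam x \<zeta> * v \<zeta>)"
      proof (rule Bochner_Integration.integrable_bound)
        show "integrable arc_measure (\<lambda>\<zeta>. 2 / (1 - x)\<^sup>2 * v \<zeta>)" using v by simp
        show "AE \<zeta> in arc_measure. norm (radial_kernel lam x \<zeta> * v \<zeta>) \<le> norm (2 / (1 - x)\<^sup>2 * v \<zeta>)"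
          unfolding real_norm_def abs_mult using radial_kernel_bound'[OF lam _ x]
          by (intro AE_I2 mult_right_mono) auto
      qed measurable
      then show ?thesis
        using integral_norm_bound_ennreal[of arc_measure "\<lambda>\<zeta>. w x * (radial_kernel lam x \<zeta> * v \<zeta>)"] by simp
    qed
    also have "\<dots> \<le> (\<integral>\<^sup>+\<zeta>. ennreal 32 * (ennreal (g \<zeta>) * ennreal (K (1 - x) \<zeta>)) \<partial>arc_measure)"
    proof (rule nn_integral_mono_AE)
      show "AE \<zeta> in arc_measure. ennreal \<bar>w x * (radial_kernel lam x \<zeta> * v \<zeta>)\<bar>
          \<le> ennreal 32 * (ennreal (g \<zeta>) * ennreal (K (1 - x) \<zeta>))"
        using le[OF x] AE_arc_measure_ang_pos[OF lam] AE_space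
      proof eventually_elim
        case (elim \<zeta>)
        then have \<zeta>: "\<zeta> \<in> circle" by simp
        define D where "D = cmod (\<zeta> - of_real x * lam)"
        have D: "0 < D" using max_ang_le(2)[OF lam \<zeta> x] x unfolding D_def by linarith
        have "\<bar>w x * (radial_kernel lam x \<zeta> * v \<zeta>)\<bar> = \<bar>radial_kernel lam x \<zeta>\<bar> * (w x * \<bar>v \<zeta>\<bar>)"
          using w0 by (simp add: abs_mult)
        also have "\<dots> \<le> 2 / D\<^sup>2 * (w x * \<bar>v \<zeta>\<bar>)"
          unfolding D_def using w0 by (intro mult_right_mono radial_kernel_bound lam \<zeta> x) auto
        also have "\<dots> = 2 * (w x * \<bar>v \<zeta>\<bar> / D\<^sup>2)" by simp
        also have "\<dots> \<le> 2 * (4 * g \<zeta> / D)"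
          using elim(1) by (intro mult_left_mono) (auto simp: D_def)
        also have "\<dots> = 8 * g \<zeta> * (1 / D)" by simp
        also have "\<dots> \<le> 8 * g \<zeta> * (4 / max (1 - x) (ang lam \<zeta>))"
        proof (intro mult_left_mono)
          show "1 / D \<le> 4 / max (1 - x) (ang lam \<zeta>)"
            using max_ang_le(1)[OF lam \<zeta> x] D x by (simp add: D_def divide_simps)
        qed (simp add: g0)
        also have "\<dots> = 32 * (g \<zeta> * K (1 - x) \<zeta>)"
          using x elim(2) by (simp add: K_def)
        finally have "ennreal \<bar>w x * (radial_kernel lam x \<zeta> * v \<zeta>)\<bar> \<le> ennreal (32 * (g \<zeta> * K (1 - x) \<zeta>))"
          by (rule ennreal_leI)
        also have "\<dots> = ennreal 32 * (ennreal (g \<zeta>) * ennreal (K (1 - x) \<zeta>))"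
          using x g0[of \<zeta>] by (simp only: ennreal_mult'[OF g0] ennreal_mult'[OF zero_le_numeral])
        finally show ?case .
      qed
    qed
    also have "\<dots> = ennreal 32 * X (1 - x)"
    proof -
      have [measurable]: "K (1 - x) \<in> borel_measurable arc_measure" unfolding K_def by measurable
      show ?thesis unfolding X_def by (rule nn_integral_cmult) measurable
    qed
    finally have "(ennreal (w x * \<bar>V\<bar>))\<^sup>2 \<le> (ennreal 32 * X (1 - x))\<^sup>2" by (intro power_mono) auto
    then show ?thesis
      using w0 unfolding V_def[symmetric]
      by (simp add: ennreal_power power_mult_distrib mult.commute)
  qed
  have "(\<integral>\<^sup>+x\<in>{0..<1}. ennreal ((\<integral>\<zeta>. radial_kernel lam x \<zeta> * v \<zeta> \<partial>arc_measure)\<^sup>2 * (w x)\<^sup>2) \<partial>lborel)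
      \<le> (\<integral>\<^sup>+x. 1024 * (X (1 - x))\<^sup>2 \<partial>lborel)"
    by (intro nn_integral_mono) (auto simp: indicator_def pointwise)
  also have "\<dots> = 1024 * (\<integral>\<^sup>+x. (X (1 - x))\<^sup>2 \<partial>lborel)" by (rule nn_integral_cmult) measurable
  also have "(\<integral>\<^sup>+x. (X (1 - x))\<^sup>2 \<partial>lborel) = (\<integral>\<^sup>+y. (X y)\<^sup>2 \<partial>lborel)"
    by (subst (2) nn_integral_real_affine[where c = "-1" and t = 1]) auto
  also have "\<dots> \<le> 8 * (\<integral>\<^sup>+\<zeta>. (ennreal (g \<zeta>))\<^sup>2 \<partial>arc_measure)"
    unfolding X_def K_def by (rule hilbert_inequality_arc[OF lam]) measurable
  finally show ?thesis using g0 by (simp add: mult_left_mono ennreal_power mult.assoc[symmetric])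
qed

text \<open>With \<open>g = \<bar>v\<bar>\<close> the weight \<open>1 - x\<close> is itself at most
  the distance to the radial point.\<close>

lemma radial_derivative_l2_bound:
  assumes lam: "lam \<in> circle" and v: "integrable arc_measure v"
  shows "(\<integral>\<^sup>+x\<in>{0..<1}. ennreal ((\<integral>\<zeta>. radial_kernel lam x \<zeta> * v \<zeta> \<partial>arc_measure)\<^sup>2 * (1 - x)\<^sup>2) \<partial>lborel)
    \<le> 8192 * (\<integral>\<^sup>+\<zeta>. ennreal ((v \<zeta>)\<^sup>2) \<partial>arc_measure)"
proof -
  have [measurable]: "v \<in> borel_measurable arc_measure" using v by simp
  \<comment> \<open>The absolute value makes the weight nonnegative for all real \<open>x\<close>,
    as the general bound demands.\<close>
  have "(\<integral>\<^sup>+x\<in>{0..<1}. ennreal ((\<integral>\<zeta>. radial_kernel lam x \<zeta> * v \<zeta> \<partial>arc_measure)\<^sup>2 * \<bar>1 - x\<bar>\<^sup>2) \<partial>lborel)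
    \<le> 8192 * (\<integral>\<^sup>+\<zeta>. ennreal (\<bar>v \<zeta>\<bar>\<^sup>2) \<partial>arc_measure)"
  proof (rule radial_derivative_weighted_bound[OF lam v])
    fix x :: real assume x: "0 \<le> x" "x < 1"
    show "AE \<zeta> in arc_measure. \<bar>1 - x\<bar> * \<bar>v \<zeta>\<bar> / (cmod (\<zeta> - of_real x * lam))\<^sup>2 \<le> 4 * \<bar>v \<zeta>\<bar> / cmod (\<zeta> - of_real x * lam)"
    proof (intro AE_I2)
      fix \<zeta> assume "\<zeta> \<in> space arc_measure"
      define D where "D = cmod (\<zeta> - of_real x * lam)"
      have D: "1 - x \<le> D" using max_ang_le(2)[OF lam _ x, of \<zeta>] \<open>\<zeta> \<in> _\<close> by (simp add: D_def)
      have "\<bar>1 - x\<bar> * \<bar>v \<zeta>\<bar> / D\<^sup>2 \<le> (4 * D) * \<bar>v \<zeta>\<bar> / D\<^sup>2"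
        using D x by (intro divide_right_mono mult_right_mono) auto
      also have "\<dots> = 4 * \<bar>v \<zeta>\<bar> / D" by (simp add: power2_eq_square)
      finally show "\<bar>1 - x\<bar> * \<bar>v \<zeta>\<bar> / (cmod (\<zeta> - of_real x * lam))\<^sup>2 \<le> 4 * \<bar>v \<zeta>\<bar> / cmod (\<zeta> - of_real x * lam)"
        by (simp add: D_def)
    qed
  qed auto
  then show ?thesis by simp
qed

text \<open>With \<open>D\<close> and \<open>E\<close> the distances of \<zeta> and \<xi> from the
  radial point, the root of the weight is at most \<open>2 * (1 - x) / E\<close>. Both distances are
  at least \<open>1 - x\<close>, and \<open>cmod (\<zeta> - \<xi>) \<le> D + E\<close>; hence
  \<open>(1 - x) * cmod (\<zeta> - \<xi>) \<le> 2 * D * E\<close>, which cancels \<open>E\<close>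
  and leaves a bound uniform in \<xi>.\<close>

lemma radial_derivative_local_bound:
  fixes c :: real
  assumes lam: "lam \<in> circle" and \<xi>: "\<xi> \<in> circle" and v: "integrable arc_measure v"
  shows "(\<integral>\<^sup>+x\<in>{0..<1}. ennreal ((\<integral>\<zeta>. radial_kernel lam x \<zeta> * v \<zeta> \<partial>arc_measure)\<^sup>2 *
      ((1 - x) * poisson_kernel (of_real x * lam) \<xi>)) \<partial>lborel)
    \<le> 8192 * (\<integral>\<^sup>+\<zeta>. ennreal ((v \<zeta> - c)\<^sup>2 / (cmod (\<zeta> - \<xi>))\<^sup>2) \<partial>arc_measure)"
proof -
  interpret A: finite_measure arc_measure by (rule finite_measure_arc_measure)
  have [measurable]: "v \<in> borel_measurable arc_measure" using v by simp
  have [measurable]: "(\<lambda>\<zeta>. cmod (\<zeta> - \<xi>)) \<in> borel_measurable arc_measure"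
    by (rule measurable_circle_borel) auto
  \<comment> \<open>The indicator protects nonnegativity for \<open>x\<close> outside
    \<open>{0..<1}\<close>, where the Poisson kernel may be negative.\<close>
  define w where "w x = sqrt ((1 - x) * poisson_kernel (of_real x * lam) \<xi>) * indicator {0..<1} x" for x
  define g where "g \<zeta> = \<bar>v \<zeta> - c\<bar> / cmod (\<zeta> - \<xi>)" for \<zeta>
  have vc: "integrable arc_measure (\<lambda>\<zeta>. v \<zeta> - c)" using v by simp
  have Pnn: "0 \<le> (1 - x) * poisson_kernel (of_real x * lam) \<xi>" if "0 \<le> x" "x < 1" for x
    using that lam by (intro mult_nonneg_nonneg poisson_kernel_nonneg) (auto simp: norm_mult)
  have w0: "0 \<le> w x" for x
    using Pnn[of x] by (auto simp: w_def indicator_def)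
  have bound: "(\<integral>\<^sup>+x\<in>{0..<1}. ennreal ((\<integral>\<zeta>. radial_kernel lam x \<zeta> * (v \<zeta> - c) \<partial>arc_measure)\<^sup>2 * (w x)\<^sup>2) \<partial>lborel)
    \<le> 8192 * (\<integral>\<^sup>+\<zeta>. ennreal ((g \<zeta>)\<^sup>2) \<partial>arc_measure)"
  proof (rule radial_derivative_weighted_bound[OF lam vc])
    fix x :: real assume x: "0 \<le> x" "x < 1"
    define E where "E = cmod (\<xi> - of_real x * lam)"
    have E: "1 - x \<le> E" "0 < E" using max_ang_le(2)[OF lam \<xi> x] x unfolding E_def by linarith+
    have wx: "w x \<le> 2 * (1 - x) / E"
    proof -
      have "(1 - x) * poisson_kernel (of_real x * lam) \<xi> = (1 - x) * (1 - x\<^sup>2) / E\<^sup>2"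
        using lam x by (simp add: poisson_kernel_def E_def norm_mult)
      also have "1 - x\<^sup>2 = (1 - x) * (1 + x)" by (simp add: power2_eq_square algebra_simps)
      \<comment> \<open>Rounding \<open>1 + x\<close> up to 4 yields a perfect square.\<close>
      also have "(1 - x) * ((1 - x) * (1 + x)) / E\<^sup>2 \<le> (1 - x) * ((1 - x) * 4) / E\<^sup>2"
        using x by (intro divide_right_mono mult_left_mono) auto
      also have "(1 - x) * ((1 - x) * 4) = (2 * (1 - x))\<^sup>2" by (simp add: power2_eq_square algebra_simps)
      also have "(2 * (1 - x))\<^sup>2 / E\<^sup>2 = (2 * (1 - x) / E)\<^sup>2" by (simp only: power_divide)
      finally have "sqrt ((1 - x) * poisson_kernel (of_real x * lam) \<xi>) \<le> 2 * (1 - x) / E"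
        using E x by (intro real_le_lsqrt) auto
      then show ?thesis using x by (simp add: w_def)
    qed
    show "AE \<zeta> in arc_measure. w x * \<bar>v \<zeta> - c\<bar> / (cmod (\<zeta> - of_real x * lam))\<^sup>2 \<le> 4 * g \<zeta> / cmod (\<zeta> - of_real x * lam)"
      using AE_arc_measure_ang_pos[OF \<xi>] AE_space
    proof eventually_elim
      case (elim \<zeta>)
      then have \<zeta>: "\<zeta> \<in> circle" and ne: "\<zeta> \<noteq> \<xi>" using \<xi> by auto
      define D where "D = cmod (\<zeta> - of_real x * lam)"
      have D: "1 - x \<le> D" "0 < D" using max_ang_le(2)[OF lam \<zeta> x] x unfolding D_def by linarith+
      have "cmod (\<zeta> - \<xi>) \<le> D + E"
        using norm_triangle_ineq4[of "\<zeta> - of_real x * lam" "\<xi> - of_real x * lam"] by (simp add: D_def E_def)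
      then have "(1 - x) * cmod (\<zeta> - \<xi>) \<le> (1 - x) * (D + E)" using x by (intro mult_left_mono) auto
      also have "\<dots> \<le> E * D + D * E"
        unfolding distrib_left using D E by (intro add_mono mult_right_mono) auto
      finally have key: "(1 - x) * cmod (\<zeta> - \<xi>) \<le> 2 * D * E" by simp
      have "w x * \<bar>v \<zeta> - c\<bar> / D\<^sup>2 = w x * cmod (\<zeta> - \<xi>) * g \<zeta> / D\<^sup>2"
        using ne by (simp add: g_def)
      also have "\<dots> \<le> (2 * (1 - x) / E) * cmod (\<zeta> - \<xi>) * g \<zeta> / D\<^sup>2"
        using wx by (intro divide_right_mono mult_right_mono) (auto simp: g_def)
      also have "\<dots> = ((1 - x) * cmod (\<zeta> - \<xi>)) * (2 * g \<zeta> / (E * D\<^sup>2))" by simp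
      also have "\<dots> \<le> (2 * D * E) * (2 * g \<zeta> / (E * D\<^sup>2))"
        using E by (intro mult_right_mono key) (auto simp: g_def)
      also have "\<dots> = 4 * g \<zeta> / D" using D E by (simp add: power2_eq_square)
      finally show ?case by (simp add: D_def)
    qed
  qed (auto simp: g_def w0)
  \<comment> \<open>The kernel has mean zero, so the constant \<open>c\<close> leaves the radial
    derivative unchanged.\<close>
  have "(\<integral>\<zeta>. radial_kernel lam x \<zeta> * (v \<zeta> - c) \<partial>arc_measure) = (\<integral>\<zeta>. radial_kernel lam x \<zeta> * v \<zeta> \<partial>arc_measure)"
    if x: "0 \<le> x" "x < 1" for x
  proof -
    have [measurable]: "radial_kernel lam x \<in> borel_measurable arc_measure"
      using integral_radial_kernel_arc(1)[OF lam x] by simp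
    have "integrable arc_measure (\<lambda>\<zeta>. radial_kernel lam x \<zeta> * v \<zeta>)"
    proof (rule Bochner_Integration.integrable_bound)
      show "integrable arc_measure (\<lambda>\<zeta>. 2 / (1 - x)\<^sup>2 * v \<zeta>)" using v by simp
      show "AE \<zeta> in arc_measure. norm (radial_kernel lam x \<zeta> * v \<zeta>) \<le> norm (2 / (1 - x)\<^sup>2 * v \<zeta>)"
        unfolding real_norm_def abs_mult using radial_kernel_bound'[OF lam _ x]
        by (intro AE_I2 mult_right_mono) auto
    qed measurable
    then show ?thesis
      using integral_radial_kernel_arc[OF lam x] by (simp add: right_diff_distrib)
  qed
  moreover have "(w x)\<^sup>2 = (1 - x) * poisson_kernel (of_real x * lam) \<xi>" if "0 \<le> x" "x < 1" for x
    using Pnn[OF that] that by (simp add: w_def)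
  ultimately have "(\<integral>\<^sup>+x\<in>{0..<1}. ennreal ((\<integral>\<zeta>. radial_kernel lam x \<zeta> * (v \<zeta> - c) \<partial>arc_measure)\<^sup>2 * (w x)\<^sup>2) \<partial>lborel) =
      (\<integral>\<^sup>+x\<in>{0..<1}. ennreal ((\<integral>\<zeta>. radial_kernel lam x \<zeta> * v \<zeta> \<partial>arc_measure)\<^sup>2 *
        ((1 - x) * poisson_kernel (of_real x * lam) \<xi>)) \<partial>lborel)"
    by (intro nn_integral_cong) (auto simp: indicator_def)
  with bound show ?thesis by (simp add: g_def power_divide)
qed

text \<open>The inequality holds under the integral sign: where \<open>v \<ge> 1\<close> the product
  is at least the kernel, and elsewhere \<zeta> is at distance at least \<open>d / 2\<close> from
  the radial point, so that the kernel is at most the subtracted error and the left side is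
  nonpositive. The kernel has total mass 1.\<close>

lemma poisson_average_ge:
  fixes v :: "complex \<Rightarrow> real"
  assumes lam: "lam \<in> circle" and v: "integrable arc_measure v"
    and v0: "AE \<zeta> in arc_measure. 0 \<le> v \<zeta>"
    and v1: "AE \<zeta> in arc_measure. cmod (\<zeta> - lam) < d \<longrightarrow> 1 \<le> v \<zeta>"
    and d: "0 < d" and r: "0 \<le> r" "r < 1" "1 - r < d / 2"
  shows "1 - 4 * (1 - r\<^sup>2) / d\<^sup>2 \<le> (\<integral>\<zeta>. poisson_kernel (of_real r * lam) \<zeta> * v \<zeta> \<partial>arc_measure)"
proof -
  let ?P = "poisson_kernel (of_real r * lam)"
  have z: "cmod (of_real r * lam) < 1" using r lam by (simp add: norm_mult)
  note P = integral_poisson_kernel[OF z]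
  have [measurable]: "v \<in> borel_measurable arc_measure" using v by simp
  interpret A: finite_measure arc_measure by (rule finite_measure_arc_measure)
  have m1: "measure arc_measure (space arc_measure) = 1"
    using emeasure_arc_measure by (simp add: measure_def)
  have r2: "0 \<le> 1 - r\<^sup>2" using r by (simp add: abs_square_le_1)
  have "1 - 4 * (1 - r\<^sup>2) / d\<^sup>2 = (\<integral>\<zeta>. ?P \<zeta> - 4 * (1 - r\<^sup>2) / d\<^sup>2 \<partial>arc_measure)"
    using P m1 by simp
  also have "\<dots> \<le> (\<integral>\<zeta>. ?P \<zeta> * v \<zeta> \<partial>arc_measure)"
  proof (rule integral_mono_AE)
    show "integrable arc_measure (\<lambda>\<zeta>. ?P \<zeta> - 4 * (1 - r\<^sup>2) / d\<^sup>2)" using P(1) by simp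
    have [measurable]: "?P \<in> borel_measurable arc_measure" using P(1) by simp
    show "integrable arc_measure (\<lambda>\<zeta>. ?P \<zeta> * v \<zeta>)"
    proof (rule Bochner_Integration.integrable_bound)
      show "integrable arc_measure (\<lambda>\<zeta>. 1 / (1 - cmod (of_real r * lam))\<^sup>2 * v \<zeta>)" using v by simp
      show "AE \<zeta> in arc_measure. norm (?P \<zeta> * v \<zeta>) \<le> norm (1 / (1 - cmod (of_real r * lam))\<^sup>2 * v \<zeta>)"
        unfolding real_norm_def abs_mult
        using poisson_kernel_bounded[OF z] poisson_kernel_nonneg[OF z]
        by (intro AE_I2 mult_right_mono) auto
    qed measurable
    show "AE \<zeta> in arc_measure. ?P \<zeta> - 4 * (1 - r\<^sup>2) / d\<^sup>2 \<le> ?P \<zeta> * v \<zeta>"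
      using v0 v1 AE_space
    proof eventually_elim
      case (elim \<zeta>)
      then have \<zeta>: "\<zeta> \<in> circle" by simp
      note p0 = poisson_kernel_nonneg[OF z, of \<zeta>]
      show ?case
      proof (cases "cmod (\<zeta> - lam) < d")
        case True
        then have "?P \<zeta> * 1 \<le> ?P \<zeta> * v \<zeta>" using elim p0 by (intro mult_left_mono) auto
        moreover have "0 \<le> 4 * (1 - r\<^sup>2) / d\<^sup>2" using r2 by simp
        ultimately show ?thesis by linarith
      next
        case False
        have "lam - of_real r * lam = of_real (1 - r) * lam" by (simp add: algebra_simps)
        then have "cmod (lam - of_real r * lam) = 1 - r" using lam r by (simp only: norm_mult norm_of_real) simp
        then have "d / 2 \<le> cmod (\<zeta> - of_real r * lam)"
          using False r norm_triangle_ineq4[of "\<zeta> - of_real r * lam" "lam - of_real r * lam"] by simp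
        then have "(d / 2)\<^sup>2 \<le> (cmod (\<zeta> - of_real r * lam))\<^sup>2" using d by (intro power_mono) auto
        then have "?P \<zeta> \<le> (1 - r\<^sup>2) / (d / 2)\<^sup>2"
          unfolding poisson_kernel_def using r2 r lam d by (intro frac_le) (auto simp: norm_mult)
        also have "\<dots> = 4 * (1 - r\<^sup>2) / d\<^sup>2" by (simp add: power_divide)
        finally have "?P \<zeta> - 4 * (1 - r\<^sup>2) / d\<^sup>2 \<le> 0" by simp
        also have "0 \<le> ?P \<zeta> * v \<zeta>" using p0 elim by simp
        finally show ?thesis .
      qed
    qed
  qed
  finally show ?thesis .
qed

context
  fixes \<mu> :: "complex measure" and lam :: complex
  assumes finite_mu: "finite_measure \<mu>" and sets_mu: "sets \<mu> = sets circle_borel" and lam: "lam \<in> circle"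
begin

interpretation finite_measure \<mu> by (rule finite_mu)

lemma poisson_measure_nonneg:
  assumes "0 \<le> x" "x < 1" shows "0 \<le> poisson_measure \<mu> (of_real x * lam)"
  unfolding poisson_measure_def
  using assms lam by (intro integral_nonneg_AE AE_I2 poisson_kernel_nonneg) (simp add: norm_mult)

text \<open>The local bound, with \<open>c\<close> the real part of the nontangential limit, is
  integrated over \<mu>, and Tonelli turns the Poisson kernels into \<open>poisson_measure\<close>.
  Where the limit does not exist, the local Dirichlet integral is infinite. The L2 bound supplies
  the term \<open>(1 - x)\<^sup>2\<close>.\<close>

lemma radial_derivative_bound:
  assumes u: "u \<in> borel_measurable arc_measure" and v: "integrable arc_measure (\<lambda>\<zeta>. Re (u \<zeta>))"
  shows "(\<integral>\<^sup>+x\<in>{0..<1}. ennreal ((\<integral>\<zeta>. radial_kernel lam x \<zeta> * Re (u \<zeta>) \<partial>arc_measure)\<^sup>2 *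
      ((1 - x) * poisson_measure \<mu> (of_real x * lam) + (1 - x)\<^sup>2)) \<partial>lborel)
    \<le> 8192 * dirichlet_norm_sq \<mu> u"
proof -
  interpret A: finite_measure arc_measure by (rule finite_measure_arc_measure)
  note [measurable] = measurable_pair_circle_borel[OF sets_arc_measure radial_kernel_measurable] u
  define V where "V x = (\<integral>\<zeta>. radial_kernel lam x \<zeta> * Re (u \<zeta>) \<partial>arc_measure)" for x
  have [measurable]: "V \<in> borel_measurable borel"
    using A.borel_measurable_lebesgue_integral[of "\<lambda>x \<zeta>. radial_kernel lam x \<zeta> * Re (u \<zeta>)" lborel]
    unfolding V_def[abs_def] by simp
  have [measurable]: "case_prod (\<lambda>x. poisson_kernel (of_real x * lam)) \<in> borel_measurable (lborel \<Otimes>\<^sub>M \<mu>)"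
    by (rule measurable_pair_circle_borel[OF sets_mu]) (simp add: poisson_kernel_def[abs_def])
  have [measurable]: "(\<lambda>x. poisson_measure \<mu> (of_real x * lam)) \<in> borel_measurable borel"
    using borel_measurable_lebesgue_integral[of "\<lambda>x. poisson_kernel (of_real x * lam)" lborel]
    unfolding poisson_measure_def by simp
  define F where "F \<xi> = (\<integral>\<^sup>+x\<in>{0..<1}. ennreal ((V x)\<^sup>2 * ((1 - x) * poisson_kernel (of_real x * lam) \<xi>)) \<partial>lborel)" for \<xi>
  interpret P: pair_sigma_finite lborel \<mu> ..
  have [measurable]: "F \<in> borel_measurable \<mu>"
    unfolding F_def[abs_def] by measurable
  have "(\<integral>\<^sup>+x\<in>{0..<1}. ennreal ((V x)\<^sup>2 * ((1 - x) * poisson_measure \<mu> (of_real x * lam))) \<partial>lborel) =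
      (\<integral>\<^sup>+x. (\<integral>\<^sup>+\<xi>. ennreal ((V x)\<^sup>2 * ((1 - x) * poisson_kernel (of_real x * lam) \<xi>)) * indicator {0..<1} x \<partial>\<mu>) \<partial>lborel)"
  proof (intro nn_integral_cong)
    fix x :: real
    show "ennreal ((V x)\<^sup>2 * ((1 - x) * poisson_measure \<mu> (of_real x * lam))) * indicator {0..<1} x =
        (\<integral>\<^sup>+\<xi>. ennreal ((V x)\<^sup>2 * ((1 - x) * poisson_kernel (of_real x * lam) \<xi>)) * indicator {0..<1} x \<partial>\<mu>)"
    proof (cases "0 \<le> x \<and> x < 1")
      case True
      then have z: "cmod (of_real x * lam) < 1" using lam by (simp add: norm_mult)
      note ip = integrable_poisson_kernel_mu[OF finite_mu sets_mu lam z]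
      have "(\<integral>\<^sup>+\<xi>. ennreal ((V x)\<^sup>2 * ((1 - x) * poisson_kernel (of_real x * lam) \<xi>)) \<partial>\<mu>) =
          ennreal (\<integral>\<xi>. (V x)\<^sup>2 * ((1 - x) * poisson_kernel (of_real x * lam) \<xi>) \<partial>\<mu>)"
        using True ip by (intro nn_integral_eq_integral AE_I2 mult_nonneg_nonneg poisson_kernel_nonneg z) auto
      then show ?thesis using True by (simp add: poisson_measure_def)
    qed auto
  qed
  also have "\<dots> = (\<integral>\<^sup>+\<xi>. F \<xi> \<partial>\<mu>)"
    unfolding F_def by (rule P.Fubini'[symmetric]) measurable
  \<comment> \<open>The constant is moved onto \<open>F\<close>, which is known to be measurable:
    pulling it out of the integral of \<open>local_dirichlet\<close> would require measurability in
    \<xi>, which is not established.\<close>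
  also have "\<dots> = 8192 * (\<integral>\<^sup>+\<xi>. F \<xi> / 8192 \<partial>\<mu>)"
    by (subst nn_integral_divide) (auto simp: ennreal_times_divide mult.commute[of 8192] ennreal_mult_divide_eq)
  also have "(\<integral>\<^sup>+\<xi>. F \<xi> / 8192 \<partial>\<mu>) \<le> dirichlet_integral \<mu> u"
    unfolding dirichlet_integral_def
  proof (rule nn_integral_mono)
    fix \<xi> assume "\<xi> \<in> space \<mu>"
    then have \<xi>: "\<xi> \<in> circle" using space_mu[OF finite_mu sets_mu lam] by simp
    show "F \<xi> / 8192 \<le> local_dirichlet \<xi> u"
    proof (cases "\<exists>L. has_nt_limit (poisson_fun u) \<xi> L")
      case True
      have [measurable]: "(\<lambda>\<zeta>. cmod (\<zeta> - \<xi>)) \<in> borel_measurable arc_measure"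
        by (rule measurable_circle_borel) auto
      define L where "L = nt_limit (poisson_fun u) \<xi>"
      have "F \<xi> \<le> 8192 * (\<integral>\<^sup>+\<zeta>. ennreal ((Re (u \<zeta>) - Re L)\<^sup>2 / (cmod (\<zeta> - \<xi>))\<^sup>2) \<partial>arc_measure)"
        unfolding F_def V_def by (rule radial_derivative_local_bound[OF lam \<xi> v])
      also have "\<dots> \<le> 8192 * (\<integral>\<^sup>+\<zeta>. ennreal ((cmod (u \<zeta> - L))\<^sup>2 / (cmod (\<zeta> - \<xi>))\<^sup>2) \<partial>arc_measure)"
      proof (rule mult_left_mono, rule nn_integral_mono, rule ennreal_leI, rule divide_right_mono)
        fix \<zeta>
        have "\<bar>Re (u \<zeta>) - Re L\<bar> \<le> cmod (u \<zeta> - L)" using abs_Re_le_cmod[of "u \<zeta> - L"] by simp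
        then show "(Re (u \<zeta>) - Re L)\<^sup>2 \<le> (cmod (u \<zeta> - L))\<^sup>2" by (metis abs_le_square_iff abs_norm_cancel)
      qed auto
      also have "\<dots> = 8192 * local_dirichlet \<xi> u" using True by (auto simp: local_dirichlet_def L_def)
      finally have "F \<xi> / 8192 \<le> 8192 * local_dirichlet \<xi> u / 8192" by (rule divide_right_mono_ennreal)
      then show ?thesis by (simp add: mult.commute ennreal_mult_divide_eq)
    qed (simp add: local_dirichlet_def)
  qed
  finally have 1: "(\<integral>\<^sup>+x\<in>{0..<1}. ennreal ((V x)\<^sup>2 * ((1 - x) * poisson_measure \<mu> (of_real x * lam))) \<partial>lborel)
      \<le> 8192 * dirichlet_integral \<mu> u" by (simp add: mult_left_mono)
  have 2: "(\<integral>\<^sup>+x\<in>{0..<1}. ennreal ((V x)\<^sup>2 * (1 - x)\<^sup>2) \<partial>lborel) \<le> 8192 * (\<integral>\<^sup>+\<zeta>. ennreal ((cmod (u \<zeta>))\<^sup>2) \<partial>arc_measure)"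
  proof -
    have "(\<integral>\<^sup>+x\<in>{0..<1}. ennreal ((V x)\<^sup>2 * (1 - x)\<^sup>2) \<partial>lborel) \<le> 8192 * (\<integral>\<^sup>+\<zeta>. ennreal ((Re (u \<zeta>))\<^sup>2) \<partial>arc_measure)"
      unfolding V_def by (rule radial_derivative_l2_bound[OF lam v])
    also have "\<dots> \<le> 8192 * (\<integral>\<^sup>+\<zeta>. ennreal ((cmod (u \<zeta>))\<^sup>2) \<partial>arc_measure)"
      by (rule mult_left_mono, rule nn_integral_mono, rule ennreal_leI) (auto simp: cmod_power2)
    finally show ?thesis .
  qed
  have "(\<integral>\<^sup>+x\<in>{0..<1}. ennreal ((V x)\<^sup>2 * ((1 - x) * poisson_measure \<mu> (of_real x * lam) + (1 - x)\<^sup>2)) \<partial>lborel) =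
      (\<integral>\<^sup>+x\<in>{0..<1}. ennreal ((V x)\<^sup>2 * ((1 - x) * poisson_measure \<mu> (of_real x * lam))) \<partial>lborel) +
      (\<integral>\<^sup>+x\<in>{0..<1}. ennreal ((V x)\<^sup>2 * (1 - x)\<^sup>2) \<partial>lborel)"
    by (subst nn_integral_add[symmetric])
      (auto intro!: nn_integral_cong simp: indicator_def distrib_left poisson_measure_nonneg)
  also have "\<dots> \<le> 8192 * dirichlet_integral \<mu> u + 8192 * (\<integral>\<^sup>+\<zeta>. ennreal ((cmod (u \<zeta>))\<^sup>2) \<partial>arc_measure)"
    by (intro add_mono 1 2)
  also have "\<dots> = 8192 * dirichlet_norm_sq \<mu> u"
    by (simp add: dirichlet_norm_sq_def distrib_left add.commute)
  finally show ?thesis unfolding V_def .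
qed

text \<open>The bound involves \<open>I\<close> alone and neither \<open>U\<close> nor
  \<open>u\<close>. The size of \<open>U\<close> enters only through the radius \<open>r\<close> at
  which the Poisson integral is evaluated, and the integral of \<open>\<bar>V\<bar>\<close> is
  controlled on all of \<open>{0..<1}\<close>.\<close>

lemma open_capacity_lower_bound:
  assumes fin: "(\<integral>\<^sup>+x\<in>{0..<1}. ennreal (1 / ((1 - x) * poisson_measure \<mu> (of_real x * lam) + (1 - x)\<^sup>2)) \<partial>lborel) = ennreal I"
    and I: "0 \<le> I" and U: "openin (top_of_set circle) U" "lam \<in> U"
  shows "ennreal (1 / (4 * (1 + 4096 * (2 * I + 1)))) \<le> open_capacity \<mu> U"
  unfolding open_capacity_def
proof (intro Inf_greatest, clarify)
  fix u assume u: "u \<in> harmonic_dirichlet_space \<mu>"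
    and u0: "AE \<zeta> in arc_measure. u \<zeta> \<in> \<real> \<and> 0 \<le> Re (u \<zeta>)"
    and u1: "AE \<zeta> in arc_measure. \<zeta> \<in> U \<longrightarrow> 1 \<le> Re (u \<zeta>)"
  interpret A: finite_measure arc_measure by (rule finite_measure_arc_measure)
  have um[measurable]: "u \<in> borel_measurable arc_measure"
    and ul2: "(\<integral>\<^sup>+\<zeta>. ennreal ((cmod (u \<zeta>))\<^sup>2) \<partial>arc_measure) < \<infinity>"
    and fin_norm: "dirichlet_norm_sq \<mu> u < \<infinity>"
    using u by (auto simp: harmonic_dirichlet_space_def L2_circle_def)
  define v where "v = (\<lambda>\<zeta>. Re (u \<zeta>))"
  have [measurable]: "v \<in> borel_measurable arc_measure" unfolding v_def by measurable
  have vl2: "(\<integral>\<^sup>+\<zeta>. ennreal ((v \<zeta>)\<^sup>2) \<partial>arc_measure) \<le> dirichlet_norm_sq \<mu> u"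
  proof -
    have "(\<integral>\<^sup>+\<zeta>. ennreal ((v \<zeta>)\<^sup>2) \<partial>arc_measure) \<le> (\<integral>\<^sup>+\<zeta>. ennreal ((cmod (u \<zeta>))\<^sup>2) \<partial>arc_measure)"
      by (rule nn_integral_mono, rule ennreal_leI) (auto simp: cmod_power2 v_def)
    also have "\<dots> \<le> dirichlet_norm_sq \<mu> u" by (simp add: dirichlet_norm_sq_def)
    finally show ?thesis .
  qed
  have v: "integrable arc_measure v"
  proof (rule A.square_integrable_imp_integrable)
    show "integrable arc_measure (\<lambda>\<zeta>. (v \<zeta>)\<^sup>2)"
      using le_less_trans[OF vl2 fin_norm] by (intro integrableI_bounded) auto
  qed simp
  obtain N where N: "dirichlet_norm_sq \<mu> u = ennreal N" "0 \<le> N"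
    using fin_norm by (cases "dirichlet_norm_sq \<mu> u") auto
  obtain d where d: "0 < d" "\<And>\<zeta>. \<zeta> \<in> circle \<Longrightarrow> cmod (\<zeta> - lam) < d \<Longrightarrow> \<zeta> \<in> U"
  proof -
    obtain T where T: "open T" "U = circle \<inter> T" using U(1) by (auto simp: openin_open)
    then obtain d where "0 < d" "ball lam d \<subseteq> T" using U(2) by (auto simp: open_contains_ball)
    then show ?thesis using that[of d] T by (auto simp: subset_iff dist_norm norm_minus_commute)
  qed
  define V where "V x = (\<integral>\<zeta>. radial_kernel lam x \<zeta> * v \<zeta> \<partial>arc_measure)" for x
  define W where "W x = (1 - x) * poisson_measure \<mu> (of_real x * lam) + (1 - x)\<^sup>2" for x
  \<comment> \<open>The AM-GM parameter: it brings the contribution \<open>1 / (2 * A) * I\<close>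
    below 1/4, and the added 1 keeps it positive for \<open>I = 0\<close>.\<close>
  define A where "A = 2 * I + 1"
  have A: "0 < A" using I by (simp add: A_def)
  have W: "0 < W x" if "0 \<le> x" "x < 1" for x
    using that poisson_measure_nonneg[of x] by (auto simp: W_def intro!: add_nonneg_pos)
  note [measurable] = measurable_pair_circle_borel[OF sets_arc_measure radial_kernel_measurable]
  have [measurable]: "V \<in> borel_measurable borel"
    using A.borel_measurable_lebesgue_integral[of "\<lambda>x \<zeta>. radial_kernel lam x \<zeta> * v \<zeta>" lborel]
    unfolding V_def[abs_def] by simp
  have [measurable]: "case_prod (\<lambda>x. poisson_kernel (of_real x * lam)) \<in> borel_measurable (lborel \<Otimes>\<^sub>M \<mu>)"
    by (rule measurable_pair_circle_borel[OF sets_mu]) (simp add: poisson_kernel_def[abs_def])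
  have [measurable]: "W \<in> borel_measurable borel"
    using borel_measurable_lebesgue_integral[of "\<lambda>x. poisson_kernel (of_real x * lam)" lborel]
    unfolding W_def[abs_def] poisson_measure_def by simp
  have Vint: "(\<integral>\<^sup>+x\<in>{0..<1}. ennreal \<bar>V x\<bar> \<partial>lborel) \<le> ennreal (A / 2 * (8192 * N) + 1 / (2 * A) * I)"
  proof -
    have "(\<integral>\<^sup>+x\<in>{0..<1}. ennreal \<bar>V x\<bar> \<partial>lborel) \<le>
        (\<integral>\<^sup>+x. ennreal (A / 2) * (ennreal ((V x)\<^sup>2 * W x) * indicator {0..<1} x) +
          ennreal (1 / (2 * A)) * (ennreal (1 / W x) * indicator {0..<1} x) \<partial>lborel)"
    proof (rule nn_integral_mono)
      fix x
      show "ennreal \<bar>V x\<bar> * indicator {0..<1} x \<le> ennreal (A / 2) * (ennreal ((V x)\<^sup>2 * W x) * indicator {0..<1} x) +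
          ennreal (1 / (2 * A)) * (ennreal (1 / W x) * indicator {0..<1} x)"
      proof (cases "0 \<le> x \<and> x < 1")
        case True
        then have w: "0 < W x" using W by simp
        have "\<bar>V x\<bar> \<le> A / 2 * ((V x)\<^sup>2 * W x) + 1 / (2 * A) * (1 / W x)"
        proof -
          \<comment> \<open>AM-GM, obtained by expanding the square and dividing by
            \<open>2 * A * W x\<close>.\<close>
          have "0 \<le> (A * W x * \<bar>V x\<bar> - 1)\<^sup>2" by simp
          also have "\<dots> = (A * W x)\<^sup>2 * (V x)\<^sup>2 - 2 * (A * W x) * \<bar>V x\<bar> + 1"
            by (simp add: power2_eq_square algebra_simps)
          finally have "2 * (A * W x) * \<bar>V x\<bar> \<le> (A * W x)\<^sup>2 * (V x)\<^sup>2 + 1" by simp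
          then have "\<bar>V x\<bar> \<le> ((A * W x)\<^sup>2 * (V x)\<^sup>2 + 1) / (2 * (A * W x))"
            using A w by (simp add: pos_le_divide_eq mult.commute)
          also have "\<dots> = A / 2 * ((V x)\<^sup>2 * W x) + 1 / (2 * A) * (1 / W x)"
            using A w by (simp add: field_simps power2_eq_square)
          finally show ?thesis .
        qed
        then have "ennreal \<bar>V x\<bar> \<le> ennreal (A / 2 * ((V x)\<^sup>2 * W x) + 1 / (2 * A) * (1 / W x))"
          by (rule ennreal_leI)
        also have "\<dots> = ennreal (A / 2) * ennreal ((V x)\<^sup>2 * W x) + ennreal (1 / (2 * A)) * ennreal (1 / W x)"
        proof -
          have "0 \<le> A / 2" "0 \<le> 1 / (2 * A)" "0 \<le> (V x)\<^sup>2 * W x" "0 \<le> 1 / W x" using A w by auto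
          then show ?thesis by (simp only: ennreal_plus mult_nonneg_nonneg ennreal_mult)
        qed
        finally show ?thesis using True by simp
      qed auto
    qed
    also have "\<dots> = ennreal (A / 2) * (\<integral>\<^sup>+x\<in>{0..<1}. ennreal ((V x)\<^sup>2 * W x) \<partial>lborel) +
        ennreal (1 / (2 * A)) * (\<integral>\<^sup>+x\<in>{0..<1}. ennreal (1 / W x) \<partial>lborel)"
      by (subst nn_integral_add) (auto simp: nn_integral_cmult)
    also have "\<dots> \<le> ennreal (A / 2) * ennreal (8192 * N) + ennreal (1 / (2 * A)) * ennreal I"
    proof (intro add_mono mult_left_mono)
      show "(\<integral>\<^sup>+x\<in>{0..<1}. ennreal ((V x)\<^sup>2 * W x) \<partial>lborel) \<le> ennreal (8192 * N)"
        using radial_derivative_bound[OF um v[unfolded v_def]] N(2)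
        unfolding V_def W_def v_def N(1) by (simp add: ennreal_mult)
      show "(\<integral>\<^sup>+x\<in>{0..<1}. ennreal (1 / W x) \<partial>lborel) \<le> ennreal I"
        using fin by (simp add: W_def)
    qed auto
    also have "\<dots> = ennreal (A / 2 * (8192 * N) + 1 / (2 * A) * I)"
    proof -
      have "0 \<le> A / 2" "0 \<le> 1 / (2 * A)" "0 \<le> 8192 * N" using A N by auto
      with I show ?thesis by (simp only: ennreal_plus mult_nonneg_nonneg ennreal_mult)
    qed
    finally show ?thesis .
  qed
  \<comment> \<open>The three terms secure in turn \<open>0 \<le> r\<close>, the distance condition
    \<open>1 - r < d / 2\<close>, and an error \<open>4 * (1 - r\<^sup>2) / d\<^sup>2\<close> of at
    most 1/4.\<close>
  define r where "r = 1 - min (1 / 2) (min (d / 4) (d\<^sup>2 / 32))"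
  have r: "0 \<le> r" "r < 1" "1 - r < d / 2" "1 - r \<le> d\<^sup>2 / 32" using d by (auto simp: r_def min_def)
  have "1 - 4 * (1 - r\<^sup>2) / d\<^sup>2 \<le> (\<integral>\<zeta>. poisson_kernel (of_real r * lam) \<zeta> * v \<zeta> \<partial>arc_measure)"
  proof (rule poisson_average_ge[OF lam v _ _ d(1) r(1-3)])
    show "AE \<zeta> in arc_measure. 0 \<le> v \<zeta>" using u0 by (auto simp: v_def)
    show "AE \<zeta> in arc_measure. cmod (\<zeta> - lam) < d \<longrightarrow> 1 \<le> v \<zeta>"
      using u1 AE_space by eventually_elim (use d in \<open>auto simp: v_def\<close>)
  qed
  moreover have "4 * (1 - r\<^sup>2) / d\<^sup>2 \<le> 1 / 4"
  proof -
    have "1 - r\<^sup>2 = (1 - r) * (1 + r)" by (simp add: power2_eq_square algebra_simps)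
    also have "\<dots> \<le> d\<^sup>2 / 32 * 2" using r by (intro mult_mono) auto
    finally show ?thesis using d by (simp add: field_simps)
  qed
  moreover have "(\<integral>\<zeta>. poisson_kernel (of_real r * lam) \<zeta> * v \<zeta> \<partial>arc_measure) =
      (\<integral>\<zeta>. v \<zeta> \<partial>arc_measure) + (\<integral>x. indicator {0..r} x * V x \<partial>lborel)"
    unfolding V_def by (rule poisson_radial_fubini(2)[OF lam r(1,2) v])
  moreover have "(\<integral>x. indicator {0..r} x * V x \<partial>lborel) \<le> A / 2 * (8192 * N) + 1 / (2 * A) * I"
  proof -
    have "ennreal (norm (\<integral>x. indicator {0..r} x * V x \<partial>lborel)) \<le> (\<integral>\<^sup>+x. ennreal (norm (indicator {0..r} x * V x)) \<partial>lborel)"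
      using poisson_radial_fubini(1)[OF lam r(1,2) v] unfolding V_def[symmetric]
      by (rule integral_norm_bound_ennreal)
    also have "\<dots> \<le> (\<integral>\<^sup>+x\<in>{0..<1}. ennreal \<bar>V x\<bar> \<partial>lborel)"
      using r by (intro nn_integral_mono) (auto simp: indicator_def)
    also note Vint
    finally have "norm (\<integral>x. indicator {0..r} x * V x \<partial>lborel) \<le> A / 2 * (8192 * N) + 1 / (2 * A) * I"
      using A I N by (subst (asm) ennreal_le_iff) auto
    then show ?thesis unfolding real_norm_def by linarith
  qed
  moreover have "(\<integral>\<zeta>. v \<zeta> \<partial>arc_measure) \<le> 1 / 4 + N"
  proof -
    have "ennreal (norm (\<integral>\<zeta>. v \<zeta> \<partial>arc_measure)) \<le> (\<integral>\<^sup>+\<zeta>. ennreal (norm (v \<zeta>)) \<partial>arc_measure)"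
      by (rule integral_norm_bound_ennreal[OF v])
    also have "\<dots> \<le> (\<integral>\<^sup>+\<zeta>. ennreal (1 / 4) + ennreal ((v \<zeta>)\<^sup>2) \<partial>arc_measure)"
    proof (rule nn_integral_mono)
      fix \<zeta>
      \<comment> \<open>Bounding \<open>\<bar>v\<bar>\<close> by \<open>1 / 4 + v\<^sup>2\<close>
        keeps the estimate of the mean linear in \<open>N\<close>.\<close>
      have "0 \<le> (\<bar>v \<zeta>\<bar> - 1 / 2)\<^sup>2" by simp
      also have "\<dots> = (v \<zeta>)\<^sup>2 - \<bar>v \<zeta>\<bar> + 1 / 4" by (simp add: power2_eq_square algebra_simps)
      finally have "norm (v \<zeta>) \<le> 1 / 4 + (v \<zeta>)\<^sup>2" by simp
      then have "ennreal (norm (v \<zeta>)) \<le> ennreal (1 / 4 + (v \<zeta>)\<^sup>2)" by (rule ennreal_leI)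
      also have "\<dots> = ennreal (1 / 4) + ennreal ((v \<zeta>)\<^sup>2)" by (rule ennreal_plus) auto
      finally show "ennreal (norm (v \<zeta>)) \<le> ennreal (1 / 4) + ennreal ((v \<zeta>)\<^sup>2)" .
    qed
    also have "\<dots> = ennreal (1 / 4) + (\<integral>\<^sup>+\<zeta>. ennreal ((v \<zeta>)\<^sup>2) \<partial>arc_measure)"
      using emeasure_arc_measure by (subst nn_integral_add) auto
    also have "\<dots> \<le> ennreal (1 / 4) + ennreal N" using vl2 N by (intro add_left_mono) simp
    also have "\<dots> = ennreal (1 / 4 + N)" using N by simp
    finally have "norm (\<integral>\<zeta>. v \<zeta> \<partial>arc_measure) \<le> 1 / 4 + N"
      using N by (subst (asm) ennreal_le_iff) auto
    then show ?thesis unfolding real_norm_def by linarith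
  qed
  moreover have "1 / (2 * A) * I \<le> 1 / 4" using I by (simp add: A_def field_simps)
  \<comment> \<open>The Poisson integral is at least 3/4; the mean of \<open>v\<close> and the
    \<open>I\<close> term each use up 1/4, and the remaining 1/4 must come from terms proportional
    to \<open>N\<close>.\<close>
  ultimately have "1 / 4 \<le> N + A / 2 * (8192 * N)" by linarith
  then have "1 / 4 \<le> (1 + 4096 * A) * N" by (simp add: algebra_simps)
  then have "1 / (4 * (1 + 4096 * A)) \<le> N" using A by (simp add: field_simps)
  then show "ennreal (1 / (4 * (1 + 4096 * (2 * I + 1)))) \<le> dirichlet_norm_sq \<mu> u"
    unfolding N A_def by (rule ennreal_leI)
qed

text \<open>The bound for \<open>open_capacity\<close> is the same for every neighbourhood of
  \<open>lam\<close>, so it survives the infimum over them.\<close>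

lemma capacity_pos:
  assumes "(\<integral>\<^sup>+x\<in>{0..<1}. ennreal (1 / ((1 - x) * poisson_measure \<mu> (of_real x * lam) + (1 - x)\<^sup>2)) \<partial>lborel) < \<infinity>"
  shows "0 < capacity \<mu> {lam}"
proof -
  let ?J = "\<integral>\<^sup>+x\<in>{0..<1}. ennreal (1 / ((1 - x) * poisson_measure \<mu> (of_real x * lam) + (1 - x)\<^sup>2)) \<partial>lborel"
  have I: "?J = ennreal (enn2real ?J)"
    using assms by (simp only: infinity_ennreal_def ennreal_enn2real)
  have "0 < 1 / (4 * (1 + 4096 * (2 * t + 1)))" if "0 \<le> t" for t :: real
    using that by (intro divide_pos_pos) auto
  then have "0 < ennreal (1 / (4 * (1 + 4096 * (2 * enn2real ?J + 1))))"
    unfolding ennreal_less_zero_iff using enn2real_nonneg by blast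
  also have "\<dots> \<le> capacity \<mu> {lam}"
    unfolding capacity_def using open_capacity_lower_bound[OF I enn2real_nonneg] by (intro Inf_greatest) auto
  finally show ?thesis .
qed

end

theorem corollary5p2:
  fixes \<mu> :: "complex measure" and lam :: complex
  assumes "finite_measure \<mu>"
    and "sets \<mu> = sets circle_borel"
    and "lam \<in> circle"
  shows "capacity \<mu> {lam} = 0 \<longleftrightarrow>
    (\<integral>\<^sup>+x\<in>{0..<1}. ennreal (1 / ((1 - x) * poisson_measure \<mu> (of_real x * lam) + (1 - x)\<^sup>2)) \<partial>lborel)
      = \<infinity>"
proof
  assume zero: "capacity \<mu> {lam} = 0"
  show "(\<integral>\<^sup>+x\<in>{0..<1}. ennreal (1 / ((1 - x) * poisson_measure \<mu> (of_real x * lam) + (1 - x)\<^sup>2)) \<partial>lborel) = \<infinity>"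
      (is "?J = \<infinity>")
  proof (rule ccontr)
    assume "?J \<noteq> \<infinity>"
    then have "?J < \<infinity>" unfolding infinity_ennreal_def by (simp only: less_top)
    from capacity_pos[OF assms this] zero show False by simp
  qed
qed (rule capacity_eq_0[OF assms])

end
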